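(* Let $K/k$ be a finitely generated field extension, where $k$ is an algebraically closed field of characteristic $p>0$. Let $\nu$ be a valuation of $K/k$, with value group $\Gamma_\nu$, of maximal rational rank, that is, $$\dim_{\mathbb Q}(\mathbb Q\otimes_{\mathbb Z}\Gamma_\nu)=\mathrm{tr.deg}(K/k).$$ Suppose $\nu$ is centered on a Noetherian local $k$-subalgebra $(R,\mathfrak m_R,\kappa_R)$ of $K$ such that the fraction field of $R$ is $K$. If $\mathrm{gr}_\nu(R)$ is split-$F$-regular, then $\mathrm{gr}_\nu(R)$ is a finitely generated $k$-algebra.
   Context: A valuation of $K/k$ is a valuation of $K$ (with totally ordered Abelian value group of arbitrary rank) that is trivial on $k$. Let $(\mathcal O_\nu,\mathfrak m_\nu,\kappa_\nu)$ be its valuation ring. $\nu$ is centered on a local domain $(R,\mathfrak m_R,\kappa_R)$ with fraction field $K$ if $\mathcal O_\nu$ dominates $R$, i.e. $R\subseteq\mathcal O_\nu$ and $\mathfrak m_\nu\cap R=\mathfrak m_R$. Put $\Phi_R=\nu(R-\{0\})$, a submonoid of $\Gamma_\nu$. For $m\in\Phi_R$ define the ideals $\mathfrak a_{\ge m}(R)=\{r\in R:\nu(r)\ge m\}\cup\{0\}$ and $\mathfrak a_{>m}(R)=\{r\in R:\nu(r)>m\}\cup\{0\}$. The associated graded ring of $R$ along $\nu$ is the $\Phi_R$-graded $\kappa_R$-algebra $\mathrm{gr}_\nu(R)=\bigoplus_{m\in\Phi_R}\mathfrak a_{\ge m}(R)/\mathfrak a_{>m}(R)$; it is an integral domain. For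 a commutative ring $A$ of prime characteristic $p$ and $e>0$, $F^e_*A$ denotes $A$ viewed as an $A$-module by restriction of scalars along $a\mapsto a^{p^e}$, with elements written $F^e_*x$. An integral domain $A$ of characteristic $p>0$ (not assumed Noetherian nor $F$-finite) is split-$F$-regular if for every $c\in A\setminus\{0\}$ there is an integer $e>0$ such that the $A$-linear map $A\to F^e_*A$, $1\mapsto F^e_*c$, splits as a map of $A$-modules. *)

theory Defs
  imports
    "HOL-Algebra.Algebra"
    "HOL-Library.Poly_Mapping"
    "HOL-Library.Equipollence"
begin

section \<open>The tensor product of the rational numbers with an abelian group\<close>

text \<open>The tensor product over the integers of the rationals and \<^typ>\<open>'g\<close> is the free abelian
  group on pairs modulo the subgroup generated by the biadditivity relations.\<close>

inductive_set biadd_rel :: "((rat \<times> 'g::ab_group_add) \<Rightarrow>\<^sub>0 int) set" where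
  zero: "0 \<in> biadd_rel"
| diff: "\<lbrakk> x \<in> biadd_rel; y \<in> biadd_rel \<rbrakk> \<Longrightarrow> x - y \<in> biadd_rel"
| left: "frag_of (q + r, g) - frag_of (q, g) - frag_of (r, g) \<in> biadd_rel"
| right: "frag_of (q, g + h) - frag_of (q, g) - frag_of (q, h) \<in> biadd_rel"

lemma biadd_rel_uminus: "x \<in> biadd_rel \<Longrightarrow> - x \<in> biadd_rel"
  using biadd_rel.diff[OF biadd_rel.zero] by fastforce

lemma biadd_rel_add: "x \<in> biadd_rel \<Longrightarrow> y \<in> biadd_rel \<Longrightarrow> x + y \<in> biadd_rel"
  using biadd_rel.diff[of x "- y"] biadd_rel_uminus[of y] by simp

definition tensor_eq ::
    "((rat \<times> 'g::ab_group_add) \<Rightarrow>\<^sub>0 int) \<Rightarrow> ((rat \<times> 'g) \<Rightarrow>\<^sub>0 int) \<Rightarrow> bool" where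
  "tensor_eq x y \<longleftrightarrow> x - y \<in> biadd_rel"

quotient_type (overloaded) 'g rat_tensor = "(rat \<times> 'g::ab_group_add) \<Rightarrow>\<^sub>0 int" / tensor_eq
proof (rule equivpI)
  show "reflp (tensor_eq :: _ \<Rightarrow> (rat \<times> 'g \<Rightarrow>\<^sub>0 int) \<Rightarrow> bool)"
    by (auto intro!: reflpI simp: tensor_eq_def biadd_rel.zero)
  show "symp (tensor_eq :: _ \<Rightarrow> (rat \<times> 'g \<Rightarrow>\<^sub>0 int) \<Rightarrow> bool)"
    using biadd_rel_uminus by (auto intro!: sympI simp: tensor_eq_def) fastforce
  show "transp (tensor_eq :: _ \<Rightarrow> (rat \<times> 'g \<Rightarrow>\<^sub>0 int) \<Rightarrow> bool)"
    using biadd_rel_add by (auto intro!: transpI simp: tensor_eq_def) fastforce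
qed

instantiation rat_tensor :: (ab_group_add) ab_group_add
begin

lift_definition zero_rat_tensor :: "'a rat_tensor" is 0 .

lift_definition plus_rat_tensor :: "'a rat_tensor \<Rightarrow> 'a rat_tensor \<Rightarrow> 'a rat_tensor" is "(+)"
  using biadd_rel_add by (fastforce simp: tensor_eq_def algebra_simps)

lift_definition uminus_rat_tensor :: "'a rat_tensor \<Rightarrow> 'a rat_tensor" is uminus
  using biadd_rel_uminus by (fastforce simp: tensor_eq_def)

lift_definition minus_rat_tensor :: "'a rat_tensor \<Rightarrow> 'a rat_tensor \<Rightarrow> 'a rat_tensor" is "(-)"
  using biadd_rel.diff by (fastforce simp: tensor_eq_def algebra_simps)

instance
  by standard (transfer; simp add: tensor_eq_def biadd_rel.zero algebra_simps)+

end

lift_definition pure_tensor :: "rat \<Rightarrow> 'g::ab_group_add \<Rightarrow> 'g rat_tensor" is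
  "\<lambda>q g. frag_of (q, g)" .

abbreviation frag_scale ::
    "rat \<Rightarrow> ((rat \<times> 'g::ab_group_add) \<Rightarrow>\<^sub>0 int) \<Rightarrow> ((rat \<times> 'g) \<Rightarrow>\<^sub>0 int)" where
  "frag_scale q \<equiv> frag_extend (\<lambda>(r, g). frag_of (q * r, g))"

lemma biadd_rel_frag_scale: "x \<in> biadd_rel \<Longrightarrow> frag_scale q x \<in> biadd_rel"
  by (induction rule: biadd_rel.induct)
     (auto simp: frag_extend_diff distrib_left intro: biadd_rel.intros)

lift_definition rat_tensor_scale :: "rat \<Rightarrow> 'g::ab_group_add rat_tensor \<Rightarrow> 'g rat_tensor" is
  frag_scale
  using biadd_rel_frag_scale by (fastforce simp: tensor_eq_def simp flip: frag_extend_diff)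

lemma rat_tensor_scale_pure: "rat_tensor_scale q (pure_tensor r g) = pure_tensor (q * r) g"
  by transfer (simp add: tensor_eq_def biadd_rel.zero)

lemma frag_scale_add_left: "frag_scale (a + b) x - (frag_scale a x + frag_scale b x) \<in> biadd_rel"
proof (induction rule: frag_induction[OF subset_UNIV[of "Poly_Mapping.keys x"]])
  case (2 c)
  show ?case
    by (cases c) (use biadd_rel.left in \<open>simp add: distrib_right diff_diff_eq\<close>)
next
  case (3 x y)
  then show ?case
    using biadd_rel.diff by (fastforce simp: frag_extend_diff algebra_simps)
qed (auto simp: biadd_rel.zero)

lemma frag_scale_frag_scale: "frag_scale a (frag_scale b x) = frag_scale (a * b) x"
  by (induction rule: frag_induction[OF subset_UNIV[of "Poly_Mapping.keys x"]])
     (auto simp: frag_extend_diff mult.assoc)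

lemma frag_scale_one: "frag_scale 1 x = x"
  by (induction rule: frag_induction[OF subset_UNIV[of "Poly_Mapping.keys x"]])
     (auto simp: frag_extend_diff)

global_interpretation rat_tensor: vector_space "rat_tensor_scale"
proof
  show "rat_tensor_scale a (x + y) = rat_tensor_scale a x + rat_tensor_scale a y"
    for a and x y :: "'g::ab_group_add rat_tensor"
    by transfer (simp add: tensor_eq_def frag_extend_add biadd_rel.zero)
  show "rat_tensor_scale (a + b) x = rat_tensor_scale a x + rat_tensor_scale b x"
    for a b and x :: "'g::ab_group_add rat_tensor"
    by transfer (simp add: tensor_eq_def frag_scale_add_left)
  show "rat_tensor_scale a (rat_tensor_scale b x) = rat_tensor_scale (a * b) x"
    for a b and x :: "'g::ab_group_add rat_tensor"
    by transfer (simp add: tensor_eq_def frag_scale_frag_scale biadd_rel.zero)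
  show "rat_tensor_scale 1 x = x" for x :: "'g::ab_group_add rat_tensor"
    by transfer (simp only: tensor_eq_def frag_scale_one diff_self biadd_rel.zero)
qed

definition rat_tensor_basis :: "'g::ab_group_add rat_tensor set \<Rightarrow> bool" where
  "rat_tensor_basis B \<longleftrightarrow> rat_tensor.independent B \<and> rat_tensor.span B = UNIV"


section \<open>Field extensions\<close>

definition ring_char :: "('a, 'b) ring_scheme \<Rightarrow> nat \<Rightarrow> bool" where
  "ring_char A p \<longleftrightarrow> (\<forall>n::nat. [n] \<cdot>\<^bsub>A\<^esub> \<one>\<^bsub>A\<^esub> = \<zero>\<^bsub>A\<^esub> \<longleftrightarrow> p dvd n)"

definition fin_gen_field_ext :: "('a, 'b) ring_scheme \<Rightarrow> 'a set \<Rightarrow> bool" where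
  "fin_gen_field_ext K k \<longleftrightarrow>
     (\<exists>S. finite S \<and> S \<subseteq> carrier K \<and> generate_field K (k \<union> S) = carrier K)"

text \<open>In the library's polynomial ring with indeterminates indexed by \<open>S\<close>, a polynomial maps
  each monomial, a finite multiset over \<open>S\<close>, to its coefficient. The next definition evaluates
  such a polynomial by substituting for each indeterminate its own index.\<close>

definition indexed_subst :: "('a, 'b) ring_scheme \<Rightarrow> ('a multiset \<Rightarrow> 'a) \<Rightarrow> 'a" where
  "indexed_subst K P =
     (\<Oplus>\<^bsub>K\<^esub> m \<in> {m. P m \<noteq> \<zero>\<^bsub>K\<^esub>}. P m \<otimes>\<^bsub>K\<^esub> (\<Otimes>\<^bsub>K\<^esub> s \<in> set_mset m. s [^]\<^bsub>K\<^esub> count m s))"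

definition alg_independent :: "('a, 'b) ring_scheme \<Rightarrow> 'a set \<Rightarrow> 'a set \<Rightarrow> bool" where
  "alg_independent K k S \<longleftrightarrow>
     S \<subseteq> carrier K \<and>
     (\<forall>P \<in> ring.indexed_pset K S k.
        indexed_subst K P = \<zero>\<^bsub>K\<^esub> \<longrightarrow> P = ring.indexed_const K \<zero>\<^bsub>K\<^esub>)"

definition transcendence_basis :: "('a, 'b) ring_scheme \<Rightarrow> 'a set \<Rightarrow> 'a set \<Rightarrow> bool" where
  "transcendence_basis K k S \<longleftrightarrow>
     alg_independent K k S \<and>
     (\<forall>x \<in> carrier K. (ring.algebraic K over generate_field K (k \<union> S)) x)"


section \<open>Valuations and their centers\<close>

text \<open>A valuation is only meaningful on the nonzero elements; its value at zero is never used.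
  It maps onto \<^typ>\<open>'g\<close>, so that \<^typ>\<open>'g\<close> is its value group.\<close>

definition valuation_over ::
    "('a, 'b) ring_scheme \<Rightarrow> 'a set \<Rightarrow> ('a \<Rightarrow> 'g::linordered_ab_group_add) \<Rightarrow> bool" where
  "valuation_over K k \<nu> \<longleftrightarrow>
     (\<forall>x \<in> carrier K - {\<zero>\<^bsub>K\<^esub>}. \<forall>y \<in> carrier K - {\<zero>\<^bsub>K\<^esub>}. \<nu> (x \<otimes>\<^bsub>K\<^esub> y) = \<nu> x + \<nu> y) \<and>
     (\<forall>x \<in> carrier K - {\<zero>\<^bsub>K\<^esub>}. \<forall>y \<in> carrier K - {\<zero>\<^bsub>K\<^esub>}.
        x \<oplus>\<^bsub>K\<^esub> y \<noteq> \<zero>\<^bsub>K\<^esub> \<longrightarrow> min (\<nu> x) (\<nu> y) \<le> \<nu> (x \<oplus>\<^bsub>K\<^esub> y)) \<and>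
     (\<forall>x \<in> k - {\<zero>\<^bsub>K\<^esub>}. \<nu> x = 0) \<and>
     \<nu> ` (carrier K - {\<zero>\<^bsub>K\<^esub>}) = UNIV"

definition val_ring ::
    "('a, 'b) ring_scheme \<Rightarrow> ('a \<Rightarrow> 'g::linordered_ab_group_add) \<Rightarrow> 'a set" where
  "val_ring K \<nu> = {x \<in> carrier K. x = \<zero>\<^bsub>K\<^esub> \<or> 0 \<le> \<nu> x}"

definition val_maximal_ideal ::
    "('a, 'b) ring_scheme \<Rightarrow> ('a \<Rightarrow> 'g::linordered_ab_group_add) \<Rightarrow> 'a set" where
  "val_maximal_ideal K \<nu> = {x \<in> carrier K. x = \<zero>\<^bsub>K\<^esub> \<or> 0 < \<nu> x}"

definition local_ring :: "('a, 'b) ring_scheme \<Rightarrow> 'a set \<Rightarrow> bool" where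
  "local_ring A \<mm> \<longleftrightarrow> cring A \<and> maximalideal \<mm> A \<and> (\<forall>\<nn>. maximalideal \<nn> A \<longrightarrow> \<nn> = \<mm>)"

definition centered_on ::
    "('a, 'b) ring_scheme \<Rightarrow> ('a \<Rightarrow> 'g::linordered_ab_group_add) \<Rightarrow> 'a set \<Rightarrow> 'a set \<Rightarrow> bool" where
  "centered_on K \<nu> R \<mm> \<longleftrightarrow> R \<subseteq> val_ring K \<nu> \<and> val_maximal_ideal K \<nu> \<inter> R = \<mm>"

definition is_fraction_field :: "('a, 'b) ring_scheme \<Rightarrow> 'a set \<Rightarrow> bool" where
  "is_fraction_field K R \<longleftrightarrow>
     carrier K = {a \<otimes>\<^bsub>K\<^esub> inv\<^bsub>K\<^esub> b |a b. a \<in> R \<and> b \<in> R - {\<zero>\<^bsub>K\<^esub>}}"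


section \<open>The associated graded ring along a valuation\<close>

definition value_monoid ::
    "('a, 'b) ring_scheme \<Rightarrow> ('a \<Rightarrow> 'g::linordered_ab_group_add) \<Rightarrow> 'g set" where
  "value_monoid A \<nu> = \<nu> ` (carrier A - {\<zero>\<^bsub>A\<^esub>})"

definition ideal_ge ::
    "('a, 'b) ring_scheme \<Rightarrow> ('a \<Rightarrow> 'g::linordered_ab_group_add) \<Rightarrow> 'g \<Rightarrow> 'a set" where
  "ideal_ge A \<nu> m = {r \<in> carrier A. r = \<zero>\<^bsub>A\<^esub> \<or> m \<le> \<nu> r}"

definition ideal_gt ::
    "('a, 'b) ring_scheme \<Rightarrow> ('a \<Rightarrow> 'g::linordered_ab_group_add) \<Rightarrow> 'g \<Rightarrow> 'a set" where
  "ideal_gt A \<nu> m = {r \<in> carrier A. r = \<zero>\<^bsub>A\<^esub> \<or> m < \<nu> r}"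

text \<open>The additive quotient group is a monoid in the library's multiplicative notation.\<close>

definition gr_piece ::
    "('a, 'b) ring_scheme \<Rightarrow> ('a \<Rightarrow> 'g::linordered_ab_group_add) \<Rightarrow> 'g \<Rightarrow> 'a set monoid" where
  "gr_piece A \<nu> m = add_monoid (A\<lparr>carrier := ideal_ge A \<nu> m\<rparr>) Mod ideal_gt A \<nu> m"

definition gr_const ::
    "('a, 'b) ring_scheme \<Rightarrow> ('a \<Rightarrow> 'g::linordered_ab_group_add) \<Rightarrow> 'a \<Rightarrow> ('g \<Rightarrow> 'a set)" where
  "gr_const A \<nu> c =
     (\<lambda>m \<in> value_monoid A \<nu>. if m = 0 then ideal_gt A \<nu> 0 +>\<^bsub>A\<^esub> c else ideal_gt A \<nu> m)"

text \<open>The product extends biadditively the product of homogeneous classes induced by the product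
  of representatives. The sum giving its component of degree \<open>m\<close> (a \<open>finprod\<close>, because the
  pieces are written multiplicatively) is restricted to the supports of the factors, since \<open>m\<close>
  may have infinitely many decompositions.\<close>

definition gr :: "('a, 'b) ring_scheme \<Rightarrow> ('a \<Rightarrow> 'g::linordered_ab_group_add) \<Rightarrow> ('g \<Rightarrow> 'a set) ring"
  where
  "gr A \<nu> =
     \<lparr>carrier = carrier (sum_group (value_monoid A \<nu>) (gr_piece A \<nu>)),
      monoid.mult = (\<lambda>f g. \<lambda>m \<in> value_monoid A \<nu>.
        finprod (gr_piece A \<nu> m) (\<lambda>(i, j). rcoset_mult A (ideal_gt A \<nu> m) (f i) (g j))
          {(i, j). i \<in> value_monoid A \<nu> \<and> j \<in> value_monoid A \<nu> \<and> i + j = m \<and>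
                   f i \<noteq> ideal_gt A \<nu> i \<and> g j \<noteq> ideal_gt A \<nu> j}),
      one = gr_const A \<nu> \<one>\<^bsub>A\<^esub>,
      ring.zero = monoid.one (sum_group (value_monoid A \<nu>) (gr_piece A \<nu>)),
      ring.add = monoid.mult (sum_group (value_monoid A \<nu>) (gr_piece A \<nu>))\<rparr>"

text \<open>Here \<open>k\<close> is the image in \<open>A\<close> of the base ring of the algebra.\<close>

definition fin_gen_algebra :: "('a, 'b) ring_scheme \<Rightarrow> 'a set \<Rightarrow> bool" where
  "fin_gen_algebra A k \<longleftrightarrow>
     (\<exists>S. finite S \<and> S \<subseteq> carrier A \<and> generate_ring A (k \<union> S) = carrier A)"


section \<open>Split F-regularity\<close>

definition module_hom ::
    "('a, 'b) ring_scheme \<Rightarrow> ('a, 'c, 'd) module_scheme \<Rightarrow> ('a, 'e, 'f) module_scheme \<Rightarrow> ('c \<Rightarrow> 'e) set"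
  where
  "module_hom A M N =
     {h \<in> hom (add_monoid M) (add_monoid N).
        \<forall>a \<in> carrier A. \<forall>x \<in> carrier M. h (a \<odot>\<^bsub>M\<^esub> x) = a \<odot>\<^bsub>N\<^esub> h x}"

definition module_splits ::
    "('a, 'b) ring_scheme \<Rightarrow> ('a, 'c, 'd) module_scheme \<Rightarrow> ('a, 'e, 'f) module_scheme \<Rightarrow> ('c \<Rightarrow> 'e) \<Rightarrow> bool"
  where
  "module_splits A M N h \<longleftrightarrow> (\<exists>g \<in> module_hom A N M. \<forall>x \<in> carrier M. g (h x) = x)"

definition self_module :: "('a, 'b) ring_scheme \<Rightarrow> ('a, 'a) module" where
  "self_module A =
     \<lparr>carrier = carrier A, monoid.mult = monoid.mult A, one = monoid.one A, ring.zero = ring.zero A, ring.add = ring.add A,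
      smult = monoid.mult A\<rparr>"

definition frobenius_module :: "nat \<Rightarrow> nat \<Rightarrow> ('a, 'b) ring_scheme \<Rightarrow> ('a, 'a) module" where
  "frobenius_module p e A =
     \<lparr>carrier = carrier A, monoid.mult = monoid.mult A, one = monoid.one A, ring.zero = ring.zero A, ring.add = ring.add A,
      smult = (\<lambda>a x. (a [^]\<^bsub>A\<^esub> (p ^ e)) \<otimes>\<^bsub>A\<^esub> x)\<rparr>"

definition split_F_regular :: "nat \<Rightarrow> ('a, 'b) ring_scheme \<Rightarrow> bool" where
  "split_F_regular p A \<longleftrightarrow>
     domain A \<and> Factorial_Ring.prime p \<and> ring_char A p \<and>
     (\<forall>c \<in> carrier A - {\<zero>\<^bsub>A\<^esub>}. \<exists>e>0.
        module_splits A (self_module A) (frobenius_module p e A)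
          (\<lambda>a. a \<odot>\<^bsub>frobenius_module p e A\<^esub> c))"

end

theory Submission
  imports Defs Complex_Main
begin

text \<open>Since the rational rank is maximal, comparing the growth of monomials in elements with
  independent values to the growth of \<open>K\<close> over a transcendence basis shows that the value group
  \<open>\<Gamma>\<close> is finitely generated and that the residue field is \<open>k\<close>. Hence all pieces of the graded ring
  are lines, and it is enough to generate the value monoid \<open>\<Phi>\<close>. A splitting of \<open>1 \<mapsto> F_* c\<close> for a
  homogeneous \<open>c\<close> of degree \<open>d\<close> gives a \<open>q \<ge> 2\<close> such that \<open>d + q u \<in> \<Phi>\<close> implies \<open>u \<in> \<Phi>\<close>. This makes
  \<open>\<Phi>\<close> saturated and completely integrally closed, so, for an interior point \<open>c\<close>, the monoid is the
  locus where \<open>h(u) = sup {a / n | n u - a c \<in> \<Phi>}\<close> is nonnegative. Applied to \<open>d = c\<close> the condition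
  says that the fractional part of \<open>h\<close> never enters \<open>[1 - 1/q, 1)\<close>; as \<open>h\<close> is homogeneous, it takes
  values in \<open>(1/q!) \<int>\<close>. A superadditive homogeneous function on \<open>\<Gamma>\<close> with discrete values is the
  minimum of finitely many linear forms, so \<open>\<Phi>\<close> is finitely generated by Gordan's lemma.\<close>


section \<open>Abelian groups as modules over the integers\<close>

text \<open>The graded ring is not known to be Noetherian or F-finite, so the hypothesis is used one
  element at a time: one \<open>c\<close>, one splitting, one homogeneous element fed into it. The
  splitting need not respect the grading; a single component of its value is enough. What transports
  it to \<Phi> is that two elements of equal value agree to leading order up to a scalar of
  \<open>k\<close>, and that \<open>k\<close> contains the \<open>q\<close>-th root needed to move
  this scalar inside Frobenius.

  In the growth comparison the decisive point is that the constant depends on the elements with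
  independent values and not on the further vectors multiplied with them. When the two exponents
  agree, the powers cancel and a uniform bound remains, both for the number of cosets of values and
  for the number of independent powers of an element of value 0. Finite generation of \<Gamma> then
  supplies the interior point and confines the linear forms to a finite box.

  The convex geometry stays over the integers: with denominators cleared, directional derivatives
  are limits of bounded monotone integer sequences, which become constant.\<close>

definition int_scale :: "int \<Rightarrow> 'g::ab_group_add \<Rightarrow> 'g" (infixr \<open>*\<^sub>z\<close> 75) where
  "n *\<^sub>z x = (if 0 \<le> n then ((+) x ^^ nat n) 0 else - (((+) x ^^ nat (- n)) 0))"

lemma funpow_plus_add:
  fixes x :: "'g::ab_group_add"
  shows "((+) x ^^ (m + n)) 0 = ((+) x ^^ m) 0 + ((+) x ^^ n) 0"
  by (induction m) (auto simp: add.assoc)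

lemma funpow_plus_diff:
  fixes x :: "'g::ab_group_add"
  shows "n \<le> m \<Longrightarrow> ((+) x ^^ (m - n)) 0 = ((+) x ^^ m) 0 - ((+) x ^^ n) 0"
  using funpow_plus_add[of "m - n" n x] by (simp add: algebra_simps)

text \<open>Writing an integer as a difference of two naturals turns additivity in the integer into
  additivity of iteration, without a case distinction on the signs of two summands.\<close>

lemma int_scale_diff_nat:
  "(int m - int n) *\<^sub>z x = ((+) x ^^ m) 0 - ((+) x ^^ n) 0" for x :: "'g::ab_group_add"
proof (cases "n \<le> m")
  case True
  then have "nat (int m - int n) = m - n" by simp
  with True show ?thesis by (simp add: int_scale_def funpow_plus_diff)
next
  case False
  then have "nat (- (int m - int n)) = n - m" by simp
  with False show ?thesis by (simp add: int_scale_def funpow_plus_diff)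
qed

lemma int_scale_add_left: "(a + b) *\<^sub>z x = a *\<^sub>z x + b *\<^sub>z x" for x :: "'g::ab_group_add"
proof -
  obtain m n where a: "a = int m - int n" by (metis int_diff_cases)
  obtain m' n' where b: "b = int m' - int n'" by (metis int_diff_cases)
  have "a + b = int (m + m') - int (n + n')" using a b by simp
  then have "(a + b) *\<^sub>z x = ((+) x ^^ (m + m')) 0 - ((+) x ^^ (n + n')) 0"
    using int_scale_diff_nat by metis
  then show ?thesis
    unfolding a b int_scale_diff_nat funpow_plus_add by (simp add: algebra_simps)
qed

lemma int_scale_0_left: "0 *\<^sub>z x = 0" for x :: "'g::ab_group_add"
  by (simp add: int_scale_def)

lemma int_scale_1: "1 *\<^sub>z x = x" for x :: "'g::ab_group_add"
  by (simp add: int_scale_def)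

lemma int_scale_minus_left: "(- a) *\<^sub>z x = - (a *\<^sub>z x)" for x :: "'g::ab_group_add"
  using int_scale_add_left[of a "- a" x] by (simp add: int_scale_0_left add_eq_0_iff2)

lemma int_scale_diff_left: "(a - b) *\<^sub>z x = a *\<^sub>z x - b *\<^sub>z x" for x :: "'g::ab_group_add"
  using int_scale_add_left[of a "- b" x] by (simp add: int_scale_minus_left)

lemma int_scale_add_right: "a *\<^sub>z (x + y) = a *\<^sub>z x + a *\<^sub>z y" for x :: "'g::ab_group_add"
proof (induction a rule: int_induct[where k = 0])
  case (step1 i)
  then show ?case by (simp add: int_scale_add_left int_scale_1 algebra_simps)
next
  case (step2 i)
  then show ?case by (simp add: int_scale_diff_left int_scale_1)
qed (simp add: int_scale_0_left)

lemma int_scale_assoc: "a *\<^sub>z b *\<^sub>z x = (a * b) *\<^sub>z x" for x :: "'g::ab_group_add"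
proof (induction a rule: int_induct[where k = 0])
  case (step1 i)
  then show ?case by (simp add: int_scale_add_left int_scale_1 distrib_right)
next
  case (step2 i)
  then show ?case by (simp add: int_scale_diff_left int_scale_1 left_diff_distrib)
qed (simp add: int_scale_0_left)

global_interpretation zmod: Modules.module "int_scale :: int \<Rightarrow> 'g::ab_group_add \<Rightarrow> 'g"
  by unfold_locales
    (auto simp: int_scale_add_left int_scale_add_right int_scale_assoc int_scale_1)


section \<open>Finite generation of F-regular submonoids\<close>

locale add_submonoid =
  fixes S :: "'g::ab_group_add set"
  assumes zero_mem: "0 \<in> S" and add_mem: "x \<in> S \<Longrightarrow> y \<in> S \<Longrightarrow> x + y \<in> S"
begin

lemma int_scale_mem:
  assumes "x \<in> S" "0 \<le> n"
  shows "n *\<^sub>z x \<in> S"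
  using assms(2,1)
proof (induction n rule: int_ge_induct)
  case (step i)
  then show ?case by (simp add: zmod.scale_left_distrib add_mem)
qed (auto simp: zero_mem)

end

text \<open>Here \<open>c\<close> is an order unit: some multiple of it pushes any group element
  into \<open>S\<close>, while by saturation no negative multiple of it lies in \<open>S\<close>.
  The last assumption is what a splitting for an element of degree \<open>d\<close> leaves at the
  level of degrees.\<close>

locale F_regular_submonoid = add_submonoid S for S :: "'g::ab_group_add set" +
  fixes c :: 'g
  assumes c_mem: "c \<in> S" and c_not_unit: "- c \<notin> S"
    and c_interior: "\<exists>m\<ge>0. u + m *\<^sub>z c \<in> S"
    and F_regular: "d \<in> S \<Longrightarrow> \<exists>q\<ge>2. \<forall>u. d + q *\<^sub>z u \<in> S \<longrightarrow> u \<in> S"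
begin

text \<open>The range of \<open>n\<close> contains the number \<open>q\<close> belonging to
  \<open>d\<close>, and this single instance already gives the conclusion.\<close>

lemma completely_integrally_closed:
  assumes "d \<in> S" "\<And>n. 1 \<le> n \<Longrightarrow> d + n *\<^sub>z u \<in> S"
  shows "u \<in> S"
  using F_regular[OF assms(1)] assms(2) by (metis one_le_numeral order_trans)

text \<open>With \<open>k = j n + r\<close>, the multiple \<open>k u\<close> differs from
  \<open>j\<close> copies of \<open>n u\<close> by fewer than \<open>n\<close> copies of
  \<open>u\<close>, and \<open>m c\<close> pushes each copy into \<open>S\<close>. Hence
  \<open>n m c\<close> is a denominator for all multiples of \<open>u\<close> at once.\<close>

lemma saturated:
  assumes n: "1 \<le> n" and nu: "n *\<^sub>z u \<in> S"
  shows "u \<in> S"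
proof -
  obtain m where m: "0 \<le> m" "u + m *\<^sub>z c \<in> S" using c_interior by blast
  show ?thesis
  proof (rule completely_integrally_closed)
    show "(n * m) *\<^sub>z c \<in> S" using c_mem int_scale_mem n m by simp
    fix k :: int assume k: "1 \<le> k"
    define j r where "j = k div n" and "r = k mod n"
    have jr: "k = j * n + r" "0 \<le> j" "0 \<le> r" "r \<le> n"
      using n k pos_mod_sign[of n k] pos_mod_bound[of n k]
      by (auto simp: j_def r_def pos_imp_zdiv_nonneg_iff less_imp_le simp del: pos_mod_bound)
    have "j *\<^sub>z n *\<^sub>z u + r *\<^sub>z (u + m *\<^sub>z c) + ((n - r) * m) *\<^sub>z c \<in> S"
      by (intro add_mem[OF add_mem[OF int_scale_mem int_scale_mem] int_scale_mem])
        (use jr m c_mem nu in auto)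
    also have "j *\<^sub>z n *\<^sub>z u + r *\<^sub>z (u + m *\<^sub>z c) + ((n - r) * m) *\<^sub>z c
        = (n * m) *\<^sub>z c + k *\<^sub>z u"
      unfolding jr(1)
      by (simp add: zmod.scale_left_distrib zmod.scale_right_distrib left_diff_distrib
          zmod.scale_left_diff_distrib)
    finally show "(n * m) *\<^sub>z c + k *\<^sub>z u \<in> S" .
  qed
qed

lemma neg_multiple_notin: "n *\<^sub>z c \<in> S \<Longrightarrow> 0 \<le> n"
proof (rule ccontr)
  assume "n *\<^sub>z c \<in> S" and "\<not> 0 \<le> n"
  then have "(- n) *\<^sub>z (- c) \<in> S" "1 \<le> - n" by auto
  then show False using saturated c_not_unit by blast
qed

section \<open>Height relative to the interior point\<close>

definition slopes :: "'g \<Rightarrow> real set" where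
  "slopes u = {of_int a / of_int n | a n. 1 \<le> n \<and> n *\<^sub>z u - a *\<^sub>z c \<in> S}"

definition height :: "'g \<Rightarrow> real" where
  "height u = Sup (slopes u)"

lemma slopes_nonempty: "slopes u \<noteq> {}"
proof -
  obtain m where "0 \<le> m" "u + m *\<^sub>z c \<in> S" using c_interior by blast
  then have "(1::int) \<le> 1 \<and> 1 *\<^sub>z u - (- m) *\<^sub>z c \<in> S" by simp
  then show ?thesis unfolding slopes_def by blast
qed

text \<open>Some \<open>m c\<close> also absorbs \<open>- u\<close>. Adding \<open>n\<close> copies
  of \<open>- u + m c\<close> to \<open>n u - a c\<close> leaves \<open>(n m - a) c\<close>, which
  is in \<open>S\<close> only if \<open>a \<le> n m\<close>.\<close>

lemma slopes_bdd_above: "bdd_above (slopes u)"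
proof -
  obtain m where m: "0 \<le> m" "- u + m *\<^sub>z c \<in> S" using c_interior by blast
  have "x \<le> of_int m" if mem: "x \<in> slopes u" for x
  proof -
    obtain a n where x: "x = of_int a / of_int n" and n: "1 \<le> n" and S: "n *\<^sub>z u - a *\<^sub>z c \<in> S"
      using mem unfolding slopes_def by blast
    have "n *\<^sub>z u - a *\<^sub>z c + n *\<^sub>z (- u + m *\<^sub>z c) \<in> S"
      by (rule add_mem[OF S int_scale_mem[OF m(2)]]) (use n in simp)
    also have "n *\<^sub>z u - a *\<^sub>z c + n *\<^sub>z (- u + m *\<^sub>z c) = (n * m - a) *\<^sub>z c"
      by (simp add: zmod.scale_right_diff_distrib zmod.scale_left_diff_distrib)
    finally have "a \<le> m * n" using neg_multiple_notin by (fastforce simp: mult.commute)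
    then have "real_of_int a \<le> of_int m * of_int n" by (metis of_int_le_iff of_int_mult)
    then show ?thesis using n unfolding x by (simp add: divide_le_eq)
  qed
  then show ?thesis by (rule bdd_aboveI)
qed

text \<open>A slope \<open>a' / n'\<close> strictly above \<open>a / n\<close> is witnessed in
  \<open>S\<close>. Then \<open>n'\<close> times the desired element is \<open>n\<close> times that
  witness plus a positive multiple of \<open>c\<close>, and saturation divides by
  \<open>n'\<close>.\<close>

lemma slope_less_imp_mem:
  assumes n: "1 \<le> n" and less: "of_int a / of_int n < height u"
  shows "n *\<^sub>z u - a *\<^sub>z c \<in> S"
proof -
  obtain x where "x \<in> slopes u" "of_int a / of_int n < x"
    using less less_cSup_iff[OF slopes_nonempty slopes_bdd_above] unfolding height_def by blast
  then obtain a' n' where n': "1 \<le> n'" and S: "n' *\<^sub>z u - a' *\<^sub>z c \<in> S"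
    and ax: "real_of_int a / of_int n < of_int a' / of_int n'"
    unfolding slopes_def by blast
  have "real_of_int (a * n') < of_int (a' * n)"
    using ax n n' by (simp add: divide_less_eq less_divide_eq field_simps)
  then have "a * n' < a' * n" by (simp only: of_int_less_iff)
  then have "n *\<^sub>z (n' *\<^sub>z u - a' *\<^sub>z c) + (a' * n - a * n') *\<^sub>z c \<in> S"
    using n S c_mem by (intro add_mem int_scale_mem) auto
  also have "n *\<^sub>z (n' *\<^sub>z u - a' *\<^sub>z c) + (a' * n - a * n') *\<^sub>z c = n' *\<^sub>z (n *\<^sub>z u - a *\<^sub>z c)"
    by (simp add: zmod.scale_right_diff_distrib zmod.scale_left_diff_distrib mult.commute)
  finally show ?thesis using saturated n' by blast
qed

text \<open>The supremum is attained because \<open>S\<close> is completely integrally closed: for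
  every \<open>k\<close> the slope \<open>(k a - 1) / (k n)\<close> is strictly below the height, so
  one fixed copy of \<open>c\<close> repairs all multiples of the boundary element.\<close>

lemma le_height_iff:
  assumes n: "1 \<le> n"
  shows "of_int a \<le> of_int n * height u \<longleftrightarrow> n *\<^sub>z u - a *\<^sub>z c \<in> S"
proof
  assume "n *\<^sub>z u - a *\<^sub>z c \<in> S"
  then have "of_int a / of_int n \<in> slopes u" unfolding slopes_def using n by blast
  then have "of_int a / of_int n \<le> height u"
    unfolding height_def using slopes_bdd_above by (rule cSup_upper)
  then show "of_int a \<le> of_int n * height u" using n by (simp add: divide_le_eq mult.commute)
next
  assume le: "of_int a \<le> of_int n * height u"
  show "n *\<^sub>z u - a *\<^sub>z c \<in> S"
  proof (rule completely_integrally_closed[OF c_mem])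
    fix k :: int assume k: "1 \<le> k"
    have "1 \<le> k * n" using n k by (metis mult_mono zero_le_one mult_1 order_trans)
    have "of_int k * real_of_int a \<le> of_int k * (of_int n * height u)"
      using le k by (intro mult_left_mono) auto
    then have "real_of_int (k * a - 1) < height u * of_int (k * n)"
      by (simp add: mult.commute mult.left_commute)
    moreover have pos: "0 < real_of_int (k * n)" using \<open>1 \<le> k * n\<close> by linarith
    ultimately have "of_int (k * a - 1) / of_int (k * n) < height u"
      by (simp only: pos_divide_less_eq[OF pos])
    then have "(k * n) *\<^sub>z u - (k * a - 1) *\<^sub>z c \<in> S"
      by (rule slope_less_imp_mem[OF \<open>1 \<le> k * n\<close>])
    then show "c + k *\<^sub>z (n *\<^sub>z u - a *\<^sub>z c) \<in> S"
      by (simp add: zmod.scale_right_diff_distrib zmod.scale_left_diff_distrib algebra_simps)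
  qed
qed

end

text \<open>If no multiple of \<open>x\<close> comes within \<open>1 / q\<close> below an integer, then the multiple of \<open>x\<close> that
  Dirichlet's theorem places near an integer must be that integer.\<close>

lemma rational_if_multiples_avoid:
  fixes x :: real and q :: nat
  assumes q: "1 \<le> q"
    and avoid: "\<And>n m :: int. 1 \<le> n \<Longrightarrow> of_int m - 1 / of_nat q \<le> of_int n * x \<Longrightarrow> of_int m \<le> of_int n * x"
  obtains b where "1 \<le> b" "b \<le> q" "of_nat b * x \<in> \<int>"
proof -
  \<comment> \<open>The fractional parts of \<open>i x\<close>, for \<open>i\<close> from 0 to
    \<open>q\<close>, fall into \<open>q\<close> intervals of length \<open>1 / q\<close>; two in
    the same interval give the multiplier \<open>b \<le> q\<close>.\<close>
  define f where "f i = nat \<lfloor>of_nat q * frac (of_nat i * x)\<rfloor>" for i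
  have "f ` {0..q} \<subseteq> {..<q}"
  proof
    fix y assume "y \<in> f ` {0..q}"
    then obtain i where y: "y = f i" by blast
    have "of_nat q * frac (of_nat i * x) < of_nat q"
      using q frac_lt_1[of "of_nat i * x"] by simp
    then show "y \<in> {..<q}" unfolding y f_def using q by (simp add: nat_less_iff floor_less_iff)
  qed
  then have "card (f ` {0..q}) < card {0..q}"
    using card_mono[of "{..<q}"] by (metis card_atLeastAtMost card_lessThan diff_zero finite_lessThan less_Suc_eq_le)
  then have "\<not> inj_on f {0..q}" by (meson pigeonhole)
  then obtain i j where ij: "i < j" "j \<le> q" "f i = f j"
    unfolding inj_on_def by (metis atLeastAtMost_iff linorder_neqE_nat)
  define b where "b = j - i"
  have b: "1 \<le> b" "b \<le> q" using ij b_def by auto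
  define d where "d = frac (of_nat j * x) - frac (of_nat i * x)"
  define a where "a = \<lfloor>of_nat j * x\<rfloor> - \<lfloor>of_nat i * x\<rfloor>"
  have bx: "of_nat b * x = of_int a + d"
    using ij by (simp add: b_def a_def d_def frac_def of_nat_diff left_diff_distrib)
  have "\<lfloor>of_nat q * frac (of_nat i * x)\<rfloor> = \<lfloor>of_nat q * frac (of_nat j * x)\<rfloor>"
    using ij(3) unfolding f_def by (simp add: nat_eq_iff)
  then have "\<bar>of_nat q * frac (of_nat j * x) - of_nat q * frac (of_nat i * x)\<bar> < 1" by linarith
  then have "\<bar>of_nat q * d\<bar> < 1" by (simp add: d_def right_diff_distrib)
  then have dq: "\<bar>d\<bar> < 1 / of_nat q" using q by (simp add: abs_mult field_simps)
  have "d = 0"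
  proof (rule ccontr)
    assume "d \<noteq> 0"
    show False
    proof (cases "d < 0")
      case True
      then show False using avoid[of "int b" a] b bx dq by auto
    next
      case False
      then have d: "0 < d" using \<open>d \<noteq> 0\<close> by simp
      \<comment> \<open>The last multiple of \<open>d\<close> below 1. As \<open>d < 1 / q\<close>,
        it is within \<open>1 / q\<close> of 1, so \<open>n b x\<close> falls into the forbidden gap
        just below the integer \<open>n a + 1\<close>.\<close>
      define n where "n = \<lceil>1 / d\<rceil> - 1"
      have n: "of_int n < 1 / d" "1 / d \<le> of_int n + 1" unfolding n_def by linarith+
      have "1 / of_nat q \<le> (1::real)" using q by simp
      then have "d < 1" using dq by linarith
    then have "1 < 1 / d" using d by (simp add: less_divide_eq)
      then have n1: "1 \<le> n" using n by linarith
      have nd: "of_int n * d < 1" "1 \<le> of_int n * d + d"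
        using n d by (auto simp: field_simps)
      have "of_int (n * int b) * x = of_int n * (of_nat b * x)" by simp
      also have "\<dots> = of_int (n * a) + of_int n * d" unfolding bx by (simp add: distrib_left)
      finally have e: "of_int (n * int b) * x = of_int (n * a) + of_int n * d" .
      have "1 \<le> n * int b" using n1 b by (simp add: int_one_le_iff_zero_less)
      then have "of_int (n * a + 1) \<le> of_int (n * int b) * x"
        using avoid[of "n * int b" "n * a + 1"] nd dq d unfolding e by simp
      then show False using nd unfolding e by simp
    qed
  qed
  then show ?thesis using that[OF b] bx by simp
qed

section \<open>Integer-valued superlinear functions\<close>

text \<open>The functions that play the role of minima of finitely many integral linear forms.\<close>

definition superlinear :: "('g::ab_group_add \<Rightarrow> int) \<Rightarrow> bool" where
  "superlinear H \<longleftrightarrow> (\<forall>u v. H u + H v \<le> H (u + v)) \<and> (\<forall>n\<ge>0. \<forall>u. H (n *\<^sub>z u) = n * H u)"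

lemma superlinear_add: "superlinear H \<Longrightarrow> H u + H v \<le> H (u + v)"
  unfolding superlinear_def by blast

lemma superlinear_scale: "superlinear H \<Longrightarrow> 0 \<le> n \<Longrightarrow> H (n *\<^sub>z u) = n * H u"
  unfolding superlinear_def by blast

lemma superlinear_0: "superlinear H \<Longrightarrow> H 0 = 0"
  using superlinear_scale[of H 0 0] by simp

lemma superlinear_minus_le: "superlinear H \<Longrightarrow> H (- u) \<le> - H u"
  using superlinear_add[of H u "- u"] superlinear_0[of H] by simp

lemma (in F_regular_submonoid) ex_superlinear:
  obtains H where "superlinear H" "\<And>u. u \<in> S \<longleftrightarrow> 0 \<le> H u"
proof -
  obtain q where q: "2 \<le> q" and qS: "\<And>u. c + q *\<^sub>z u \<in> S \<Longrightarrow> u \<in> S"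
    using F_regular[OF c_mem] by blast
  \<comment> \<open>Multiplication by \<open>q\<close> turns the slack \<open>1 / q\<close> into one
    copy of \<open>c\<close>, which is exactly the shape of the F-regularity condition for
    \<open>d = c\<close>.\<close>
  have avoid: "of_int m \<le> of_int n * height u"
    if n: "1 \<le> n" and le: "of_int m - 1 / of_nat (nat q) \<le> of_int n * height u" for n m u
  proof -
    have qn: "1 \<le> q * n" using n q by (metis mult_mono one_le_numeral order_trans zero_le_one mult_1)
    have "of_int q * (of_int m - 1 / of_int q) \<le> of_int q * (of_int n * height u)"
      using le q by (intro mult_left_mono) auto
    then have "of_int (q * m - 1) \<le> of_int (q * n) * height u"
      using q by (simp add: right_diff_distrib mult.assoc)
    then have "(q * n) *\<^sub>z u - (q * m - 1) *\<^sub>z c \<in> S" using le_height_iff[OF qn] by blast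
    then have "c + q *\<^sub>z (n *\<^sub>z u - m *\<^sub>z c) \<in> S"
      by (simp add: zmod.scale_right_diff_distrib zmod.scale_left_diff_distrib algebra_simps)
    then show ?thesis using qS le_height_iff[OF n] by blast
  qed
  \<comment> \<open>The multiplier that makes \<open>height u\<close> integral depends on
    \<open>u\<close> but is at most \<open>q\<close>; the factorial is a common multiple of all
    candidates.\<close>
  define N :: int where "N = fact (nat q)"
  have N: "1 \<le> N" unfolding N_def by (simp add: fact_ge_1)
  have "\<exists>h. of_int N * height u = of_int h" for u
  proof -
    obtain b where b: "1 \<le> b" "b \<le> nat q" "of_nat b * height u \<in> \<int>"
      using rational_if_multiples_avoid[of "nat q" "height u"] avoid q by (auto simp: Suc_le_eq)
    have "b dvd fact (nat q)" using b by (intro dvd_fact) auto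
    then obtain k where "fact (nat q) = b * k" by blast
    then have "real_of_int N = of_nat k * of_nat b" unfolding N_def
      by (metis mult.commute of_int_fact of_nat_fact of_nat_mult)
    then have "of_int N * height u = of_nat k * (of_nat b * height u)" by simp
    then have "of_int N * height u \<in> \<int>" using Ints_mult[OF Ints_of_nat b(3)] by metis
    then show ?thesis by (rule Ints_cases) blast
  qed
  then obtain H where H: "\<And>u. of_int N * height u = of_int (H u)" by metis
  \<comment> \<open>The integer \<open>H u\<close> is described by the integers below it, so
    superadditivity and homogeneity can be read off from membership in \<open>S\<close>.\<close>
  have H_iff: "a \<le> H u \<longleftrightarrow> N *\<^sub>z u - a *\<^sub>z c \<in> S" for a u
    using le_height_iff[OF N, of a u] unfolding H by simp
  have "superlinear H"
    unfolding superlinear_def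
  proof (intro conjI allI impI)
    fix u v
    have "(N *\<^sub>z u - H u *\<^sub>z c) + (N *\<^sub>z v - H v *\<^sub>z c) \<in> S"
      using H_iff by (intro add_mem) auto
    then show "H u + H v \<le> H (u + v)"
      unfolding H_iff by (simp add: zmod.scale_right_distrib zmod.scale_left_distrib algebra_simps)
  next
    fix n :: int and u assume n: "0 \<le> n"
    show "H (n *\<^sub>z u) = n * H u"
    proof (cases "n = 0")
      case True
      have "a \<le> H 0 \<longleftrightarrow> a \<le> 0" for a
        unfolding H_iff using neg_multiple_notin[of "- a"] int_scale_mem[OF c_mem, of "- a"] by auto
      then have "H 0 = 0" by (metis order_antisym order_refl)
      with True show ?thesis by simp
    next
      case False
      then have Nn: "1 \<le> N * n" using n N by (smt (verit) mult_pos_pos)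
      have "a \<le> H (n *\<^sub>z u) \<longleftrightarrow> a \<le> n * H u" for a
      proof -
        have "a \<le> H (n *\<^sub>z u) \<longleftrightarrow> (N * n) *\<^sub>z u - a *\<^sub>z c \<in> S" unfolding H_iff by simp
        also have "\<dots> \<longleftrightarrow> of_int a \<le> of_int (N * n) * height u" using le_height_iff[OF Nn] by simp
        also have "of_int (N * n) * height u = of_int n * (of_int N * height u)" by simp
        also have "\<dots> = of_int (n * H u)" unfolding H by simp
        finally show ?thesis by (simp only: of_int_le_iff)
      qed
      then show ?thesis by (metis order_antisym order_refl)
    qed
  qed
  moreover have "u \<in> S \<longleftrightarrow> 0 \<le> H u" for u
  proof
    assume "u \<in> S"
    then have "N *\<^sub>z u \<in> S" using N by (intro int_scale_mem) auto
    then show "0 \<le> H u" unfolding H_iff by simp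
  next
    assume "0 \<le> H u"
    then have "N *\<^sub>z u \<in> S" unfolding H_iff by simp
    then show "u \<in> S" by (rule saturated[OF N])
  qed
  ultimately show ?thesis using that by blast
qed

lemma bounded_mono_int_eventually_const:
  fixes f :: "nat \<Rightarrow> int"
  assumes mono: "\<And>n. f n \<le> f (Suc n)" and bound: "\<And>n. f n \<le> B"
  shows "\<exists>l M. \<forall>n\<ge>M. f n = l"
proof -
  have inc: "f m \<le> f n" if "m \<le> n" for m n using lift_Suc_mono_le[of f, OF mono that] .
  define g where "g n = nat (B - f n)" for n
  obtain M where M: "\<And>n. g M \<le> g n"
    using ex_has_least_nat[of "\<lambda>_. True" 0 g] by auto
  have "f n = f M" if "M \<le> n" for n
  proof -
    have "B - f M \<le> B - f n"
      using M[of n] bound[of n] bound[of M] unfolding g_def by linarith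
    with inc[OF that] show ?thesis by simp
  qed
  then show ?thesis by blast
qed

text \<open>The directional derivative of a superlinear function at \<open>u\<close> is linear along \<open>u\<close>.\<close>

lemma superlinear_linearize:
  assumes H: "superlinear H"
  obtains H' where "superlinear H'" "\<And>v. H v \<le> H' v" "H' u = H u" "H' (- u) = - H u"
proof -
  \<comment> \<open>The gain of adding \<open>v\<close> after \<open>n\<close> steps along
    \<open>u\<close>. Superadditivity makes it nondecreasing in \<open>n\<close> and bounds it by
    \<open>- H (- v)\<close>, so \<open>H' v\<close> is its eventual value.\<close>
  define f where "f v n = H (int n *\<^sub>z u + v) - int n * H u" for v and n :: nat
  have "\<exists>l M. \<forall>n\<ge>M. f v n = l" for v
  proof (rule bounded_mono_int_eventually_const)
    fix n
    have "H u + H (int n *\<^sub>z u + v) \<le> H (int (Suc n) *\<^sub>z u + v)"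
      using superlinear_add[OF H, of u "int n *\<^sub>z u + v"]
      by (simp add: zmod.scale_left_distrib add.assoc)
    then show "f v n \<le> f v (Suc n)" unfolding f_def by (simp add: distrib_right)
    have "H (int n *\<^sub>z u + v) + H (- v) \<le> H (int n *\<^sub>z u)"
      using superlinear_add[OF H, of "int n *\<^sub>z u + v" "- v"] by simp
    then show "f v n \<le> - H (- v)" unfolding f_def using superlinear_scale[OF H, of "int n" u] by simp
  qed
  then obtain H' M where M: "\<And>v n. M v \<le> n \<Longrightarrow> f v n = H' v" by metis
  have f0: "H' v = H v" if "\<And>n. f v n = H v" for v using M[of v "M v"] that by simp
  have ge: "H v \<le> H' v" for v
  proof -
    have "H v + H (int (M v) *\<^sub>z u) \<le> H (int (M v) *\<^sub>z u + v)"
      using superlinear_add[OF H, of v "int (M v) *\<^sub>z u"] by (simp add: add.commute)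
    then show ?thesis using M[of v "M v"] superlinear_scale[OF H, of "int (M v)" u]
      unfolding f_def by simp
  qed
  have sup: "superlinear H'"
    unfolding superlinear_def
  proof (intro conjI allI impI)
    fix v w
    define n where "n = M v + M w + M (v + w)"
    \<comment> \<open>Adding two points that are \<open>n\<close> steps along \<open>u\<close> gives
      a point \<open>2 n\<close> steps along it, hence the stage \<open>n + n\<close> on the
      right.\<close>
    have "f v n + f w n \<le> f (v + w) (n + n)"
      using superlinear_add[OF H, of "int n *\<^sub>z u + v" "int n *\<^sub>z u + w"]
      unfolding f_def by (simp only: of_nat_add zmod.scale_left_distrib distrib_right) (simp add: algebra_simps)
    then show "H' v + H' w \<le> H' (v + w)"
      using M[of v n] M[of w n] M[of "v + w" "n + n"] n_def by simp
  next
    fix n :: int and v assume n: "0 \<le> n"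
    define m where "m = M v + M (n *\<^sub>z v)"
    show "H' (n *\<^sub>z v) = n * H' v"
    proof (cases "n = 0")
      case True
      have "H' 0 = H 0" using f0[of 0] superlinear_scale[OF H] superlinear_0[OF H]
        unfolding f_def by simp
      with True show ?thesis using superlinear_0[OF H] by simp
    next
      case False
      then have "M (n *\<^sub>z v) \<le> nat n * m" unfolding m_def using n
        by (metis add.commute le_add1 mult_le_mono nat_0_less_mult_iff nat_mult_1 less_eq_Suc_le
            One_nat_def order_less_le zero_less_nat_eq trans_le_add1)
      then have "H' (n *\<^sub>z v) = f (n *\<^sub>z v) (nat n * m)" using M by simp
      also have "\<dots> = H (n *\<^sub>z (int m *\<^sub>z u + v)) - n * (int m * H u)"
        using n unfolding f_def by (simp add: zmod.scale_right_distrib)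
      also have "\<dots> = n * f v m" using superlinear_scale[OF H n] unfolding f_def
        by (simp add: right_diff_distrib)
      also have "f v m = H' v" using M m_def by simp
      finally show ?thesis .
    qed
  qed
  have u: "H' u = H u"
  proof (rule f0)
    fix n
    have "int n *\<^sub>z u + u = (int n + 1) *\<^sub>z u" by (simp add: zmod.scale_left_distrib)
    then show "f u n = H u" unfolding f_def using superlinear_scale[OF H, of "int n + 1" u]
      by (simp add: distrib_right)
  qed
  have "- H u \<le> H' (- u)"
  proof -
    \<comment> \<open>The successor keeps \<open>n - 1\<close> nonnegative, since homogeneity is
      available for nonnegative multiples only.\<close>
    define n where "n = Suc (M (- u))"
    have "int n *\<^sub>z u + - u = (int n - 1) *\<^sub>z u"
      by (simp add: n_def zmod.scale_left_distrib)
    then have "f (- u) n = - H u"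
      unfolding f_def using superlinear_scale[OF H, of "int n - 1" u] n_def
      by (simp add: distrib_right)
    then show ?thesis using M[of "- u" n] n_def by simp
  qed
  then have "H' (- u) = - H u" using superlinear_minus_le[OF sup, of u] u by simp
  then show ?thesis using that sup ge u by blast
qed

text \<open>The chain \<open>H w \<le> H' w \<le> - H' (- w) \<le> - H (- w) = H w\<close>
  collapses. Directions in which a function is already linear are thus frozen under all further
  enlargements, which allows linearizing one direction after another.\<close>

lemma superlinear_ge_reversible:
  assumes "superlinear H'" "\<And>v. H v \<le> H' v" "H (- w) = - H w"
  shows "H' w = H w" "H' (- w) = - H' w"
  using assms(2)[of w] assms(2)[of "- w"] superlinear_minus_le[OF assms(1), of w] assms(3) by auto

text \<open>The recursion starts at the end of the list, so the last vector is linearized first,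
  directly from \<open>H\<close>; its value under \<open>H\<close> is kept there, and later
  enlargements cannot change it.\<close>

lemma superlinear_linearize_list:
  assumes "superlinear H"
  shows "\<exists>H'. superlinear H' \<and> (\<forall>v. H v \<le> H' v) \<and> (\<forall>u\<in>set us. H' (- u) = - H' u)
    \<and> (us \<noteq> [] \<longrightarrow> H' (last us) = H (last us))"
proof (induction us)
  case Nil
  then show ?case using assms by auto
next
  case (Cons u us)
  obtain H1 where H1: "superlinear H1" "\<And>v. H v \<le> H1 v" "\<And>u. u \<in> set us \<Longrightarrow> H1 (- u) = - H1 u"
    "us \<noteq> [] \<Longrightarrow> H1 (last us) = H (last us)"
    using Cons by blast
  show ?case
  proof (cases "us = []")
    case True
    obtain H2 where H2: "superlinear H2" "\<And>v. H v \<le> H2 v" "H2 u = H u" "H2 (- u) = - H u"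
      using superlinear_linearize[OF assms, of u] by blast
    then have "superlinear H2 \<and> (\<forall>v. H v \<le> H2 v) \<and> (\<forall>w\<in>set (u # us). H2 (- w) = - H2 w)
      \<and> (u # us \<noteq> [] \<longrightarrow> H2 (last (u # us)) = H (last (u # us)))"
      using True by simp
    then show ?thesis by (intro exI[of _ H2])
  next
    case False
    obtain H2 where H2: "superlinear H2" "\<And>v. H1 v \<le> H2 v" "H2 u = H1 u" "H2 (- u) = - H1 u"
      using superlinear_linearize[OF H1(1), of u] by blast
    have rev: "H2 w = H1 w" "H2 (- w) = - H2 w" if "w \<in> set us" for w
      using superlinear_ge_reversible[OF H2(1,2) H1(3)[OF that]] .
    have "superlinear H2 \<and> (\<forall>v. H v \<le> H2 v) \<and> (\<forall>w\<in>set (u # us). H2 (- w) = - H2 w)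
      \<and> (u # us \<noteq> [] \<longrightarrow> H2 (last (u # us)) = H (last (u # us)))"
      using False H1(1,2,4) H2 rev(2) rev(1)[OF last_in_set[OF False]] order_trans[OF H1(2) H2(2)]
      by auto
    then show ?thesis by (intro exI[of _ H2])
  qed
qed

text \<open>Superadditivity for the pairs \<open>x, y\<close> and \<open>x + y, - y\<close> gives
  additivity as soon as \<open>y\<close> is reversible. The reversible elements therefore form a
  subgroup, and it contains a generating set.\<close>

lemma superlinear_reversible_imp_additive:
  assumes H: "superlinear H" and span: "zmod.span (set us) = UNIV"
    and rev: "\<And>u. u \<in> set us \<Longrightarrow> H (- u) = - H u"
  shows "H (v + w) = H v + H w"
proof -
  have R: "H (x + y) = H x + H y" if "H (- y) = - H y" for x y
    using superlinear_add[OF H, of x y] superlinear_add[OF H, of "x + y" "- y"] that by simp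
  have "H (- y) = - H y" if "y \<in> zmod.span (set us)" for y
    using that
  proof (induction rule: zmod.span_induct_alt)
    case base
    then show ?case using superlinear_0[OF H] by simp
  next
    case (step n x y)
    have "H (- (n *\<^sub>z x)) = - H (n *\<^sub>z x)"
    proof (cases "0 \<le> n")
      case True
      then show ?thesis using superlinear_scale[OF H True] rev[OF step(1)]
        by (metis mult_minus_right zmod.scale_minus_right)
    next
      case False
      then have "0 \<le> - n" by simp
      from superlinear_scale[OF H this, of x] superlinear_scale[OF H this, of "- x"] rev[OF step(1)]
      show ?thesis by simp
    qed
    then have "H (- (n *\<^sub>z x) + - y) = - H (n *\<^sub>z x) + - H y" "H (n *\<^sub>z x + y) = H (n *\<^sub>z x) + H y"
      using R step(2) R[of "- y" "- (n *\<^sub>z x)"] by (auto simp add: add.commute)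
    then show ?case by (simp add: add.commute)
  qed
  then show ?thesis using R span by blast
qed

section \<open>Monotone subsequences, Dickson's lemma and Gordan's lemma\<close>

lemma nat_seq_monotone_subseq:
  fixes f :: "nat \<Rightarrow> nat"
  obtains r :: "nat \<Rightarrow> nat" where "strict_mono r" "\<And>i j. i \<le> j \<Longrightarrow> f (r i) \<le> f (r j)"
proof -
  obtain r where r: "strict_mono (r :: nat \<Rightarrow> nat)" "monoseq (\<lambda>n. f (r n))"
    using seq_monosub[of f] by auto
  show ?thesis
  proof (cases "\<forall>m. \<forall>n\<ge>m. f (r m) \<le> f (r n)")
    case True
    then show ?thesis using that r by blast
  next
    case False
    then have dec: "f (r n) \<le> f (r m)" if "m \<le> n" for m n using r(2) that unfolding monoseq_def by blast
    \<comment> \<open>A nonincreasing sequence of naturals is constant from its minimum on, so its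
      tail is nondecreasing as well.\<close>
    obtain M where M: "\<And>n. f (r M) \<le> f (r n)"
      using ex_has_least_nat[of "\<lambda>_. True" 0 "\<lambda>n. f (r n)"] by auto
    have "strict_mono (\<lambda>n. r (M + n))" using r(1) by (simp add: strict_mono_def)
    moreover have "f (r (M + i)) \<le> f (r (M + j))" for i j
      using dec[of M "M + i"] M[of "M + j"] by simp
    ultimately show ?thesis using that[of "\<lambda>n. r (M + n)"] by blast
  qed
qed

lemma Dickson:
  fixes f :: "nat \<Rightarrow> 'b \<Rightarrow> nat"
  assumes "finite F"
  shows "\<exists>r :: nat \<Rightarrow> nat. strict_mono r \<and> (\<forall>l\<in>F. \<forall>i j. i \<le> j \<longrightarrow> f (r i) l \<le> f (r j) l)"
  using assms
proof induction
  case empty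
  then show ?case by (intro exI[of _ id]) (auto simp: strict_mono_def)
next
  case (insert x F)
  then obtain r :: "nat \<Rightarrow> nat"
    where r: "strict_mono r" "\<And>l i j. l \<in> F \<Longrightarrow> i \<le> j \<Longrightarrow> f (r i) l \<le> f (r j) l" by blast
  obtain s :: "nat \<Rightarrow> nat"
    where s: "strict_mono s" "\<And>i j. i \<le> j \<Longrightarrow> f (r (s i)) x \<le> f (r (s j)) x"
    using nat_seq_monotone_subseq[of "\<lambda>n. f (r n) x"] by blast
  have "s i \<le> s j" if "i \<le> j" for i j using s(1) that by (simp add: strict_mono_less_eq)
  then show ?case using r s
    by (intro exI[of _ "r \<circ> s"]) (auto simp: strict_mono_def)
qed

inductive_set monoid_gen :: "'g::monoid_add set \<Rightarrow> 'g set" for F where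
  zero: "0 \<in> monoid_gen F"
| add: "x \<in> F \<Longrightarrow> y \<in> monoid_gen F \<Longrightarrow> x + y \<in> monoid_gen F"

lemma monoid_gen_base: "x \<in> F \<Longrightarrow> x \<in> monoid_gen F"
  using monoid_gen.add[OF _ monoid_gen.zero] by fastforce

lemma monoid_gen_add: "x \<in> monoid_gen F \<Longrightarrow> y \<in> monoid_gen F \<Longrightarrow> x + y \<in> monoid_gen F"
  by (induction rule: monoid_gen.induct) (auto simp: add.assoc intro: monoid_gen.add)

text \<open>Gordan's lemma: minimality with respect to the finitely many forms is incompatible with an
  infinite set of indecomposable elements, by Dickson's lemma.\<close>

lemma Gordan:
  fixes S :: "'g::ab_group_add set" and F :: "('g \<Rightarrow> int) set"
  assumes F: "finite F" and additive: "\<And>l u v. l \<in> F \<Longrightarrow> l (u + v) = l u + l v"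
    and S: "S = {u. \<forall>l\<in>F. 0 \<le> l u}" and pointed: "\<And>u. u \<in> S \<Longrightarrow> - u \<in> S \<Longrightarrow> u = 0"
  shows "\<exists>G. finite G \<and> G \<subseteq> S \<and> S \<subseteq> monoid_gen G"
proof -
  have l0: "l 0 = 0" if "l \<in> F" for l using additive[OF that, of 0 0] by simp
  have lm: "l (u - v) = l u - l v" if "l \<in> F" for l u v using additive[OF that, of "u - v" v] by simp
  \<comment> \<open>The nonzero elements that are not a sum of two nonzero elements of
    \<open>S\<close>: the Hilbert basis.\<close>
  define G where "G = {u \<in> S. u \<noteq> 0 \<and> (\<forall>v\<in>S. u - v \<in> S \<longrightarrow> v = 0 \<or> v = u)}"
  have "finite G"
  proof (rule ccontr)
    assume "infinite G"
    then obtain f :: "nat \<Rightarrow> 'g" where f: "inj f" "range f \<subseteq> G"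
      using infinite_countable_subset by blast
    obtain r :: "nat \<Rightarrow> nat" where r: "strict_mono r"
      and rl: "\<And>l i j. l \<in> F \<Longrightarrow> i \<le> j \<Longrightarrow> nat (l (f (r i))) \<le> nat (l (f (r j)))"
      using Dickson[OF F, of "\<lambda>n l. nat (l (f n))"] by blast
    have G: "f (r 0) \<in> G" "f (r 1) \<in> G" using f by auto
    have "r 0 \<noteq> r 1" using r by (metis strict_mono_eq zero_neq_one)
    then have ne: "f (r 0) \<noteq> f (r 1)" using f(1) by (simp add: inj_eq)
    have "0 \<le> l (f (r 1) - f (r 0))" if "l \<in> F" for l
    proof -
      have "0 \<le> l (f (r 0))" "0 \<le> l (f (r 1))" using G that unfolding G_def S by auto
      then show ?thesis using rl[OF that, of 0 1] lm[OF that] by simp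
    qed
    then have "f (r 1) - f (r 0) \<in> S" unfolding S by blast
    then show False using G ne unfolding G_def by blast
  qed
  moreover have "u \<in> monoid_gen G" if "u \<in> S" for u
    using that
  proof (induction "nat (\<Sum>l\<in>F. l u)" arbitrary: u rule: less_induct)
    case less
    \<comment> \<open>The sum of all forms serves as a degree. Pointedness makes it positive on
      nonzero elements, so both parts of a proper decomposition have smaller degree.\<close>
    have pos: "0 < (\<Sum>l\<in>F. l v)" if "v \<in> S" "v \<noteq> 0" for v
    proof (rule ccontr)
      assume "\<not> 0 < (\<Sum>l\<in>F. l v)"
      moreover have nn: "\<And>l. l \<in> F \<Longrightarrow> 0 \<le> l v" using that S by blast
      ultimately have "(\<Sum>l\<in>F. l v) = 0" using sum_nonneg[of F "\<lambda>l. l v"] by force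
      then have "\<forall>l\<in>F. l v = 0" using sum_nonneg_eq_0_iff[OF F, of "\<lambda>l. l v"] nn by blast
      then have "l (- v) = 0" if "l \<in> F" for l using lm[OF that, of 0 v] l0[OF that] that by simp
      then have "- v \<in> S" unfolding S by simp
      then show False using pointed that by blast
    qed
    consider "u = 0" | "u \<in> G" | v where "v \<in> S" "u - v \<in> S" "v \<noteq> 0" "v \<noteq> u"
      using less.prems unfolding G_def by blast
    then show ?case
    proof cases
      case 3
      have e: "(\<Sum>l\<in>F. l (u - v)) = (\<Sum>l\<in>F. l u) - (\<Sum>l\<in>F. l v)"
        by (simp add: lm sum_subtractf)
      have "0 < (\<Sum>l\<in>F. l v)" "0 < (\<Sum>l\<in>F. l (u - v))" using pos 3 by auto
      then have "u - v \<in> monoid_gen G" "v \<in> monoid_gen G"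
        using less.hyps[of v] less.hyps[of "u - v"] e 3 by auto
      then show ?thesis using monoid_gen_add[of "u - v" G v] by simp
    qed (auto intro: monoid_gen.zero monoid_gen_base)
  qed
  moreover have "G \<subseteq> S" unfolding G_def by blast
  ultimately show ?thesis by blast
qed

text \<open>\<open>F\<close> consists of all additive majorants of \<open>H\<close>. It is finite,
  because a majorant is determined by its values on \<open>E\<close> and these lie between
  \<open>H e\<close> and \<open>- H (- e)\<close>. It cuts out \<open>S\<close>, because for each
  \<open>u\<close> some majorant touches \<open>H\<close> at \<open>u\<close>.\<close>

lemma (in F_regular_submonoid) finitely_generated:
  fixes E :: "'g set"
  assumes E: "finite E" "zmod.span E = UNIV" and pointed: "\<And>u. u \<in> S \<Longrightarrow> - u \<in> S \<Longrightarrow> u = 0"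
  shows "\<exists>G. finite G \<and> G \<subseteq> S \<and> S \<subseteq> monoid_gen G"
proof -
  obtain H where H: "superlinear H" and SH: "\<And>u. u \<in> S \<longleftrightarrow> 0 \<le> H u" using ex_superlinear by blast
  define F where "F = {l. (\<forall>u v. l (u + v) = l u + l v) \<and> (\<forall>v. H v \<le> l v)}"
  have l0: "l 0 = 0" if "l \<in> F" for l
  proof -
    have "l (0 + 0) = l 0 + l 0" using that unfolding F_def by blast
    then show ?thesis by simp
  qed
  have lm: "l (- u) = - l u" if "l \<in> F" for l u
  proof -
    have "l (u + - u) = l u + l (- u)" using that unfolding F_def by blast
    then show ?thesis using l0[OF that] by simp
  qed
  have "finite F"
  proof (rule inj_on_finite)
    show "(\<lambda>l. restrict l E) ` F \<subseteq> (\<Pi>\<^sub>E e\<in>E. {H e .. - H (- e)})"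
    proof
      fix f assume "f \<in> (\<lambda>l. restrict l E) ` F"
      then obtain l where l: "l \<in> F" "f = restrict l E" by blast
      then have le: "H v \<le> l v" for v unfolding F_def by blast
      have "H e \<le> l e" "l e \<le> - H (- e)" for e
        using le[of e] le[of "- e"] unfolding lm[OF l(1)] by (simp_all add: le_minus_iff)
      then show "f \<in> (\<Pi>\<^sub>E e\<in>E. {H e .. - H (- e)})" using l(2) by auto
    qed
    show "finite (\<Pi>\<^sub>E e\<in>E. {H e .. - H (- e)})" using E(1) by (intro finite_PiE) auto
    show "inj_on (\<lambda>l. restrict l E) F"
    proof (rule inj_onI)
      fix l l' assume l: "l \<in> F" "l' \<in> F" and eq: "restrict l E = restrict l' E"
      have "l u = l' u" if "u \<in> zmod.span E" for u
        using that
      proof (induction rule: zmod.span_induct_alt)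
        case base
        then show ?case using l0[OF l(1)] l0[OF l(2)] by simp
      next
        case (step n x y)
        have x: "l x = l' x" using eq step(1) by (metis restrict_apply')
        have "l (n *\<^sub>z x) = l' (n *\<^sub>z x)"
        proof (induction n rule: int_induct[where k = 0])
          case (step1 i)
          then show ?case using l x unfolding F_def by (simp add: zmod.scale_left_distrib)
        next
          case (step2 i)
          have d: "m (u - v) = m u - m v" if "m \<in> F" for m u v
            using that lm[OF that, of v] unfolding F_def by (metis (mono_tags, lifting) diff_conv_add_uminus mem_Collect_eq)
          from step2 show ?case using d[OF l(1)] d[OF l(2)] x by (simp add: zmod.scale_left_diff_distrib)
        qed (use l0[OF l(1)] l0[OF l(2)] in simp)
        then show ?case using l step(2) unfolding F_def by simp
      qed
      then show "l = l'" using E(2) by auto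
    qed
  qed
  moreover have "S = {u. \<forall>l\<in>F. 0 \<le> l u}"
  proof (rule Set.set_eqI, rule iffI)
    fix u assume "u \<in> S"
    then show "u \<in> {u. \<forall>l\<in>F. 0 \<le> l u}" unfolding SH F_def by (auto intro: order_trans)
  next
    fix u assume u: "u \<in> {u. \<forall>l\<in>F. 0 \<le> l u}"
    obtain es where es: "set es = E" using E(1) finite_list by blast
    \<comment> \<open>\<open>u\<close> is placed last so that its value under \<open>H\<close> is
      preserved; the generators before it make the majorant additive.\<close>
    obtain l where l: "superlinear l" "\<And>v. H v \<le> l v" "\<And>w. w \<in> set (es @ [u]) \<Longrightarrow> l (- w) = - l w"
      "l u = H u"
      using superlinear_linearize_list[OF H, of "es @ [u]"] by auto
    have "zmod.span (set (es @ [u])) = UNIV"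
      using E(2) es by (metis UNIV_I set_append zmod.span_mono sup_ge1 subset_UNIV subset_antisym)
    then have "l (v + w) = l v + l w" for v w
      using superlinear_reversible_imp_additive[OF l(1)] l(3) by blast
    then have "l \<in> F" using l(2) unfolding F_def by blast
    then show "u \<in> S" using u l(4) SH by auto
  qed
  ultimately show ?thesis using pointed by (intro Gordan) (auto simp: F_def)
qed

theorem F_regular_submonoid_finitely_generated:
  fixes S E :: "'g::linordered_ab_group_add set"
  assumes S: "0 \<in> S" "\<And>x y. x \<in> S \<Longrightarrow> y \<in> S \<Longrightarrow> x + y \<in> S"
    and nonneg: "\<And>x. x \<in> S \<Longrightarrow> 0 \<le> x"
    and diff: "\<And>u. \<exists>a\<in>S. \<exists>b\<in>S. u = a - b"
    and F_reg: "\<And>d. d \<in> S \<Longrightarrow> \<exists>q\<ge>2. \<forall>u. d + q *\<^sub>z u \<in> S \<longrightarrow> u \<in> S"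
    and E: "finite E" "zmod.span E = UNIV"
  shows "\<exists>G. finite G \<and> G \<subseteq> S \<and> S \<subseteq> monoid_gen G"
proof (cases "S = {0}")
  case True
  then show ?thesis by (intro exI[of _ "{}"]) (simp add: monoid_gen.zero)
next
  case False
  interpret add_submonoid S by unfold_locales (fact S)+
  have pointed: "u = 0" if "u \<in> S" "- u \<in> S" for u using nonneg[OF that(1)] nonneg[OF that(2)] by simp
  obtain x0 where x0: "x0 \<in> S" "x0 \<noteq> 0" using False S(1) by blast
  have "\<exists>p. fst p \<in> S \<and> snd p \<in> S \<and> u = fst p - snd p" for u
  proof -
    obtain a b where "a \<in> S" "b \<in> S" "u = a - b" using diff[of u] by blast
    then show ?thesis by (intro exI[of _ "(a, b)"]) simp
  qed
  then obtain P where P: "\<forall>u. fst (P u) \<in> S \<and> snd (P u) \<in> S \<and> u = fst (P u) - snd (P u)"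
    using choice[of "\<lambda>u p. fst p \<in> S \<and> snd p \<in> S \<and> u = fst p - snd p"] by blast
  define A B where "A u = fst (P u)" and "B u = snd (P u)" for u
  have AB: "A u \<in> S" "B u \<in> S" "u = A u - B u" for u
    unfolding A_def B_def
    by (rule P[rule_format, THEN conjunct1] P[rule_format, THEN conjunct2, THEN conjunct1]
        P[rule_format, THEN conjunct2, THEN conjunct2])+
  \<comment> \<open>Each generator is \<open>e = A e - B e\<close> with both parts in
    \<open>S\<close>, so \<open>c\<close> dominates \<open>e\<close> and \<open>- e\<close>. The
    summand \<open>x0\<close> keeps \<open>c\<close> nonzero.\<close>
  define c where "c = x0 + (\<Sum>e\<in>E. A e + B e)"
  have sumS: "sum f D \<in> S" if "\<And>e. f e \<in> S" for f :: "'g \<Rightarrow> 'g" and D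
    by (induction D rule: infinite_finite_induct) (auto simp: S that)
  have sumAB: "(\<Sum>e\<in>D. A e + B e) \<in> S" for D
    by (rule sumS) (rule S(2)[OF AB(1,2)])
  have cS: "c \<in> S" unfolding c_def by (rule S(2)[OF x0(1) sumAB])
  have "0 \<le> (\<Sum>e\<in>E. A e + B e)" "0 \<le> x0" by (rule nonneg[OF sumAB] nonneg[OF x0(1)])+
  then have c0: "c \<noteq> 0" using x0(2) unfolding c_def by (metis add_nonneg_eq_0_iff)
  have "F_regular_submonoid S c"
  proof unfold_locales
    show "c \<in> S" "- c \<notin> S" using cS c0 pointed by auto
    show "\<exists>q\<ge>2. \<forall>u. d + q *\<^sub>z u \<in> S \<longrightarrow> u \<in> S" if "d \<in> S" for d using F_reg that .
    fix u
    have ce: "e + c \<in> S" "c - e \<in> S" if "e \<in> E" for e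
    proof -
      define r where "r = (\<Sum>e\<in>E - {e}. A e + B e)"
      have r: "r \<in> S" unfolding r_def by (rule sumAB)
      have c: "c = x0 + (A e + B e + r)"
        unfolding c_def r_def by (subst sum.remove[OF E(1) that]) (rule refl)
      have "e + c = (A e - B e) + c" by (rule arg_cong[OF AB(3)])
      also have "\<dots> = x0 + (A e + A e + r)" unfolding c by (simp add: algebra_simps)
      finally have 1: "e + c = x0 + (A e + A e + r)" .
      have "c - e = c - (A e - B e)" by (rule arg_cong[OF AB(3)])
      also have "\<dots> = x0 + (B e + B e + r)" unfolding c by (simp add: algebra_simps)
      finally have 2: "c - e = x0 + (B e + B e + r)" .
      show "e + c \<in> S" "c - e \<in> S" unfolding 1 2
        using S(2) x0(1) AB(1,2) r by simp_all
    qed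
    have "u \<in> zmod.span E" using E by simp
    then show "\<exists>m\<ge>0. u + m *\<^sub>z c \<in> S"
    proof (induction rule: zmod.span_induct_alt)
      case base
      then show ?case using S by (intro exI[of _ 0]) simp
    next
      case (step n e y)
      then obtain m where m: "0 \<le> m" "y + m *\<^sub>z c \<in> S" by blast
      have "n *\<^sub>z e + \<bar>n\<bar> *\<^sub>z c \<in> S"
      proof (cases "0 \<le> n")
        case True
        then show ?thesis using int_scale_mem[OF ce(1)[OF step(1)] True] by (simp add: zmod.scale_right_distrib)
      next
        case False
        then show ?thesis using int_scale_mem[OF ce(2)[OF step(1)], of "- n"] by (simp add: zmod.scale_right_diff_distrib)
      qed
      from S(2)[OF this m(2)] have "n *\<^sub>z e + y + (\<bar>n\<bar> + m) *\<^sub>z c \<in> S"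
        by (simp add: zmod.scale_left_distrib algebra_simps)
      then show ?case using m by (intro exI[of _ "\<bar>n\<bar> + m"]) auto
    qed
  qed
  then show ?thesis using F_regular_submonoid.finitely_generated E pointed by blast
qed

section \<open>Growth of finitely generated field extensions\<close>

context ring
begin

text \<open>Every exponent ranges over \<open>0..n\<close> separately, and coinciding monomials are
  listed repeatedly. The length \<open>(n + 1) ^ r\<close> is the growth function on both sides of
  the later comparison.\<close>

fun monomials :: "'a list \<Rightarrow> nat \<Rightarrow> 'a list" where
  "monomials [] n = [\<one>]"
| "monomials (x # xs) n = map (\<lambda>(i, m). x [^] i \<otimes> m) (List.product [0..<Suc n] (monomials xs n))"

definition products :: "'a list \<Rightarrow> 'a list \<Rightarrow> 'a list" where
  "products us vs = map (\<lambda>(u, v). u \<otimes> v) (List.product us vs)"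

lemma length_monomials: "length (monomials xs n) = (n + 1) ^ length xs"
  by (induction xs) (simp_all del: upt_Suc)

lemma length_products: "length (products us vs) = length us * length vs"
  by (simp add: products_def)

lemma set_products: "set (products us vs) = {u \<otimes> v | u v. u \<in> set us \<and> v \<in> set vs}"
  by (auto simp: products_def)

lemma products_Cons: "products (u # us) vs = map (\<lambda>v. u \<otimes> v) vs @ products us vs"
  by (simp add: products_def)

lemma products_Nil: "products [] vs = []"
  by (simp add: products_def)

lemma set_monomials_Cons:
  "set (monomials (x # xs) n) = {x [^] i \<otimes> m | i m. i \<le> n \<and> m \<in> set (monomials xs n)}"
proof -
  have "set (monomials (x # xs) n) = (\<lambda>(i, m). x [^] i \<otimes> m) ` ({0..<Suc n} \<times> set (monomials xs n))"
    by (simp del: upt_Suc)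
  also have "\<dots> = {x [^] i \<otimes> m | i m. i \<le> n \<and> m \<in> set (monomials xs n)}"
    by (simp add: image_def Bex_def less_Suc_eq_le) blast
  finally show ?thesis .
qed

declare monomials.simps(2) [simp del]

lemma monomials_closed: "set xs \<subseteq> carrier R \<Longrightarrow> set (monomials xs n) \<subseteq> carrier R"
proof (induction xs)
  case (Cons x xs)
  then show ?case unfolding set_monomials_Cons by auto
qed simp

lemma one_in_monomials: "set xs \<subseteq> carrier R \<Longrightarrow> \<one> \<in> set (monomials xs n)"
proof (induction xs)
  case (Cons x xs)
  then have "x [^] (0::nat) \<otimes> \<one> \<in> set (monomials (x # xs) n)"
    unfolding set_monomials_Cons by fastforce
  then show ?case by simp
qed simp

lemma base_in_monomials:
  "set xs \<subseteq> carrier R \<Longrightarrow> x \<in> set xs \<Longrightarrow> x \<in> set (monomials xs (Suc n))"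
proof (induction xs)
  case (Cons y xs)
  show ?case
  proof (cases "x = y")
    case True
    then have "x [^] (1::nat) \<otimes> \<one> \<in> set (monomials (y # xs) (Suc n))"
      unfolding set_monomials_Cons using Cons one_in_monomials[of xs "Suc n"] by fastforce
    then show ?thesis using Cons True by simp
  next
    case False
    then have "y [^] (0::nat) \<otimes> x \<in> set (monomials (y # xs) (Suc n))"
      unfolding set_monomials_Cons using Cons by fastforce
    then show ?thesis using Cons by auto
  qed
qed simp

lemma Span_induct [consumes 3, case_names zero step]:
  assumes "subfield F R" "set us \<subseteq> carrier R" "v \<in> Span F us"
    and "P \<zero>"
    and "\<And>a u v. a \<in> F \<Longrightarrow> u \<in> set us \<Longrightarrow> v \<in> Span F us \<Longrightarrow> P v \<Longrightarrow> P (a \<otimes> u \<oplus> v)"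
  shows "P v"
  using assms(2-5)
proof (induction us arbitrary: v)
  case (Cons u us)
  obtain a w where v: "v = a \<otimes> u \<oplus> w" "a \<in> F" "w \<in> Span F us"
    using Cons.prems(2) by (auto simp: line_extension_mem_iff)
  have mono: "Span F us \<subseteq> Span F (u # us)"
    using mono_Span[OF assms(1)] Cons.prems(1) by simp
  have "P w"
  proof (rule Cons.IH[OF _ v(3) Cons.prems(3)])
    show "set us \<subseteq> carrier R" using Cons.prems(1) by simp
    show "P (b \<otimes> x \<oplus> y)" if "b \<in> F" "x \<in> set us" "y \<in> Span F us" "P y" for b x y
      using Cons.prems(4)[OF that(1) _ _ that(4)] that(2,3) mono by auto
  qed
  then show ?case unfolding v(1) using Cons.prems(4)[OF v(2)] v(3) mono by auto
qed simp

text \<open>A spanning list is thinned to an independent list with the same span by skipping each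
  vector that lies in the span of those after it; then two independent lists can be
  compared.\<close>

lemma independent_length_le_spanning:
  assumes F: "subfield F R" and vs: "set vs \<subseteq> carrier R"
    and us: "independent F us" "set us \<subseteq> Span F vs"
  shows "length us \<le> length vs"
proof -
  have "\<exists>bs. independent F bs \<and> Span F bs = Span F vs \<and> length bs \<le> length vs"
    using vs
  proof (induction vs)
    case (Cons v vs)
    then obtain bs where bs: "independent F bs" "Span F bs = Span F vs" "length bs \<le> length vs"
      by auto
    have eq: "Span F (v # bs) = Span F (v # vs)" using bs(2) by simp
    show ?case
    proof (cases "v \<in> Span F bs")
      case True
      have "set (v # vs) \<subseteq> Span F bs"
        using True Span_base_incl[OF F, of vs] Cons.prems bs(2) by simp
      then have "Span F (v # vs) \<subseteq> Span F bs"
        using mono_Span_subset[OF F] independent_in_carrier[OF bs(1)] by blast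
      moreover have "Span F vs \<subseteq> Span F (v # vs)" using mono_Span[OF F] Cons.prems by simp
      ultimately show ?thesis using bs by (intro exI[of _ bs]) auto
    next
      case False
      then have "independent F (v # bs)" using li_Cons bs(1) Cons.prems by simp
      then show ?thesis using eq bs(3) by (intro exI[of _ "v # bs"]) simp
    qed
  qed (auto intro: exI[of _ "[]"])
  then obtain bs where bs: "independent F bs" "Span F bs = Span F vs" "length bs \<le> length vs"
    by blast
  then show ?thesis using independent_length_le[OF F us(1) bs(1)] us(2) by simp
qed

end

declare (in ring) Span.simps [simp del]

locale subfield_pair = field K for K (structure) and k +
  assumes base: "subfield k K"
begin

lemma base_closed [simp]: "a \<in> k \<Longrightarrow> a \<in> carrier K"
  using subfieldE(3)[OF base] by blast

lemma Span_in: "set us \<subseteq> carrier K \<Longrightarrow> v \<in> Span k us \<Longrightarrow> v \<in> carrier K"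
  using Span_subgroup_props(1)[OF base] by blast

lemma Span_add: "set us \<subseteq> carrier K \<Longrightarrow> v \<in> Span k us \<Longrightarrow> w \<in> Span k us \<Longrightarrow> v \<oplus> w \<in> Span k us"
  using Span_subgroup_props(3)[OF base] by blast

lemma Span_smult: "set us \<subseteq> carrier K \<Longrightarrow> a \<in> k \<Longrightarrow> v \<in> Span k us \<Longrightarrow> a \<otimes> v \<in> Span k us"
  using Span_smult_closed[OF base] by blast

lemma Span_zero: "set us \<subseteq> carrier K \<Longrightarrow> \<zero> \<in> Span k us"
  using Span_subgroup_props(2)[OF base] by blast

lemma Span_base: "set us \<subseteq> carrier K \<Longrightarrow> u \<in> set us \<Longrightarrow> u \<in> Span k us"
  using Span_base_incl[OF base] by blast

lemma Span_mult:
  assumes c: "set us \<subseteq> carrier K" "set vs \<subseteq> carrier K" "set ws \<subseteq> carrier K"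
    and prod: "\<And>u v. u \<in> set us \<Longrightarrow> v \<in> set vs \<Longrightarrow> u \<otimes> v \<in> Span k ws"
    and x: "x \<in> Span k us" and y: "y \<in> Span k vs"
  shows "x \<otimes> y \<in> Span k ws"
proof -
  have 1: "u \<otimes> y \<in> Span k ws" if u: "u \<in> set us" for u
    using base c(2) y
  proof (induction rule: Span_induct)
    case zero
    then show ?case using c u Span_zero by auto
  next
    case (step a v y)
    have uc: "u \<in> carrier K" "v \<in> carrier K" "y \<in> carrier K" "a \<in> carrier K"
      using c u step Span_in by auto
    have "u \<otimes> (a \<otimes> v \<oplus> y) = a \<otimes> (u \<otimes> v) \<oplus> u \<otimes> y"
      using uc by algebra
    then show ?case using Span_add Span_smult c(3) step prod u by simp
  qed
  have yc: "y \<in> carrier K" using y c Span_in by auto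
  show ?thesis
    using base c(1) x
  proof (induction rule: Span_induct)
    case zero
    then show ?case using c yc Span_zero by auto
  next
    case (step a u x)
    have uc: "u \<in> carrier K" "x \<in> carrier K" "a \<in> carrier K"
      using c step Span_in by auto
    have "(a \<otimes> u \<oplus> x) \<otimes> y = a \<otimes> (u \<otimes> y) \<oplus> x \<otimes> y"
      using uc yc by algebra
    then show ?case using Span_add Span_smult c(3) step 1 by simp
  qed
qed

lemma Span_map_mult:
  assumes a: "a \<in> carrier K" and us: "set us \<subseteq> carrier K"
  shows "Span k (map (\<lambda>u. a \<otimes> u) us) = (\<lambda>u. a \<otimes> u) ` Span k us"
  using us
proof (induction us)
  case Nil
  then show ?case using a by (simp add: Span.simps)
next
  case (Cons u us)
  have u: "u \<in> carrier K" and us: "set us \<subseteq> carrier K" using Cons.prems by auto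
  have S: "Span k (x # xs) = {b \<otimes> x \<oplus> v | b v. b \<in> k \<and> v \<in> Span k xs}" for x xs
    by (simp add: Span.simps set_eq_iff line_extension_mem_iff) blast
  have e: "b \<otimes> (a \<otimes> u) \<oplus> a \<otimes> v = a \<otimes> (b \<otimes> u \<oplus> v)" if "b \<in> k" "v \<in> Span k us" for b v
  proof -
    have "b \<in> carrier K" "v \<in> carrier K" using that Span_in[OF us] by auto
    then show ?thesis using a u by algebra
  qed
  show ?case
    unfolding list.map S Cons.IH[OF us]
  proof (intro subset_antisym subsetI)
    fix z assume "z \<in> {b \<otimes> (a \<otimes> u) \<oplus> v | b v. b \<in> k \<and> v \<in> (\<otimes>) a ` Span k us}"
    then obtain b v where "z = b \<otimes> (a \<otimes> u) \<oplus> a \<otimes> v" "b \<in> k" "v \<in> Span k us" by blast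
    then show "z \<in> (\<otimes>) a ` {b \<otimes> u \<oplus> v | b v. b \<in> k \<and> v \<in> Span k us}" using e by blast
  next
    fix z assume "z \<in> (\<otimes>) a ` {b \<otimes> u \<oplus> v | b v. b \<in> k \<and> v \<in> Span k us}"
    then obtain b v where "z = a \<otimes> (b \<otimes> u \<oplus> v)" "b \<in> k" "v \<in> Span k us" by blast
    moreover from this have "z = b \<otimes> (a \<otimes> u) \<oplus> a \<otimes> v" using e by simp
    ultimately show "z \<in> {b \<otimes> (a \<otimes> u) \<oplus> v | b v. b \<in> k \<and> v \<in> (\<otimes>) a ` Span k us}" by blast
  qed
qed

lemma independent_map_mult:
  assumes a: "a \<in> carrier K" "a \<noteq> \<zero>" and us: "independent k us"
  shows "independent k (map (\<lambda>u. a \<otimes> u) us)"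
  using us
proof (induction us rule: list.induct)
  case (Cons u us)
  then have u: "u \<notin> Span k us" "independent k us" "u \<in> carrier K"
    using independent_backwards by auto
  have us: "set us \<subseteq> carrier K" using independent_in_carrier[OF u(2)] .
  have "a \<otimes> u \<notin> Span k (map (\<lambda>u. a \<otimes> u) us)"
    unfolding Span_map_mult[OF a(1) us] using a u Span_in[OF us] m_lcancel by auto
  then show ?case using Cons.IH[OF u(2)] a u by (auto intro: li_Cons)
qed simp

end

section \<open>Growth of a finite extension of \<open>k(ss)\<close>\<close>

locale finite_over_purely_generated = subfield_pair +
  fixes ss ws :: "'a list"
  assumes ss: "set ss \<subseteq> carrier K" and ws: "set ws \<subseteq> carrier K"
    and spanning: "Span (generate_field K (k \<union> set ss)) ws = carrier K"
begin

abbreviation "L \<equiv> generate_field K (k \<union> set ss)"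

text \<open>\<open>box n\<close> is the space of polynomials in \<open>ss\<close> of degree at most
  \<open>n\<close> in each variable, and \<open>filt n\<close> the space of combinations of
  \<open>ws\<close> with such coefficients. The spaces \<open>filt n\<close> need not exhaust
  \<open>K\<close>, so denominators have to be cleared before dimensions are counted.\<close>

definition box :: "nat \<Rightarrow> 'a set" where
  "box n = Span k (monomials ss n)"

definition filt :: "nat \<Rightarrow> 'a set" where
  "filt n = Span k (products (monomials ss n) ws)"

lemma L_subfield: "subfield L K"
  using subfieldE(3)[OF base] ss by (intro generate_field_is_subfield) auto

lemma mc [simp]: "set (monomials ss n) \<subseteq> carrier K"
  using monomials_closed[OF ss] .

lemma pc [simp]: "set (products (monomials ss n) ws) \<subseteq> carrier K"
  using subsetD[OF mc] subsetD[OF ws] unfolding set_products by fastforce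

lemma box_in: "x \<in> box n \<Longrightarrow> x \<in> carrier K"
  unfolding box_def by (rule Span_in[OF mc])

lemma filt_in: "x \<in> filt n \<Longrightarrow> x \<in> carrier K"
  unfolding filt_def by (rule Span_in[OF pc])

lemma monomials_mult:
  assumes "set xs \<subseteq> carrier K" "m \<in> set (monomials xs a)" "m' \<in> set (monomials xs b)"
  shows "m \<otimes> m' \<in> set (monomials xs (a + b))"
  using assms
proof (induction xs arbitrary: m m')
  case (Cons x xs)
  then obtain i n where m: "m = x [^] i \<otimes> n" "i \<le> a" "n \<in> set (monomials xs a)"
    unfolding set_monomials_Cons by blast
  from Cons obtain i' n' where m': "m' = x [^] i' \<otimes> n'" "i' \<le> b" "n' \<in> set (monomials xs b)"
    unfolding set_monomials_Cons by blast
  have c: "x \<in> carrier K" "n \<in> carrier K" "n' \<in> carrier K"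
    using Cons.prems(1) m(3) m'(3) monomials_closed[of xs] by auto
  have "m \<otimes> m' = (x [^] i \<otimes> x [^] i') \<otimes> (n \<otimes> n')"
    unfolding m m' using c by (simp add: m_ac)
  also have "\<dots> = x [^] (i + i') \<otimes> (n \<otimes> n')" using c by (simp add: nat_pow_mult)
  finally show ?case
    unfolding set_monomials_Cons using Cons.IH[OF _ m(3) m'(3)] Cons.prems(1) m(2) m'(2)
    by (auto; fastforce)
qed simp

lemma box_mult: "x \<in> box a \<Longrightarrow> y \<in> box b \<Longrightarrow> x \<otimes> y \<in> box (a + b)"
  unfolding box_def
  by (rule Span_mult[OF mc mc mc _]) (rule Span_base[OF mc monomials_mult[OF ss]])

lemma box_filt_mult: "x \<in> box a \<Longrightarrow> y \<in> filt b \<Longrightarrow> x \<otimes> y \<in> filt (a + b)"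
  unfolding box_def filt_def
proof (rule Span_mult[OF mc pc pc])
  fix u v assume u: "u \<in> set (monomials ss a)" and "v \<in> set (products (monomials ss b) ws)"
  then obtain m w where v: "v = m \<otimes> w" "m \<in> set (monomials ss b)" "w \<in> set ws"
    unfolding set_products by blast
  have "u \<in> carrier K" "m \<in> carrier K" "w \<in> carrier K" using u v mc ws by blast+
  then have "u \<otimes> v = (u \<otimes> m) \<otimes> w" unfolding v by (simp add: m_assoc)
  then have "u \<otimes> v \<in> set (products (monomials ss (a + b)) ws)"
    unfolding set_products using monomials_mult[OF ss u v(2)] v(3) by blast
  then show "u \<otimes> v \<in> Span k (products (monomials ss (a + b)) ws)" by (intro Span_base) auto
qed

lemma base_in_box: "a \<in> k \<Longrightarrow> a \<in> box n"
proof -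
  assume a: "a \<in> k"
  have "\<one> \<in> box n" unfolding box_def using one_in_monomials[OF ss] by (intro Span_base) auto
  then have "a \<otimes> \<one> \<in> box n" unfolding box_def using a by (intro Span_smult) auto
  then show ?thesis using a by simp
qed

lemma one_in_box: "\<one> \<in> box n"
  using base_in_box subringE(3)[OF subfieldE(1)[OF base]] by blast

lemma box_add: "x \<in> box n \<Longrightarrow> y \<in> box n \<Longrightarrow> x \<oplus> y \<in> box n"
  unfolding box_def by (intro Span_add) auto

lemma filt_add: "x \<in> filt n \<Longrightarrow> y \<in> filt n \<Longrightarrow> x \<oplus> y \<in> filt n"
  unfolding filt_def by (intro Span_add) auto

lemma box_uminus: "x \<in> box n \<Longrightarrow> \<ominus> x \<in> box n"
proof -
  assume x: "x \<in> box n"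
  have "\<ominus> \<one> \<in> k" using subringE(3,5)[OF subfieldE(1)[OF base]] by blast
  then have "(\<ominus> \<one>) \<otimes> x \<in> box n" using x unfolding box_def by (intro Span_smult) auto
  then show ?thesis using box_in[OF x] l_minus[of \<one> x] by simp
qed

lemma ws_in_filt: "w \<in> set ws \<Longrightarrow> w \<in> filt n"
proof -
  assume w: "w \<in> set ws"
  have "\<one> \<otimes> w \<in> set (products (monomials ss n) ws)"
    unfolding set_products using w one_in_monomials[OF ss] by blast
  then show ?thesis unfolding filt_def using w ws by (intro Span_base) auto
qed

text \<open>The elements that become a polynomial after multiplication by a nonzero polynomial are
  closed under all operations generating \<open>L\<close>; products of denominators stay in a box
  because box degrees add.\<close>

lemma L_fraction:
  "z \<in> L \<Longrightarrow> \<exists>n. \<exists>P\<in>box n. \<exists>Q\<in>box n. Q \<noteq> \<zero> \<and> Q \<otimes> z = P"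
proof (induction rule: generate_field.induct)
  case one
  then show ?case using one_in_box[of 0] by (intro exI[of _ 0] bexI[of _ \<one>]) auto
next
  case (incl h)
  have "h \<in> box 1"
  proof (cases "h \<in> k")
    case False
    then show ?thesis unfolding box_def using incl base_in_monomials[OF ss, of h 0]
      by (intro Span_base) auto
  qed (simp add: base_in_box)
  then show ?case using one_in_box[of 1] box_in by (intro exI[of _ 1] bexI[of _ h] bexI[of _ \<one>]) auto
next
  case (a_inv h)
  then obtain n P Q where h: "P \<in> box n" "Q \<in> box n" "Q \<noteq> \<zero>" "Q \<otimes> h = P" by blast
  have "h \<in> carrier K" using a_inv(1) subfieldE(3)[OF L_subfield] by blast
  then have "Q \<otimes> (\<ominus> h) = \<ominus> P" using h box_in by (metis r_minus)
  then show ?case using h box_uminus by blast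
next
  case (m_inv h)
  then obtain n P Q where h: "P \<in> box n" "Q \<in> box n" "Q \<noteq> \<zero>" "Q \<otimes> h = P" by blast
  have c: "h \<in> carrier K" "Q \<in> carrier K" "inv h \<in> carrier K" "h \<otimes> inv h = \<one>"
    using m_inv subfieldE(3)[OF L_subfield] h box_in field_Units by auto
  then have "P \<otimes> inv h = Q" using h(4) by (metis m_assoc r_one)
  moreover have "P \<noteq> \<zero>" using h(3,4) c m_inv(2) integral by blast
  ultimately show ?case using h by blast
next
  case (eng_add h1 h2)
  then obtain n1 P1 Q1 n2 P2 Q2 where h1: "P1 \<in> box n1" "Q1 \<in> box n1" "Q1 \<noteq> \<zero>" "Q1 \<otimes> h1 = P1"
    and h2: "P2 \<in> box n2" "Q2 \<in> box n2" "Q2 \<noteq> \<zero>" "Q2 \<otimes> h2 = P2" by blast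
  have c: "h1 \<in> carrier K" "h2 \<in> carrier K" "Q1 \<in> carrier K" "Q2 \<in> carrier K"
    using eng_add subfieldE(3)[OF L_subfield] h1 h2 box_in by auto
  have "(Q1 \<otimes> Q2) \<otimes> (h1 \<oplus> h2) = (Q1 \<otimes> h1) \<otimes> Q2 \<oplus> Q1 \<otimes> (Q2 \<otimes> h2)"
    using c by algebra
  then have "(Q1 \<otimes> Q2) \<otimes> (h1 \<oplus> h2) = P1 \<otimes> Q2 \<oplus> Q1 \<otimes> P2" unfolding h1 h2 .
  moreover have "Q1 \<otimes> Q2 \<noteq> \<zero>" using h1 h2 c integral by blast
  moreover have "Q1 \<otimes> Q2 \<in> box (n1 + n2)" "P1 \<otimes> Q2 \<oplus> Q1 \<otimes> P2 \<in> box (n1 + n2)"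
    using h1 h2 by (auto intro: box_mult box_add)
  ultimately show ?case by blast
next
  case (eng_mult h1 h2)
  then obtain n1 P1 Q1 n2 P2 Q2 where h1: "P1 \<in> box n1" "Q1 \<in> box n1" "Q1 \<noteq> \<zero>" "Q1 \<otimes> h1 = P1"
    and h2: "P2 \<in> box n2" "Q2 \<in> box n2" "Q2 \<noteq> \<zero>" "Q2 \<otimes> h2 = P2" by blast
  have c: "h1 \<in> carrier K" "h2 \<in> carrier K" "Q1 \<in> carrier K" "Q2 \<in> carrier K"
    using eng_mult subfieldE(3)[OF L_subfield] h1 h2 box_in by auto
  have "(Q1 \<otimes> Q2) \<otimes> (h1 \<otimes> h2) = (Q1 \<otimes> h1) \<otimes> (Q2 \<otimes> h2)"
    using c by algebra
  then have "(Q1 \<otimes> Q2) \<otimes> (h1 \<otimes> h2) = P1 \<otimes> P2" unfolding h1 h2 .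
  moreover have "Q1 \<otimes> Q2 \<noteq> \<zero>" using h1 h2 c integral by blast
  moreover have "Q1 \<otimes> Q2 \<in> box (n1 + n2)" "P1 \<otimes> P2 \<in> box (n1 + n2)"
    using h1 h2 by (auto intro: box_mult)
  ultimately show ?case by blast
qed

lemma clear_denominator:
  assumes "z \<in> carrier K"
  shows "\<exists>n. \<exists>Q\<in>box n. Q \<noteq> \<zero> \<and> Q \<otimes> z \<in> filt n"
proof -
  have z: "z \<in> Span L ws" using assms spanning by simp
  show ?thesis
    using L_subfield ws z
  proof (induction rule: Span_induct)
    case zero
    then show ?case using one_in_box[of 0] Span_zero[OF pc] unfolding filt_def
      by (intro exI[of _ 0] bexI[of _ \<one>]) auto
  next
    case (step a w v)
    then obtain n Q where v: "Q \<in> box n" "Q \<noteq> \<zero>" "Q \<otimes> v \<in> filt n" by blast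
    obtain m P D where a: "P \<in> box m" "D \<in> box m" "D \<noteq> \<zero>" "D \<otimes> a = P"
      using L_fraction[OF step(1)] by blast
    have c: "Q \<in> carrier K" "D \<in> carrier K" "a \<in> carrier K" "w \<in> carrier K" "v \<in> carrier K"
      using v a box_in step subfieldE(3)[OF L_subfield] ws spanning by auto
    have "(D \<otimes> Q) \<otimes> (a \<otimes> w \<oplus> v) = Q \<otimes> ((D \<otimes> a) \<otimes> w) \<oplus> D \<otimes> (Q \<otimes> v)"
      using c by algebra
    then have "(D \<otimes> Q) \<otimes> (a \<otimes> w \<oplus> v) = Q \<otimes> (P \<otimes> w) \<oplus> D \<otimes> (Q \<otimes> v)" unfolding a .
    moreover have "P \<otimes> w \<in> filt m"
      using box_filt_mult[OF a(1) ws_in_filt[OF step(2), of 0]] by simp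
    then have "Q \<otimes> (P \<otimes> w) \<in> filt (m + n)" using box_filt_mult[OF v(1)] by (metis add.commute)
    moreover have "D \<otimes> (Q \<otimes> v) \<in> filt (m + n)" using box_filt_mult[OF a(2) v(3)] .
    moreover have "D \<otimes> Q \<noteq> \<zero>" using v a c integral by blast
    moreover have "D \<otimes> Q \<in> box (m + n)" using box_mult[OF a(2) v(1)] .
    ultimately show ?case using filt_add by (intro exI[of _ "m + n"] bexI[of _ "D \<otimes> Q"]) auto
  qed
qed

lemma clear_denominators:
  assumes "finite Z" "Z \<subseteq> carrier K"
  shows "\<exists>n. \<exists>Q\<in>box n. Q \<noteq> \<zero> \<and> (\<forall>z\<in>Z. Q \<otimes> z \<in> filt n)"
  using assms
proof induction
  case empty
  then show ?case using one_in_box[of 0] by (intro exI[of _ 0] bexI[of _ \<one>]) auto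
next
  case (insert y Z)
  then obtain n Q where Z: "Q \<in> box n" "Q \<noteq> \<zero>" "\<And>z. z \<in> Z \<Longrightarrow> Q \<otimes> z \<in> filt n" by auto
  obtain m D where y: "D \<in> box m" "D \<noteq> \<zero>" "D \<otimes> y \<in> filt m"
    using clear_denominator[of y] insert by blast
  have c: "Q \<in> carrier K" "D \<in> carrier K" using Z y box_in by auto
  have "(Q \<otimes> D) \<otimes> z \<in> filt (n + m)" if "z \<in> insert y Z" for z
  proof (cases "z = y")
    case True
    then show ?thesis using box_filt_mult[OF Z(1) y(3)] c insert by (simp add: m_assoc)
  next
    case False
    then have "z \<in> Z" using that by simp
    moreover have "z \<in> carrier K" using insert.prems that by blast
    then have "(Q \<otimes> D) \<otimes> z = D \<otimes> (Q \<otimes> z)" using c by algebra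
    ultimately show ?thesis using box_filt_mult[OF y(1) Z(3)] by (simp add: add.commute)
  qed
  moreover have "Q \<otimes> D \<noteq> \<zero>" using Z y c integral by blast
  ultimately show ?case using box_mult[OF Z(1) y(1)] by blast
qed

text \<open>A common denominator \<open>Q\<close> for the finitely many products of
  \<open>xs\<close> with \<open>ws\<close> works for every \<open>n\<close>, because an element of
  \<open>filt n\<close> is a combination of \<open>ws\<close> with coefficients from
  \<open>box n\<close>, which pass through. The cost \<open>r\<close> of multiplying by an
  \<open>x\<close> does not depend on \<open>n\<close>.\<close>

lemma multiplication_shift:
  assumes xs: "set xs \<subseteq> carrier K"
  shows "\<exists>r. \<exists>Q\<in>box r. Q \<noteq> \<zero> \<and> (\<forall>x\<in>set xs. \<forall>n. \<forall>v\<in>filt n. Q \<otimes> x \<otimes> v \<in> filt (n + r))"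
proof -
  have "set (products xs ws) \<subseteq> carrier K"
    using xs ws unfolding set_products by (blast intro: m_closed)
  then obtain r Q where Q: "Q \<in> box r" "Q \<noteq> \<zero>" "\<And>z. z \<in> set (products xs ws) \<Longrightarrow> Q \<otimes> z \<in> filt r"
    using clear_denominators[OF finite_set] by meson
  have "Q \<otimes> x \<otimes> v \<in> filt (n + r)" if x: "x \<in> set xs" and v: "v \<in> filt n" for x n v
  proof -
    have xc: "x \<in> carrier K" "Q \<in> carrier K" using x xs Q box_in by auto
    show ?thesis
      using base pc v[unfolded filt_def]
    proof (induction rule: Span_induct)
      case zero
      then show ?case using xc Span_zero[OF pc] unfolding filt_def by simp
    next
      case (step a u v)
      obtain m w where u: "u = m \<otimes> w" "m \<in> set (monomials ss n)" "w \<in> set ws"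
        using step(2) unfolding set_products by blast
      have c: "m \<in> carrier K" "w \<in> carrier K" "v \<in> carrier K" "a \<in> carrier K"
        using subsetD[OF mc u(2)] subsetD[OF ws u(3)] step(1) Span_in[OF pc step(3)] by auto
      have "Q \<otimes> (x \<otimes> w) \<in> filt r" using Q(3) x u(3) unfolding set_products by blast
      moreover have "m \<in> box n" unfolding box_def using u by (intro Span_base) auto
      ultimately have "m \<otimes> (Q \<otimes> (x \<otimes> w)) \<in> filt (n + r)" using box_filt_mult by blast
      then have "a \<otimes> (m \<otimes> (Q \<otimes> (x \<otimes> w))) \<in> filt (n + r)"
        unfolding filt_def by (rule Span_smult[OF pc step(1)])
      then have "a \<otimes> (m \<otimes> (Q \<otimes> (x \<otimes> w))) \<oplus> Q \<otimes> x \<otimes> v \<in> filt (n + r)"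
        using filt_add step(4) by blast
      moreover have "a \<otimes> (m \<otimes> (Q \<otimes> (x \<otimes> w))) \<oplus> Q \<otimes> x \<otimes> v = Q \<otimes> x \<otimes> (a \<otimes> u \<oplus> v)"
        unfolding u using c xc by algebra
      ultimately show ?case by simp
    qed
  qed
  then show ?thesis using Q by blast
qed

text \<open>Of the \<open>n\<close> factors \<open>Q\<close>, \<open>i\<close> are paired with an
  \<open>x\<close> and the others multiply alone; either way a factor costs \<open>r\<close>. The
  multiplier \<open>Q [^] n\<close> is thus the same for all exponents
  \<open>i \<le> n\<close>.\<close>

lemma power_shift:
  assumes Q: "Q \<in> box r" and x: "x \<in> carrier K"
    and shift: "\<And>n v. v \<in> filt n \<Longrightarrow> Q \<otimes> x \<otimes> v \<in> filt (n + r)"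
  shows "i \<le> n \<Longrightarrow> v \<in> filt j \<Longrightarrow> Q [^] n \<otimes> (x [^] i \<otimes> v) \<in> filt (j + r * n)"
proof (induction n arbitrary: i)
  case 0
  then show ?case using filt_in by simp
next
  case (Suc n)
  have c: "Q \<in> carrier K" "v \<in> carrier K" using Q Suc.prems box_in filt_in by auto
  show ?case
  proof (cases i)
    case 0
    have "Q \<otimes> (Q [^] n \<otimes> (x [^] (0::nat) \<otimes> v)) \<in> filt (r + (j + r * n))"
      using box_filt_mult[OF Q Suc.IH[OF _ Suc.prems(2), of 0]] by simp
    moreover have "Q \<otimes> (Q [^] n \<otimes> (x [^] (0::nat) \<otimes> v)) = Q [^] Suc n \<otimes> (x [^] i \<otimes> v)"
      using c x 0 by (simp add: m_assoc[symmetric] m_comm)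
    ultimately show ?thesis by (simp add: algebra_simps)
  next
    case (Suc i')
    have "Q \<otimes> x \<otimes> (Q [^] n \<otimes> (x [^] i' \<otimes> v)) \<in> filt (j + r * n + r)"
      using shift Suc.IH[OF _ Suc.prems(2), of i'] Suc.prems(1) Suc by simp
    moreover have "Q \<otimes> x \<otimes> (Q [^] n \<otimes> (x [^] i' \<otimes> v)) = Q [^] Suc n \<otimes> (x [^] i \<otimes> v)"
      using c x Suc by (simp add: m_ac)
    ultimately show ?thesis by (simp add: algebra_simps)
  qed
qed

lemma monomial_shift:
  assumes Q: "Q \<in> box r" and xs: "set xs \<subseteq> carrier K"
    and shift: "\<And>x n v. x \<in> set xs \<Longrightarrow> v \<in> filt n \<Longrightarrow> Q \<otimes> x \<otimes> v \<in> filt (n + r)"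
    and m: "m \<in> set (monomials xs n)" and v: "v \<in> filt j"
  shows "Q [^] (n * length xs) \<otimes> (m \<otimes> v) \<in> filt (j + r * (n * length xs))"
  using xs shift m
proof (induction xs arbitrary: m)
  case Nil
  then show ?case using filt_in[OF v] v by simp
next
  case (Cons x xs)
  obtain i m' where m: "m = x [^] i \<otimes> m'" "i \<le> n" "m' \<in> set (monomials xs n)"
    using Cons.prems(3) unfolding set_monomials_Cons by blast
  have c: "Q \<in> carrier K" "v \<in> carrier K" "x \<in> carrier K" "m' \<in> carrier K"
    using box_in[OF Q] filt_in[OF v] Cons.prems(1) m(3) subsetD[OF monomials_closed[of xs]] by auto
  have "Q [^] (n * length xs) \<otimes> (m' \<otimes> v) \<in> filt (j + r * (n * length xs))"
    using Cons.IH[OF _ _ m(3)] Cons.prems(1,2) by auto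
  then have "Q [^] n \<otimes> (x [^] i \<otimes> (Q [^] (n * length xs) \<otimes> (m' \<otimes> v)))
      \<in> filt (j + r * (n * length xs) + r * n)"
    using power_shift[OF Q c(3) _ m(2)] Cons.prems(2) by simp
  moreover have "Q [^] n \<otimes> (x [^] i \<otimes> (Q [^] (n * length xs) \<otimes> (m' \<otimes> v)))
      = (Q [^] n \<otimes> Q [^] (n * length xs)) \<otimes> (m \<otimes> v)"
    unfolding m using c by (simp add: m_ac)
  ultimately show ?case using c by (simp add: nat_pow_mult algebra_simps)
qed

text \<open>Multiplication by \<open>E = Q [^] (n * length xs) \<otimes> D\<close> is injective and
  carries all the products into \<open>filt N\<close>, with \<open>N\<close> linear in
  \<open>n\<close>. The vectors \<open>us\<close> enter only through \<open>D\<close> and its degree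
  \<open>r'\<close>, which is absorbed by \<open>n \<ge> r'\<close>; so \<open>C\<close> can be
  chosen before \<open>us\<close>.\<close>

theorem growth_bound:
  assumes xs: "set xs \<subseteq> carrier K"
  obtains C where "\<And>us. set us \<subseteq> carrier K \<Longrightarrow>
    \<exists>n0. \<forall>n\<ge>n0. independent k (products (monomials xs n) us) \<longrightarrow>
      (n + 1) ^ length xs * length us \<le> C * (n + 1) ^ length ss"
proof -
  obtain r Q where Q: "Q \<in> box r" "Q \<noteq> \<zero>"
    and shift: "\<And>x n v. x \<in> set xs \<Longrightarrow> v \<in> filt n \<Longrightarrow> Q \<otimes> x \<otimes> v \<in> filt (n + r)"
    using multiplication_shift[OF xs] by blast
  define C where "C = (r * length xs + 1) ^ length ss * length ws"
  have "\<exists>n0. \<forall>n\<ge>n0. independent k (products (monomials xs n) us) \<longrightarrow>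
      (n + 1) ^ length xs * length us \<le> C * (n + 1) ^ length ss" if us: "set us \<subseteq> carrier K" for us
  proof -
    obtain r' D where D: "D \<in> box r'" "D \<noteq> \<zero>" "\<And>z. z \<in> set us \<Longrightarrow> D \<otimes> z \<in> filt r'"
      using clear_denominators[OF _ us] by auto
    have "(n + 1) ^ length xs * length us \<le> C * (n + 1) ^ length ss"
      if n: "r' \<le> n" and ind: "independent k (products (monomials xs n) us)" for n
    proof -
      define E where "E = Q [^] (n * length xs) \<otimes> D"
      define N where "N = r' + r * (n * length xs)"
      have c: "Q \<in> carrier K" "D \<in> carrier K" using Q D box_in by auto
      have "Q [^] l \<noteq> \<zero>" for l :: nat
        using c Q(2) by (induction l) (auto simp: integral_iff)
      then have E: "E \<in> carrier K" "E \<noteq> \<zero>" unfolding E_def using c D(2) by (auto simp: integral_iff)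
      have "set (map (\<lambda>u. E \<otimes> u) (products (monomials xs n) us)) \<subseteq> filt N"
      proof
        fix z assume "z \<in> set (map (\<lambda>u. E \<otimes> u) (products (monomials xs n) us))"
        then obtain m u where z: "z = E \<otimes> (m \<otimes> u)" "m \<in> set (monomials xs n)" "u \<in> set us"
          unfolding set_map set_products by blast
        have "m \<in> carrier K" "u \<in> carrier K" using z monomials_closed[OF xs] us by auto
        then have "z = Q [^] (n * length xs) \<otimes> (m \<otimes> (D \<otimes> u))"
          unfolding z E_def using c by (simp add: m_ac)
        then show "z \<in> filt N"
          unfolding N_def using monomial_shift[OF Q(1) xs shift z(2) D(3)[OF z(3)]] by simp
      qed
      from independent_length_le_spanning[OF base pc independent_map_mult[OF E ind] this[unfolded filt_def]]
      have "(n + 1) ^ length xs * length us \<le> (N + 1) ^ length ss * length ws"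
        by (simp add: length_products length_monomials)
      also have "N + 1 \<le> (r * length xs + 1) * (n + 1)"
        unfolding N_def using n by (simp add: algebra_simps)
      then have "(N + 1) ^ length ss * length ws \<le> ((r * length xs + 1) * (n + 1)) ^ length ss * length ws"
        by (intro mult_le_mono1 power_mono) auto
      also have "\<dots> = C * (n + 1) ^ length ss"
        unfolding C_def power_mult_distrib by (simp add: mult.commute mult.left_commute)
      finally show ?thesis .
    qed
    then show ?thesis by blast
  qed
  then show ?thesis using that by blast
qed

end

section \<open>Abhyankar valuations\<close>

fun int_independent :: "'g::ab_group_add list \<Rightarrow> bool" where
  "int_independent [] = True"
| "int_independent (g # gs) =
    ((\<forall>n. n *\<^sub>z g \<in> zmod.span (set gs) \<longrightarrow> n = 0) \<and> int_independent gs)"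

section \<open>Valuations and linear independence\<close>

locale valued_pair = subfield_pair +
  fixes \<nu> :: "'a \<Rightarrow> 'g::linordered_ab_group_add"
  assumes valuation: "valuation_over K k \<nu>"
begin

lemma val_mult:
  "x \<in> carrier K \<Longrightarrow> x \<noteq> \<zero> \<Longrightarrow> y \<in> carrier K \<Longrightarrow> y \<noteq> \<zero> \<Longrightarrow> \<nu> (x \<otimes> y) = \<nu> x + \<nu> y"
  using valuation unfolding valuation_over_def by blast

lemma val_add:
  "x \<in> carrier K \<Longrightarrow> x \<noteq> \<zero> \<Longrightarrow> y \<in> carrier K \<Longrightarrow> y \<noteq> \<zero> \<Longrightarrow> x \<oplus> y \<noteq> \<zero>
    \<Longrightarrow> min (\<nu> x) (\<nu> y) \<le> \<nu> (x \<oplus> y)"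
  using valuation unfolding valuation_over_def by blast

lemma val_base: "a \<in> k \<Longrightarrow> a \<noteq> \<zero> \<Longrightarrow> \<nu> a = 0"
  using valuation unfolding valuation_over_def by blast

lemma val_surj: obtains x where "x \<in> carrier K" "x \<noteq> \<zero>" "\<nu> x = g"
proof -
  have "g \<in> \<nu> ` (carrier K - {\<zero>})" using valuation unfolding valuation_over_def by blast
  then show ?thesis using that by blast
qed

lemma val_one: "\<nu> \<one> = 0"
  using val_base[of \<one>] subringE(3)[OF subfieldE(1)[OF base]] by simp

lemma val_uminus:
  assumes "x \<in> carrier K" "x \<noteq> \<zero>"
  shows "\<nu> (\<ominus> x) = \<nu> x"
proof -
  have "\<ominus> \<one> \<in> k" using subringE(3,5)[OF subfieldE(1)[OF base]] by blast
  moreover have m1: "\<ominus> \<one> \<noteq> \<zero>" using add.inv_eq_1_iff by simp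
  ultimately have "\<nu> (\<ominus> \<one>) = 0" using val_base by blast
  moreover have "\<ominus> x = (\<ominus> \<one>) \<otimes> x" using assms by (simp add: l_minus)
  ultimately show ?thesis using val_mult[of "\<ominus> \<one>" x] assms m1 by simp
qed

lemma val_inv:
  assumes "x \<in> carrier K" "x \<noteq> \<zero>"
  shows "\<nu> (inv x) = - \<nu> x"
proof -
  have "x \<in> Units K" using assms field_Units by blast
  then have i: "inv x \<in> carrier K" "inv x \<otimes> x = \<one>" by auto
  then have "inv x \<noteq> \<zero>" using assms by auto
  then have "\<nu> (inv x) + \<nu> x = 0" using val_mult[of "inv x" x] i assms val_one by simp
  then show ?thesis by (simp add: add_eq_0_iff2)
qed

lemma pow_nonzero: "x \<in> carrier K \<Longrightarrow> x \<noteq> \<zero> \<Longrightarrow> x [^] (n::nat) \<noteq> \<zero>"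
  by (induction n) (auto simp: integral_iff)

lemma val_pow:
  assumes "x \<in> carrier K" "x \<noteq> \<zero>"
  shows "\<nu> (x [^] (n::nat)) = int n *\<^sub>z \<nu> x"
  using assms
proof (induction n)
  case (Suc n)
  then show ?case
    using val_mult[of "x [^] n" x] pow_nonzero[of x n]
    by (simp add: zmod.scale_left_distrib add.commute)
qed (simp add: val_one)

lemma val_add_less:
  assumes x: "x \<in> carrier K" "x \<noteq> \<zero>" and y: "y \<in> carrier K" "y \<noteq> \<zero>" and less: "\<nu> x < \<nu> y"
  shows "x \<oplus> y \<noteq> \<zero>" "\<nu> (x \<oplus> y) = \<nu> x"
proof -
  have my: "\<ominus> y \<in> carrier K" "\<ominus> y \<noteq> \<zero>" "\<nu> (\<ominus> y) = \<nu> y"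
    using y val_uminus add.inv_eq_1_iff by auto
  show nz: "x \<oplus> y \<noteq> \<zero>"
  proof
    assume "x \<oplus> y = \<zero>"
    then have "x = \<ominus> y" using x y by (simp add: minus_equality)
    then show False using my less by simp
  qed
  have "\<nu> x \<le> \<nu> (x \<oplus> y)" using val_add[OF x y nz] less by simp
  moreover have "\<nu> (x \<oplus> y) \<le> \<nu> x"
  proof (rule ccontr)
    assume "\<not> \<nu> (x \<oplus> y) \<le> \<nu> x"
    moreover have e: "(x \<oplus> y) \<oplus> (\<ominus> y) = x" using x y by algebra
    then have "min (\<nu> (x \<oplus> y)) (\<nu> y) \<le> \<nu> x"
      using val_add[of "x \<oplus> y" "\<ominus> y"] x y my nz by simp
    ultimately show False using less by (simp add: min_le_iff_disj)
  qed
  ultimately show "\<nu> (x \<oplus> y) = \<nu> x" by simp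
qed

lemma val_add_distinct:
  assumes x: "x \<in> carrier K" "x \<noteq> \<zero>" and y: "y \<in> carrier K" "y \<noteq> \<zero>" and ne: "\<nu> x \<noteq> \<nu> y"
  shows "\<nu> (x \<oplus> y) = \<nu> x \<or> \<nu> (x \<oplus> y) = \<nu> y"
proof (cases "\<nu> x < \<nu> y")
  case True
  then show ?thesis using val_add_less[OF x y] by simp
next
  case False
  then show ?thesis using val_add_less[OF y x] ne x y by (simp add: a_comm)
qed

text \<open>The values of distinct blocks \<open>m \<otimes> Span us\<close> are disjoint, so the value of a sum over blocks
  is the value of one of its summands.\<close>

lemma independent_products:
  assumes us: "independent k us"
    and ms: "set ms \<subseteq> carrier K - {\<zero>}" "distinct (map \<nu> ms)"
    and sep: "\<And>m m' t t'. m \<in> set ms \<Longrightarrow> m' \<in> set ms \<Longrightarrow> t \<in> \<nu> ` (Span k us - {\<zero>}) \<Longrightarrow>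
      t' \<in> \<nu> ` (Span k us - {\<zero>}) \<Longrightarrow> \<nu> m + t = \<nu> m' + t' \<Longrightarrow> \<nu> m = \<nu> m'"
  shows "independent k (products ms us) \<and> (\<forall>v\<in>Span k (products ms us). v \<noteq> \<zero> \<longrightarrow>
    (\<exists>m\<in>set ms. \<exists>t\<in>\<nu> ` (Span k us - {\<zero>}). \<nu> v = \<nu> m + t))"
  using ms sep
proof (induction ms)
  case Nil
  then show ?case by (auto simp: products_Nil Span.simps)
next
  case (Cons m ms)
  have usc: "set us \<subseteq> carrier K" using independent_in_carrier[OF us] .
  have m: "m \<in> carrier K" "m \<noteq> \<zero>" using Cons.prems(1) by auto
  define A where "A = map (\<lambda>u. m \<otimes> u) us"
  have A: "independent k A" unfolding A_def using independent_map_mult[OF m us] .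
  have Ac: "set A \<subseteq> carrier K" using independent_in_carrier[OF A] .
  have IH: "independent k (products ms us)"
    "\<And>v. v \<in> Span k (products ms us) \<Longrightarrow> v \<noteq> \<zero> \<Longrightarrow>
      \<exists>m\<in>set ms. \<exists>t\<in>\<nu> ` (Span k us - {\<zero>}). \<nu> v = \<nu> m + t"
    using Cons.IH Cons.prems by auto
  have Pc: "set (products ms us) \<subseteq> carrier K" using independent_in_carrier[OF IH(1)] .
  have valA: "\<exists>t\<in>\<nu> ` (Span k us - {\<zero>}). \<nu> v = \<nu> m + t" if v: "v \<in> Span k A" "v \<noteq> \<zero>" for v
  proof -
    obtain u where u: "u \<in> Span k us" "v = m \<otimes> u"
      using v(1) unfolding A_def Span_map_mult[OF m(1) usc] by blast
    then have "u \<in> carrier K" "u \<noteq> \<zero>" using Span_in[OF usc] m v(2) by auto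
    then show ?thesis using u val_mult[OF m] by blast
  qed
  have disj: "\<nu> v \<noteq> \<nu> w"
    if vw: "v \<in> Span k A" "v \<noteq> \<zero>" "w \<in> Span k (products ms us)" "w \<noteq> \<zero>" for v w
  proof
    assume eq: "\<nu> v = \<nu> w"
    obtain t where t: "t \<in> \<nu> ` (Span k us - {\<zero>})" "\<nu> v = \<nu> m + t" using valA vw by blast
    obtain m' t' where t': "m' \<in> set ms" "t' \<in> \<nu> ` (Span k us - {\<zero>})" "\<nu> w = \<nu> m' + t'"
      using IH(2) vw by blast
    have "\<nu> m = \<nu> m'" using Cons.prems(3)[OF _ _ t(1) t'(2)] t'(1,3) t(2) eq by simp
    then show False using Cons.prems(2) t'(1) by auto
  qed
  have "Span k A \<inter> Span k (products ms us) = {\<zero>}"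
    using disj Span_zero[OF Ac] Span_zero[OF Pc] by blast
  then have ind: "independent k (products (m # ms) us)"
    unfolding products_Cons A_def[symmetric] using independent_append[OF base A IH(1)] by simp
  have "\<exists>m'\<in>set (m # ms). \<exists>t\<in>\<nu> ` (Span k us - {\<zero>}). \<nu> v = \<nu> m' + t"
    if v: "v \<in> Span k (products (m # ms) us)" "v \<noteq> \<zero>" for v
  proof -
    have "v \<in> Span k A <+>\<^bsub>K\<^esub> Span k (products ms us)"
      using v(1) Span_append_eq_set_add[OF base Ac Pc] unfolding products_Cons A_def by simp
    then obtain a b where ab: "a \<in> Span k A" "b \<in> Span k (products ms us)" "v = a \<oplus> b"
      unfolding set_add_def' by blast
    have c: "a \<in> carrier K" "b \<in> carrier K" using Span_in[OF Ac] Span_in[OF Pc] ab by auto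
    consider "a = \<zero>" "v = b" | "b = \<zero>" "v = a" | "a \<noteq> \<zero>" "b \<noteq> \<zero>" using ab c by fastforce
    then show ?thesis
    proof cases
      case 1
      then show ?thesis using IH(2) ab v by auto
    next
      case 2
      then show ?thesis using valA ab v by auto
    next
      case 3
      then have "\<nu> v = \<nu> a \<or> \<nu> v = \<nu> b"
        unfolding ab using val_add_distinct[OF c(1) _ c(2)] disj[OF ab(1) _ ab(2)] by blast
      then show ?thesis
      proof
        assume "\<nu> v = \<nu> a"
        then show ?thesis using valA[OF ab(1) 3(1)] by simp
      next
        assume "\<nu> v = \<nu> b"
        then show ?thesis using IH(2)[OF ab(2) 3(2)] by simp
      qed
    qed
  qed
  then show ?case using ind by blast
qed

text \<open>If two monomials have the same value, the difference of their exponents of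
  \<open>x\<close> multiplies \<nu> x into the span of the remaining values and so is 0. The
  exponents are recovered from the value one at a time.\<close>

lemma monomials_values:
  assumes "set xs \<subseteq> carrier K - {\<zero>}" "int_independent (map \<nu> xs)"
  shows "set (monomials xs n) \<subseteq> carrier K - {\<zero>} \<and> distinct (map \<nu> (monomials xs n))
    \<and> \<nu> ` set (monomials xs n) \<subseteq> zmod.span (\<nu> ` set xs)"
  using assms
proof (induction xs)
  case Nil
  then show ?case by (simp add: val_one zmod.span_zero)
next
  case (Cons x xs)
  have x: "x \<in> carrier K" "x \<noteq> \<zero>" using Cons.prems by auto
  have IH: "set (monomials xs n) \<subseteq> carrier K - {\<zero>}" "distinct (map \<nu> (monomials xs n))"
    "\<nu> ` set (monomials xs n) \<subseteq> zmod.span (\<nu> ` set xs)"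
    using Cons by auto
  have val: "\<nu> (x [^] i \<otimes> m) = int i *\<^sub>z \<nu> x + \<nu> m" if "m \<in> set (monomials xs n)" for i :: nat and m
    using val_mult[of "x [^] i" m] val_pow[OF x] pow_nonzero[OF x] IH(1) that x by auto
  have dist: "distinct (monomials xs n)" "inj_on \<nu> (set (monomials xs n))"
    using IH(2) by (auto simp: distinct_map)
  have inj: "inj_on (\<lambda>(i, m). int i *\<^sub>z \<nu> x + \<nu> m) (set (List.product [0..<Suc n] (monomials xs n)))"
  proof (rule inj_onI, clarify)
    fix i j :: nat and m m'
    assume m: "(i, m) \<in> set (List.product [0..<Suc n] (monomials xs n))"
      "(j, m') \<in> set (List.product [0..<Suc n] (monomials xs n))"
      and eq: "int i *\<^sub>z \<nu> x + \<nu> m = int j *\<^sub>z \<nu> x + \<nu> m'"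
    then have mm: "m \<in> set (monomials xs n)" "m' \<in> set (monomials xs n)" by auto
    have "(int i - int j) *\<^sub>z \<nu> x = \<nu> m' - \<nu> m"
      using eq by (simp add: zmod.scale_left_diff_distrib algebra_simps)
    also have "\<dots> \<in> zmod.span (\<nu> ` set xs)" using IH(3) mm by (intro zmod.span_diff) auto
    finally have "(int i - int j) *\<^sub>z \<nu> x \<in> zmod.span (\<nu> ` set xs)" .
    moreover have "\<forall>n. n *\<^sub>z \<nu> x \<in> zmod.span (\<nu> ` set xs) \<longrightarrow> n = 0"
      using Cons.prems(2) by simp
    ultimately have "int i - int j = 0" by blast
    then have "i = j" by simp
    then show "i = j \<and> m = m'" using eq dist(2) mm by (auto dest: inj_onD)
  qed
  have "map \<nu> (monomials (x # xs) n)
      = map (\<lambda>(i, m). int i *\<^sub>z \<nu> x + \<nu> m) (List.product [0..<Suc n] (monomials xs n))"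
    unfolding monomials.simps(2) map_map
    by (rule map_cong[OF refl]) (use val in \<open>auto simp del: upt_Suc\<close>)
  moreover have "distinct (List.product [0..<Suc n] (monomials xs n))"
    using dist(1) by (intro distinct_product) auto
  ultimately have d: "distinct (map \<nu> (monomials (x # xs) n))"
    using inj by (simp add: distinct_map del: upt_Suc)
  have "\<nu> ` set (monomials (x # xs) n) \<subseteq> zmod.span (\<nu> ` set (x # xs))"
  proof
    fix g assume "g \<in> \<nu> ` set (monomials (x # xs) n)"
    then obtain z where z: "z \<in> set (monomials (x # xs) n)" "g = \<nu> z" by blast
    then obtain i :: nat and m where im: "m \<in> set (monomials xs n)" "g = \<nu> (x [^] i \<otimes> m)"
      unfolding set_monomials_Cons by blast
    have "\<nu> m \<in> zmod.span (\<nu> ` set (x # xs))"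
      using IH(3) im(1) zmod.span_mono[of "\<nu> ` set xs" "\<nu> ` set (x # xs)"] by auto
    then show "g \<in> zmod.span (\<nu> ` set (x # xs))"
      unfolding im(2) val[OF im(1)]
      by (intro zmod.span_add zmod.span_scale[OF zmod.span_base]) auto
  qed
  moreover have "set (monomials (x # xs) n) \<subseteq> carrier K - {\<zero>}"
    unfolding set_monomials_Cons using IH(1) x pow_nonzero by (auto simp: integral_iff)
  ultimately show ?case using d by blast
qed

lemma Span_singleton_values: "\<nu> ` (Span k [\<one>] - {\<zero>}) = {0}"
proof -
  have "Span k [\<one>] = k"
    by (auto simp: Span.simps line_extension_mem_iff)
  moreover have "\<one> \<in> k - {\<zero>}" using subringE(3)[OF subfieldE(1)[OF base]] by simp
  ultimately show ?thesis using val_base by (auto simp: image_iff)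
qed

lemma independent_one: "independent k [\<one>]"
  by (intro li_Cons) (auto simp: Span.simps)

end

section \<open>Abhyankar's inequality and the case of equality\<close>

locale abhyankar = finite_over_purely_generated K k ss ws + valued_pair K k \<nu>
  for K :: "('a, 'b) ring_scheme" (structure) and k ss ws and \<nu> :: "'a \<Rightarrow> 'g::linordered_ab_group_add" +
  fixes xs :: "'a list"
  assumes xs: "set xs \<subseteq> carrier K - {\<zero>}" and xs_independent: "int_independent (map \<nu> xs)"
begin

text \<open>Multiplying by a monomial changes a value within the subgroup spanned by the values of
  \<open>xs\<close>. If distinct values on the span of \<open>us\<close> are incongruent modulo this
  subgroup, the sum of a monomial value and such a value determines both.\<close>

lemma independent_monomial_products:
  assumes us: "independent k us"
    and T: "\<And>t t'. t \<in> \<nu> ` (Span k us - {\<zero>}) \<Longrightarrow> t' \<in> \<nu> ` (Span k us - {\<zero>}) \<Longrightarrow>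
      t - t' \<in> zmod.span (\<nu> ` set xs) \<Longrightarrow> t = t'"
  shows "independent k (products (monomials xs n) us)"
proof -
  have M: "set (monomials xs n) \<subseteq> carrier K - {\<zero>}" "distinct (map \<nu> (monomials xs n))"
    "\<nu> ` set (monomials xs n) \<subseteq> zmod.span (\<nu> ` set xs)"
    using monomials_values[OF xs xs_independent] by auto
  have "\<nu> m = \<nu> m'" if m: "m \<in> set (monomials xs n)" "m' \<in> set (monomials xs n)"
    and t: "t \<in> \<nu> ` (Span k us - {\<zero>})" "t' \<in> \<nu> ` (Span k us - {\<zero>})" and eq: "\<nu> m + t = \<nu> m' + t'"
  for m m' t t'
  proof -
    have "t - t' = \<nu> m' - \<nu> m" using eq by (simp add: algebra_simps)
    also have "\<dots> \<in> zmod.span (\<nu> ` set xs)" using M(3) m by (intro zmod.span_diff) auto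
    finally have "t = t'" using T t by blast
    then show ?thesis using eq by simp
  qed
  then show ?thesis using independent_products[OF us M(1,2)] by blast
qed

text \<open>This is Abhyankar's inequality read as growth: for \<open>us = [\<one>]\<close> the
  monomials in \<open>xs\<close> themselves are independent, and a larger power of
  \<open>n + 1\<close> cannot stay below a multiple of a smaller one.\<close>

lemma rational_rank_le: "length xs \<le> length ss"
proof (rule ccontr)
  assume less: "\<not> length xs \<le> length ss"
  obtain C where C: "\<And>us. set us \<subseteq> carrier K \<Longrightarrow>
    \<exists>n0. \<forall>n\<ge>n0. independent k (products (monomials xs n) us) \<longrightarrow>
      (n + 1) ^ length xs * length us \<le> C * (n + 1) ^ length ss"
    using growth_bound[of xs] xs by blast
  have "independent k (products (monomials xs n) [\<one>])" for n
    using independent_one Span_singleton_values by (intro independent_monomial_products) auto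
  then obtain n0 where n0: "\<And>n. n0 \<le> n \<Longrightarrow> (n + 1) ^ length xs \<le> C * (n + 1) ^ length ss"
    using C[of "[\<one>]"] by auto
  \<comment> \<open>Large enough for the growth bound and with \<open>n + 1 > C\<close>, so that one
    surplus factor \<open>n + 1\<close> contradicts it.\<close>
  define n where "n = n0 + C"
  have "(n + 1) ^ length ss * (n + 1) = (n + 1) ^ Suc (length ss)" by simp
  also have "\<dots> \<le> (n + 1) ^ length xs" using less by (intro power_increasing) auto
  also have "\<dots> \<le> C * (n + 1) ^ length ss" using n0 n_def by simp
  also have "\<dots> = (n + 1) ^ length ss * C" by simp
  finally have "n + 1 \<le> C" by (subst (asm) nat_mult_le_cancel1) auto
  then show False unfolding n_def by simp
qed

text \<open>With equal exponents the powers of \<open>n + 1\<close> cancel. The bound serves twice: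
  for vectors with incongruent values it bounds the index of a subgroup, and for powers of an
  element of value 0 it bounds a degree.\<close>

lemma bounded_multiplicity:
  assumes eq: "length xs = length ss"
  obtains C where "\<And>us. independent k us \<Longrightarrow>
    (\<And>t t'. t \<in> \<nu> ` (Span k us - {\<zero>}) \<Longrightarrow> t' \<in> \<nu> ` (Span k us - {\<zero>}) \<Longrightarrow>
      t - t' \<in> zmod.span (\<nu> ` set xs) \<Longrightarrow> t = t') \<Longrightarrow> length us \<le> C"
proof -
  obtain C where C: "\<And>us. set us \<subseteq> carrier K \<Longrightarrow>
    \<exists>n0. \<forall>n\<ge>n0. independent k (products (monomials xs n) us) \<longrightarrow>
      (n + 1) ^ length xs * length us \<le> C * (n + 1) ^ length ss"
    using growth_bound[of xs] xs by blast
  have "length us \<le> C" if us: "independent k us"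
    and T: "\<And>t t'. t \<in> \<nu> ` (Span k us - {\<zero>}) \<Longrightarrow> t' \<in> \<nu> ` (Span k us - {\<zero>}) \<Longrightarrow>
      t - t' \<in> zmod.span (\<nu> ` set xs) \<Longrightarrow> t = t'" for us
  proof -
    have "independent k (products (monomials xs n) us)" for n
      using independent_monomial_products[OF us T] .
    then obtain n where "(n + 1) ^ length xs * length us \<le> C * (n + 1) ^ length ss"
      using C[OF independent_in_carrier[OF us]] by blast
    then show ?thesis unfolding eq by (simp add: mult.commute)
  qed
  then show ?thesis using that by blast
qed

text \<open>The values of \<open>xs\<close> span a subgroup of finite index: lists of pairwise
  incongruent values have bounded length, and a longest one represents all cosets.\<close>

lemma value_group_finitely_generated:
  assumes eq: "length xs = length ss"
  shows "\<exists>E :: 'g set. finite E \<and> zmod.span E = UNIV"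
proof -
  obtain C where C: "\<And>us. independent k us \<Longrightarrow>
    (\<And>t t'. t \<in> \<nu> ` (Span k us - {\<zero>}) \<Longrightarrow> t' \<in> \<nu> ` (Span k us - {\<zero>}) \<Longrightarrow>
      t - t' \<in> zmod.span (\<nu> ` set xs) \<Longrightarrow> t = t') \<Longrightarrow> length us \<le> C"
    using bounded_multiplicity[OF eq] by blast
  define ineq :: "'g list \<Rightarrow> bool" where "ineq gs \<longleftrightarrow> distinct gs \<and>
    (\<forall>g\<in>set gs. \<forall>h\<in>set gs. g - h \<in> zmod.span (\<nu> ` set xs) \<longrightarrow> g = h)" for gs
  have bound: "length gs \<le> C" if gs: "ineq gs" for gs
  proof -
    define pick where "pick g = (SOME x. x \<in> carrier K \<and> x \<noteq> \<zero> \<and> \<nu> x = g)" for g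
    have pick: "pick g \<in> carrier K \<and> pick g \<noteq> \<zero> \<and> \<nu> (pick g) = g" for g
      unfolding pick_def by (rule someI_ex) (metis val_surj)
    define us where "us = map pick gs"
    have map: "map \<nu> us = gs" unfolding us_def using pick by (simp add: map_idI)
    have usc: "set us \<subseteq> carrier K - {\<zero>}" unfolding us_def using pick by auto
    \<comment> \<open>Reading the vectors as one-element blocks over \<open>[\<one>]\<close> gives
      their independence and shows that the values on their span are again among
      \<open>gs\<close>.\<close>
    have eq: "products us [\<one>] = us"
      unfolding us_def by (induction gs) (use pick in \<open>auto simp: products_Nil products_Cons\<close>)
    have "distinct (map \<nu> us)" unfolding map using gs ineq_def by blast
    then have P: "independent k us"
      "\<And>v. v \<in> Span k us \<Longrightarrow> v \<noteq> \<zero> \<Longrightarrow> \<exists>m\<in>set us. \<nu> v = \<nu> m"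
      using independent_products[OF independent_one usc] Span_singleton_values unfolding eq by auto
    have "\<nu> ` (Span k us - {\<zero>}) \<subseteq> set gs"
      using P(2) unfolding map[symmetric] by fastforce
    then have "length us \<le> C" using C[OF P(1)] gs unfolding ineq_def by blast
    then show ?thesis unfolding us_def by simp
  qed
  have "ineq []" unfolding ineq_def by simp
  then obtain gs where gs: "ineq gs" "\<And>hs. ineq hs \<Longrightarrow> length hs \<le> length gs"
    using ex_has_greatest_nat[of ineq "[]" length "Suc C"] bound by (force simp: less_Suc_eq_le)
  have "g \<in> zmod.span (set gs \<union> \<nu> ` set xs)" for g
  proof -
    have "\<not> ineq (g # gs)" using gs(2)[of "g # gs"] by auto
    then have "\<exists>h\<in>set gs. g - h \<in> zmod.span (\<nu> ` set xs)"
    proof (rule contrapos_np)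
      assume no: "\<not> (\<exists>h\<in>set gs. g - h \<in> zmod.span (\<nu> ` set xs))"
      have "h - g \<notin> zmod.span (\<nu> ` set xs)" if "h \<in> set gs" for h
        using no that zmod.span_neg[of "h - g" "\<nu> ` set xs"] by auto
      moreover have "g \<notin> set gs" using no zmod.span_zero[of "\<nu> ` set xs"] by force
      ultimately show "ineq (g # gs)" using gs(1) no unfolding ineq_def by auto
    qed
    then obtain h where h: "h \<in> set gs" "g - h \<in> zmod.span (\<nu> ` set xs)" by blast
    have "g - h \<in> zmod.span (set gs \<union> \<nu> ` set xs)"
      using h(2) zmod.span_mono[of "\<nu> ` set xs" "set gs \<union> \<nu> ` set xs"] by auto
    moreover have "h \<in> zmod.span (set gs \<union> \<nu> ` set xs)" using h(1) zmod.span_base by blast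
    ultimately have "(g - h) + h \<in> zmod.span (set gs \<union> \<nu> ` set xs)" by (rule zmod.span_add)
    then show ?thesis by simp
  qed
  then show ?thesis by (intro exI[of _ "set gs \<union> \<nu> ` set xs"]) auto
qed

text \<open>Otherwise every nonzero polynomial over \<open>k\<close> takes at \<open>y\<close> a
  nonzero element of value 0, so the powers of \<open>y\<close> are independent and the condition on
  values holds trivially; \<open>C + 1\<close> of them contradict the bound. The residue of
  \<open>y\<close> is thus algebraic over \<open>k\<close>.\<close>

lemma residue_polynomial:
  assumes eq: "length xs = length ss" and y: "y \<in> carrier K" "y \<noteq> \<zero>" "\<nu> y = 0"
  shows "\<exists>p\<in>carrier (univ_poly K k). p \<noteq> [] \<and> (eval p y = \<zero> \<or> 0 < \<nu> (eval p y))"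
proof (rule ccontr)
  assume no: "\<not> ?thesis"
  obtain C where C: "\<And>us. independent k us \<Longrightarrow>
    (\<And>t t'. t \<in> \<nu> ` (Span k us - {\<zero>}) \<Longrightarrow> t' \<in> \<nu> ` (Span k us - {\<zero>}) \<Longrightarrow>
      t - t' \<in> zmod.span (\<nu> ` set xs) \<Longrightarrow> t = t') \<Longrightarrow> length us \<le> C"
    using bounded_multiplicity[OF eq] by blast
  have tr: "(transcendental over k) y"
  proof (rule ccontr)
    assume "\<not> (transcendental over k) y"
    then have "(algebraic over k) y" by (simp add: over_def)
    then show False using algebraicE[OF subfieldE(1)[OF base] y(1)] no by metis
  qed
  have len: "length (exp_base y n) = n" for n by (simp add: exp_base_def)
  have c: "set (exp_base y n) \<subseteq> carrier K" for n using exp_base_closed[OF y(1)] .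
  have S: "\<exists>p\<in>carrier (univ_poly K k). length p \<le> n \<and> v = eval p y"
    if "v \<in> Span k (exp_base y n)" for v n
    using that unfolding Span_eq_eval_img[OF base y(1)] by auto
  have ind: "independent k (exp_base y n)" for n
  proof (induction n)
    case 0
    then show ?case by (simp add: exp_base_def)
  next
    case (Suc n)
    have "y [^] n \<notin> Span k (exp_base y n)"
    proof
      assume "y [^] n \<in> Span k (exp_base y n)"
      then obtain p where p: "p \<in> carrier (univ_poly K k)" "length p \<le> n" "y [^] n = eval p y"
        using S by blast
      have m: "monom \<one> n \<in> carrier (univ_poly K k)"
        unfolding univ_poly_carrier[symmetric]
        using monom_is_polynomial[OF subfieldE(1)[OF base]] subringE(3)[OF subfieldE(1)[OF base]] by simp
      have "eval (monom \<one> n) y = eval p y" using eval_monom[OF one_closed y(1), of n] p(3)[symmetric] nat_pow_closed[OF y(1), of n] by simp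
      then have "monom \<one> n = p" using tr m p(1) unfolding over_def transcendental_def by (auto dest: inj_onD)
      then show False using p(2) unfolding monom_def by auto
    qed
    then have "independent k (y [^] n # exp_base y n)" using y Suc by (intro li_Cons) auto
    then show ?case by (simp add: exp_base_def)
  qed
  have val: "\<nu> v = 0" if v: "v \<in> Span k (exp_base y n)" "v \<noteq> \<zero>" for v n
  proof -
    obtain p where p: "p \<in> carrier (univ_poly K k)" "v = eval p y" using S v by blast
    then have "p \<noteq> []" using v(2) by auto
    then have "\<not> 0 < \<nu> v" using no p by auto
    moreover have "0 \<le> \<nu> v"
      using base c v
    proof (induction rule: Span_induct)
      case (step a u w)
      have "u \<in> \<nu> -` {0} \<inter> (carrier K - {\<zero>})"
        using step(2) y val_pow[OF y(1,2)] pow_nonzero[OF y(1,2)] by (auto simp: exp_base_def)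
      then have u: "u \<in> carrier K" "u \<noteq> \<zero>" "\<nu> u = 0" by auto
      have w: "w \<in> carrier K" using Span_in[OF c step(3)] .
      show ?case
      proof (cases "a = \<zero>")
        case True
        then show ?thesis using step u w by simp
      next
        case False
        then have au: "a \<otimes> u \<in> carrier K" "a \<otimes> u \<noteq> \<zero>" "\<nu> (a \<otimes> u) = 0"
          using step(1) u val_mult[of a u] val_base by (auto simp: integral_iff)
        show ?thesis
        proof (cases "w = \<zero>")
          case True
          then show ?thesis using au by simp
        next
          case False
          then show ?thesis using val_add[OF au(1,2) w False] au step by auto
        qed
      qed
    qed simp
    ultimately show ?thesis by simp
  qed
  have "length (exp_base y (Suc C)) \<le> C"
  proof (rule C[OF ind])
    fix t t' assume "t \<in> \<nu> ` (Span k (exp_base y (Suc C)) - {\<zero>})"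
      "t' \<in> \<nu> ` (Span k (exp_base y (Suc C)) - {\<zero>})"
    then have "t = 0" "t' = 0" using val by blast+
    then show "t = t'" by simp
  qed
  then show False unfolding len by simp
qed

end

section \<open>Roots and residues over an algebraically closed base field\<close>

lemma (in subfield_pair) algebraically_closed_split:
  assumes ac: "algebraically_closed (K\<lparr>carrier := k\<rparr>)"
    and p: "p \<in> carrier (univ_poly K k)" "0 < degree p"
  shows "\<exists>t\<in>k. eval p t = \<zero>"
    "\<exists>b\<in>k. \<exists>q\<in>carrier (univ_poly K k). p = [\<one>, b] \<otimes>\<^bsub>univ_poly K k\<^esub> q"
proof -
  interpret A: algebraically_closed "K\<lparr>carrier := k\<rparr>" by (rule ac)
  note sub = subfieldE(1)[OF base]
  have poly: "univ_poly (K\<lparr>carrier := k\<rparr>) (carrier (K\<lparr>carrier := k\<rparr>)) = univ_poly K k"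
    using univ_poly_consistent[OF sub] by simp
  have pA: "p \<in> carrier (univ_poly (K\<lparr>carrier := k\<rparr>) (carrier (K\<lparr>carrier := k\<rparr>)))"
    unfolding poly by (rule p(1))
  have "size (A.roots p) = degree p" using A.roots_over_carrier[OF pA] unfolding A.splitted_def .
  then have "A.roots p \<noteq> {#}" using p(2) by auto
  then obtain t where "t \<in># A.roots p" by blast
  then have root: "A.is_root p t" using A.roots_mem_iff_is_root[OF pA] by blast
  then show "\<exists>t\<in>k. eval p t = \<zero>"
    unfolding A.is_root_def eval_consistent[OF sub] by auto
  define b where "b = \<ominus>\<^bsub>K\<lparr>carrier := k\<rparr>\<^esub> t"
  have "b \<in> carrier (K\<lparr>carrier := k\<rparr>)" unfolding b_def using root A.is_root_def by (intro A.a_inv_closed) blast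
  moreover obtain q where "q \<in> carrier (univ_poly K k)" "p = [\<one>, b] \<otimes>\<^bsub>univ_poly K k\<^esub> q"
    using A.is_root_imp_pdivides[OF pA root] unfolding pdivides_def factor_def poly b_def by auto
  ultimately show "\<exists>b\<in>k. \<exists>q\<in>carrier (univ_poly K k). p = [\<one>, b] \<otimes>\<^bsub>univ_poly K k\<^esub> q" by auto
qed

lemma (in subfield_pair) ex_power_root:
  assumes ac: "algebraically_closed (K\<lparr>carrier := k\<rparr>)" and t: "t \<in> k" and q: "0 < (q::nat)"
  shows "\<exists>s\<in>k. s [^] q = t"
proof -
  note sub = subfieldE(1)[OF base]
  have one: "\<one> \<in> k" "\<zero> \<in> k" "\<ominus> t \<in> k" using subringE(2,3,5)[OF sub] t by auto
  obtain n where n: "q = Suc n" using q by (cases q) auto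
  \<comment> \<open>Coefficients are listed from the leading one down, so this is
    \<open>X^q - t\<close> with \<open>n = q - 1\<close> zeros in between.\<close>
  define p where "p = \<one> # replicate n \<zero> @ [\<ominus> t]"
  have "p \<in> carrier (univ_poly K k)"
    unfolding p_def univ_poly_carrier[symmetric] polynomial_def using one by auto
  moreover have "0 < degree p" unfolding p_def by simp
  ultimately obtain s where s: "s \<in> k" "eval p s = \<zero>"
    using algebraically_closed_split(1)[OF ac] by blast
  have sc: "s \<in> carrier K" using s by simp
  have "eval (replicate n \<zero> @ [\<ominus> t]) s = \<ominus> t"
    by (induction n) (use sc t in auto)
  then have "eval p s = s [^] q \<ominus> t"
    unfolding p_def n using sc by (simp add: minus_eq)
  then have "s [^] q \<ominus> t = \<zero>" using s by simp
  then show ?thesis using s sc t by (intro bexI[of _ s]) (auto simp: r_right_minus_eq)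
qed

text \<open>The polynomial splits into linear factors over \<open>k\<close>, and a product that
  vanishes or has positive value at \<open>y\<close> has a factor with this property. A nonzero
  constant has value 0, so the descent on the degree ends at a linear factor. The element
  \<open>- b\<close> is the residue of \<open>y\<close>.\<close>

lemma (in valued_pair) residue_algebraic_imp_base:
  assumes ac: "algebraically_closed (K\<lparr>carrier := k\<rparr>)" and y: "y \<in> carrier K"
    and p: "p \<in> carrier (univ_poly K k)" "p \<noteq> []" "eval p y = \<zero> \<or> 0 < \<nu> (eval p y)"
  shows "\<exists>b\<in>k. y \<oplus> b = \<zero> \<or> 0 < \<nu> (y \<oplus> b)"
  using p
proof (induction "degree p" arbitrary: p rule: less_induct)
  case less
  note sub = subfieldE(1)[OF base]
  have pk: "set p \<subseteq> k" "lead_coeff p \<noteq> \<zero>"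
    using less.prems(1,2) unfolding univ_poly_carrier[symmetric] polynomial_def by auto
  show ?case
  proof (cases "degree p = 0")
    case True
    then obtain a where a: "p = [a]" using less.prems(2) by (cases p) auto
    then have "a \<in> k" "a \<noteq> \<zero>" using pk by auto
    then have "eval p y = a" "\<nu> a = 0" unfolding a using y val_base by auto
    then show ?thesis using less.prems(3) \<open>a \<noteq> \<zero>\<close> by simp
  next
    case False
    then obtain b q where b: "b \<in> k" and q: "q \<in> carrier (univ_poly K k)"
      and p: "p = [\<one>, b] \<otimes>\<^bsub>univ_poly K k\<^esub> q"
      using algebraically_closed_split(2)[OF ac less.prems(1)] by auto
    have l: "[\<one>, b] \<in> carrier (univ_poly K k)"
      unfolding univ_poly_carrier[symmetric] polynomial_def using b subringE(3)[OF sub] by simp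
    have poly: "polynomial k [\<one>, b]" "polynomial k q" using l q unfolding univ_poly_carrier by auto
    have pm: "p = poly_mult [\<one>, b] q" unfolding p univ_poly_mult by simp
    have q0: "q \<noteq> []" using less.prems(2) poly_mult_zero(2)[of "[\<one>, b]"] b unfolding pm by auto
    have "degree p = 1 + degree q"
      unfolding pm using poly_mult_degree_eq[OF sub poly] q0 by simp
    then have deg: "degree q < degree p" by simp
    have qc: "set q \<subseteq> carrier K" using poly(2) polynomial_in_carrier[OF sub] by blast
    have ev: "eval p y = (y \<oplus> b) \<otimes> eval q y"
      unfolding pm using eval_poly_mult[of "[\<one>, b]" q y] qc y b by simp
    have c: "y \<oplus> b \<in> carrier K" "eval q y \<in> carrier K" using y b eval_in_carrier[OF qc y] by auto
    consider "y \<oplus> b = \<zero>" | "eval q y = \<zero>" | "y \<oplus> b \<noteq> \<zero>" "eval q y \<noteq> \<zero>" by blast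
    then show ?thesis
    proof cases
      case 1
      then show ?thesis using b by blast
    next
      case 2
      then show ?thesis using less.hyps[OF deg q q0] by blast
    next
      case 3
      then have "eval p y \<noteq> \<zero>" unfolding ev using c by (simp add: integral_iff)
      then have "0 < \<nu> (y \<oplus> b) + \<nu> (eval q y)"
        using less.prems(3) val_mult[OF c(1) 3(1) c(2) 3(2)] unfolding ev by simp
      then have "0 < \<nu> (y \<oplus> b) \<or> 0 < \<nu> (eval q y)"
        by (metis add_nonpos_nonpos not_le)
      then show ?thesis using b less.hyps[OF deg q q0] by blast
    qed
  qed
qed

section \<open>Reduction to finitely many transcendentals\<close>

lemma (in field) generate_field_finitary:
  assumes "S \<subseteq> carrier R" "k \<subseteq> carrier R" "x \<in> generate_field R (k \<union> S)"
  shows "\<exists>F. finite F \<and> F \<subseteq> S \<and> x \<in> generate_field R (k \<union> F)"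
proof -
  have mono: "generate_field R (k \<union> F) \<subseteq> generate_field R (k \<union> (F \<union> G))"
    "generate_field R (k \<union> G) \<subseteq> generate_field R (k \<union> (F \<union> G))" if "F \<subseteq> S" "G \<subseteq> S" for F G
    using that assms by (intro mono_generate_field; blast)+
  show ?thesis
    using assms(3)
  proof (induction rule: generate_field.induct)
    case one
    then show ?case by (intro exI[of _ "{}"]) (auto intro: generate_field.one)
  next
    case (incl h)
    then show ?case
      by (intro exI[of _ "{h} \<inter> S"]) (auto intro: generate_field.incl)
  next
    case (a_inv h)
    then show ?case by (auto intro: generate_field.a_inv)
  next
    case (m_inv h)
    then show ?case by (auto intro: generate_field.m_inv)
  next
    case (eng_add h1 h2)
    then obtain F G where "finite F" "F \<subseteq> S" "h1 \<in> generate_field R (k \<union> F)"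
      "finite G" "G \<subseteq> S" "h2 \<in> generate_field R (k \<union> G)" by blast
    then show ?case using mono[of F G]
      by (intro exI[of _ "F \<union> G"]) (blast intro: generate_field.eng_add)
  next
    case (eng_mult h1 h2)
    then obtain F G where "finite F" "F \<subseteq> S" "h1 \<in> generate_field R (k \<union> F)"
      "finite G" "G \<subseteq> S" "h2 \<in> generate_field R (k \<union> G)" by blast
    then show ?case using mono[of F G]
      by (intro exI[of _ "F \<union> G"]) (blast intro: generate_field.eng_mult)
  qed
qed

lemma (in field) generate_field_finitary_set:
  assumes S: "S \<subseteq> carrier R" "k \<subseteq> carrier R" and Z: "finite Z" "Z \<subseteq> generate_field R (k \<union> S)"
  shows "\<exists>F. finite F \<and> F \<subseteq> S \<and> Z \<subseteq> generate_field R (k \<union> F)"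
  using Z
proof induction
  case empty
  then show ?case by blast
next
  case (insert x Z)
  then obtain F G where F: "finite F" "F \<subseteq> S" "Z \<subseteq> generate_field R (k \<union> F)"
    "finite G" "G \<subseteq> S" "x \<in> generate_field R (k \<union> G)"
    using generate_field_finitary[OF S, of x] by auto
  have "generate_field R (k \<union> F) \<subseteq> generate_field R (k \<union> (F \<union> G))"
    "generate_field R (k \<union> G) \<subseteq> generate_field R (k \<union> (F \<union> G))"
    using F S by (intro mono_generate_field; blast)+
  then show ?case using F by (intro exI[of _ "F \<union> G"]) blast
qed

text \<open>The polynomials witnessing that the finitely many field generators are algebraic have
  finitely many coefficients, and these involve only finitely many elements of \<open>S\<close>.
  Over the field generated by the latter, \<open>K\<close> is a finite extension.\<close>

lemma (in subfield_pair) ex_finite_over_purely_generated: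
  assumes fg: "fin_gen_field_ext K k" and S: "S \<subseteq> carrier K"
    and alg: "\<And>x. x \<in> carrier K \<Longrightarrow> (algebraic over generate_field K (k \<union> S)) x"
  obtains ss ws where "set ss \<subseteq> S" "distinct ss" "finite_over_purely_generated K k ss ws"
proof -
  have kc: "k \<subseteq> carrier K" by auto
  obtain Y where Y: "finite Y" "Y \<subseteq> carrier K" "generate_field K (k \<union> Y) = carrier K"
    using fg unfolding fin_gen_field_ext_def by blast
  have M: "subfield (generate_field K (k \<union> S)) K"
    using kc S by (intro generate_field_is_subfield) auto
  have "\<forall>y\<in>Y. \<exists>p. p \<in> carrier (univ_poly K (generate_field K (k \<union> S))) \<and> p \<noteq> [] \<and> eval p y = \<zero>"
  proof
    fix y assume "y \<in> Y"
    then have y: "y \<in> carrier K" using Y(2) by blast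
    obtain p where "p \<in> carrier (univ_poly K (generate_field K (k \<union> S)))" "p \<noteq> []" "eval p y = \<zero>"
      by (rule algebraicE[OF subfieldE(1)[OF M] y alg[OF y]])
    then show "\<exists>p. p \<in> carrier (univ_poly K (generate_field K (k \<union> S))) \<and> p \<noteq> [] \<and> eval p y = \<zero>"
      by blast
  qed
  from bchoice[OF this] obtain p
    where p: "\<And>y. y \<in> Y \<Longrightarrow> p y \<in> carrier (univ_poly K (generate_field K (k \<union> S)))"
    "\<And>y. y \<in> Y \<Longrightarrow> p y \<noteq> []" "\<And>y. y \<in> Y \<Longrightarrow> eval (p y) y = \<zero>" by blast
  have "(\<Union>y\<in>Y. set (p y)) \<subseteq> generate_field K (k \<union> S)"
    using p(1) unfolding univ_poly_carrier[symmetric] polynomial_def by fastforce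
  then obtain F where F: "finite F" "F \<subseteq> S" "(\<Union>y\<in>Y. set (p y)) \<subseteq> generate_field K (k \<union> F)"
    using generate_field_finitary_set[OF S kc, of "\<Union>y\<in>Y. set (p y)"] Y(1) by auto
  define L where "L = generate_field K (k \<union> F)"
  have L: "subfield L K" unfolding L_def using kc S F by (intro generate_field_is_subfield) auto
  have algL: "(algebraic over L) y" if y: "y \<in> Y" for y
  proof (rule algebraicI[of "p y"])
    show "p y \<in> carrier (univ_poly K L)"
      using p(1,2)[OF y] F(3) y unfolding univ_poly_carrier[symmetric] polynomial_def L_def by auto
  qed (use p y in auto)
  obtain ys where ys: "set ys = Y" using Y(1) finite_list by blast
  obtain ss where ss: "set ss = F" "distinct ss" using F(1) finite_distinct_list by blast
  have ysc: "set ys \<subseteq> carrier K" using ys Y by simp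
  have "subfield (finite_extension L ys) K" "finite_dimension L (finite_extension L ys)"
    using finite_extension_is_subfield[OF L ysc] finite_extension_finite_dimension(1)[OF L ysc] algL ys
    by auto
  moreover have "k \<union> Y \<subseteq> finite_extension L ys"
  proof -
    have "k \<subseteq> L" unfolding L_def by (auto intro: generate_field.incl)
    moreover have "L \<subseteq> finite_extension L ys" using finite_extension_incl[OF subfieldE(3)[OF L] ysc] .
    moreover have "Y \<subseteq> finite_extension L ys"
      using finite_extension_mem[OF subfieldE(1)[OF L] ysc] ys by simp
    ultimately show ?thesis by blast
  qed
  ultimately have eq: "finite_extension L ys = carrier K"
    and fin: "finite_dimension L (finite_extension L ys)"
    using generate_field_min_subfield1[of "k \<union> Y" "finite_extension L ys"] Y kc subfieldE(3) by blast+
  then obtain ws where "set ws \<subseteq> carrier K" "Span L ws = carrier K"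
    using exists_base[OF L] unfolding finite_dimension_def by metis
  then have "finite_over_purely_generated K k ss ws"
    using ss F S unfolding L_def by unfold_locales auto
  then show ?thesis using that ss F by blast
qed

section \<open>Rational rank and integral independence\<close>

lemma pure_tensor_add_right: "pure_tensor q (g + h) = pure_tensor q g + pure_tensor q h"
  by transfer (use biadd_rel.right in \<open>simp add: tensor_eq_def diff_diff_eq\<close>)

lemma pure_tensor_int_scale:
  "pure_tensor 1 (n *\<^sub>z g) = rat_tensor_scale (of_int n) (pure_tensor 1 g)"
proof (induction n rule: int_induct[where k = 0])
  case base
  have "pure_tensor 1 0 = (0 :: 'a rat_tensor)"
    using pure_tensor_add_right[of 1 0 "0 :: 'a"] by simp
  then show ?case by simp
next
  case (step1 i)
  then show ?case
    by (simp add: zmod.scale_left_distrib pure_tensor_add_right rat_tensor.scale_left_distrib)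
next
  case (step2 i)
  have "pure_tensor 1 (i *\<^sub>z g) = pure_tensor 1 ((i - 1) *\<^sub>z g) + pure_tensor 1 g"
    using pure_tensor_add_right[of 1 "(i - 1) *\<^sub>z g" g] by (simp add: zmod.scale_left_diff_distrib)
  then show ?case using step2
    by (simp add: rat_tensor.scale_left_diff_distrib algebra_simps)
qed

lemma span_pure_tensors: "rat_tensor.span (range (pure_tensor 1)) = UNIV"
proof -
  have "abs_rat_tensor x \<in> rat_tensor.span (range (pure_tensor 1))" for x :: "(rat \<times> 'g::ab_group_add) \<Rightarrow>\<^sub>0 int"
  proof (induction rule: frag_induction[OF subset_UNIV[of "Poly_Mapping.keys x"]])
    case 1
    then show ?case using rat_tensor.span_zero by (simp add: zero_rat_tensor.abs_eq)
  next
    case (2 c)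
    obtain q g where c: "c = (q, g)" by (cases c)
    have "abs_rat_tensor (frag_of c) = rat_tensor_scale q (pure_tensor 1 g)"
      unfolding c rat_tensor_scale_pure by (simp add: pure_tensor.abs_eq)
    then show ?case using rat_tensor.span_scale rat_tensor.span_base by (metis rangeI)
  next
    case (3 a b)
    then show ?case using rat_tensor.span_diff by (metis minus_rat_tensor.abs_eq)
  qed
  then have "x \<in> rat_tensor.span (range (pure_tensor 1))" for x :: "'g::ab_group_add rat_tensor"
    by (induction x rule: rat_tensor.abs_induct)
  then show ?thesis by blast
qed

text \<open>If a nonzero multiple \<open>n g\<close> lies in the integral span of the others,
  division by \<open>n\<close> puts \<open>pure_tensor 1 g\<close> into the rational span of their
  tensors.\<close>

lemma independent_pure_tensors_imp_int_independent:
  assumes "distinct (map (pure_tensor 1) gs)" "rat_tensor.independent (pure_tensor 1 ` set gs)"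
  shows "int_independent gs"
  using assms
proof (induction gs)
  case (Cons g gs)
  have "n = 0" if n: "n *\<^sub>z g \<in> zmod.span (set gs)" for n
  proof (rule ccontr)
    assume n0: "n \<noteq> 0"
    have "pure_tensor 1 h \<in> rat_tensor.span (pure_tensor 1 ` set gs)" if "h \<in> zmod.span (set gs)" for h
      using that
    proof (induction rule: zmod.span_induct_alt)
      case base
      have "pure_tensor 1 0 = (0 :: 'a rat_tensor)"
        using pure_tensor_add_right[of 1 0 "0 :: 'a"] by simp
      then show ?case using rat_tensor.span_zero by simp
    next
      case (step c x y)
      then show ?case unfolding pure_tensor_add_right pure_tensor_int_scale
        by (intro rat_tensor.span_add rat_tensor.span_scale[OF rat_tensor.span_base]) auto
    qed
    then have "rat_tensor_scale (of_int n) (pure_tensor 1 g) \<in> rat_tensor.span (pure_tensor 1 ` set gs)"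
      using n pure_tensor_int_scale by metis
    then have "rat_tensor_scale (1 / of_int n) (rat_tensor_scale (of_int n) (pure_tensor 1 g))
        \<in> rat_tensor.span (pure_tensor 1 ` set gs)"
      by (rule rat_tensor.span_scale)
    then have "pure_tensor 1 g \<in> rat_tensor.span (pure_tensor 1 ` set gs)"
      using n0 by simp
    moreover have "pure_tensor 1 g \<notin> pure_tensor 1 ` set gs" using Cons.prems(1) by simp
    ultimately show False using Cons.prems(2) by (simp add: rat_tensor.independent_insert)
  qed
  moreover have "int_independent gs"
    using Cons.IH Cons.prems by (auto simp: rat_tensor.independent_insert intro: rat_tensor.independent_mono)
  ultimately show ?case by simp
qed simp

text \<open>Elements of \<open>B\<close> need not have the form \<open>pure_tensor 1 g\<close>, so
  another basis \<open>B'\<close> is extracted from the spanning set of such tensors. The length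
  bound makes \<open>B'\<close> finite, and then both bases have the same cardinality.\<close>

lemma ex_int_independent:
  assumes B: "rat_tensor_basis (B :: 'g::ab_group_add rat_tensor set)"
    and bound: "\<And>gs :: 'g list. int_independent gs \<Longrightarrow> length gs \<le> d"
  shows "\<exists>gs :: 'g list. int_independent gs \<and> finite B \<and> length gs = card B"
proof -
  obtain B' :: "'g rat_tensor set" where B': "B' \<subseteq> range (pure_tensor 1)" "rat_tensor.independent B'"
    "range (pure_tensor 1) \<subseteq> rat_tensor.span B'"
    by (rule rat_tensor.maximal_independent_subset)
  have span: "rat_tensor.span B' = UNIV"
    using rat_tensor.span_mono[OF B'(3)] unfolding span_pure_tensors rat_tensor.span_span by blast
  have ex: "\<exists>gs :: 'g list. int_independent gs \<and> length gs = card D" if D: "finite D" "D \<subseteq> B'" for D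
  proof -
    obtain ds where ds: "set ds = D" "distinct ds" using D(1) finite_distinct_list by blast
    define gs :: "'g list" where "gs = map (inv_into (UNIV :: 'g set) (pure_tensor 1)) ds"
    have inv: "pure_tensor 1 (inv_into (UNIV :: 'g set) (pure_tensor 1) x) = x" if "x \<in> set ds" for x
      using that ds(1) D(2) B'(1) by (intro f_inv_into_f) blast
    have map: "map (pure_tensor 1) gs = ds"
      unfolding gs_def map_map by (rule map_idI) (simp add: inv)
    have "rat_tensor.independent D" using rat_tensor.independent_mono[OF B'(2) D(2)] .
    moreover have "pure_tensor 1 ` set gs = D" using arg_cong[OF map, of set] ds(1) by simp
    ultimately have "int_independent gs"
      using independent_pure_tensors_imp_int_independent[of gs] ds(2) map by simp
    moreover have "length gs = card D" unfolding gs_def using ds distinct_card by fastforce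
    ultimately show ?thesis by blast
  qed
  have fin: "finite B'"
  proof (rule ccontr)
    assume "infinite B'"
    then obtain D where D: "finite D" "D \<subseteq> B'" "card D = Suc d"
      using infinite_arbitrarily_large[of B' "Suc d"] by blast
    obtain gs :: "'g list" where gs: "int_independent gs" "length gs = Suc d" using ex[OF D(1,2)] D(3) by auto
    then show False using bound[OF gs(1)] by simp
  qed
  have "rat_tensor.independent B" "rat_tensor.span B = UNIV" using B unfolding rat_tensor_basis_def by auto
  then have "finite B" "card B = card B'"
    using rat_tensor.independent_span_bound[OF fin, of B] rat_tensor.independent_span_bound[of B B']
      B'(2) span by auto
  then show ?thesis using ex[OF fin] by auto
qed

text \<open>Abhyankar's inequality bounds the length of \<open>gs\<close> by that of
  \<open>ss\<close>; conversely \<open>ss\<close> is drawn from \<open>S\<close>, which has as many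
  elements as the rational basis, that is, as \<open>gs\<close>. The lengths agree, and the equality
  case applies.\<close>

theorem maximal_rational_rank:
  fixes K :: "('a, 'b) ring_scheme" (structure) and \<nu> :: "'a \<Rightarrow> 'g::linordered_ab_group_add"
  assumes K: "field K" "subfield k K" and ac: "algebraically_closed (K\<lparr>carrier := k\<rparr>)"
    and fg: "fin_gen_field_ext K k" and val: "valuation_over K k \<nu>"
    and rank: "\<exists>(B :: 'g rat_tensor set) S. rat_tensor_basis B \<and> transcendence_basis K k S \<and> B \<approx> S"
  shows "\<exists>E :: 'g set. finite E \<and> zmod.span E = UNIV"
    and "\<And>r s. r \<in> carrier K - {\<zero>} \<Longrightarrow> s \<in> carrier K - {\<zero>} \<Longrightarrow> \<nu> r = \<nu> s \<Longrightarrow>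
      \<exists>t\<in>k - {\<zero>}. r \<ominus> t \<otimes> s = \<zero> \<or> \<nu> r < \<nu> (r \<ominus> t \<otimes> s)"
proof -
  interpret valued_pair K k \<nu>
    using K val by (simp add: valued_pair_def subfield_pair_def subfield_pair_axioms_def valued_pair_axioms_def)
  obtain B :: "'g rat_tensor set" and S where B: "rat_tensor_basis B"
    and S: "transcendence_basis K k S" and BS: "B \<approx> S" using rank by blast
  have Sc: "S \<subseteq> carrier K" and alg: "\<And>x. x \<in> carrier K \<Longrightarrow> (algebraic over generate_field K (k \<union> S)) x"
    using S unfolding transcendence_basis_def alg_independent_def by auto
  obtain ss ws where ss: "set ss \<subseteq> S" "distinct ss" and fin: "finite_over_purely_generated K k ss ws"
    using ex_finite_over_purely_generated[OF fg Sc alg] by blast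
  have ex: "\<exists>xs. abhyankar K k ss ws \<nu> xs \<and> map \<nu> xs = gs" if gs: "int_independent gs" for gs
  proof -
    define pick where "pick g = (SOME x. x \<in> carrier K \<and> x \<noteq> \<zero> \<and> \<nu> x = g)" for g
    have pick: "pick g \<in> carrier K \<and> pick g \<noteq> \<zero> \<and> \<nu> (pick g) = g" for g
      unfolding pick_def by (rule someI_ex) (metis val_surj)
    have map: "map \<nu> (map pick gs) = gs" using pick by (simp add: map_idI)
    have "abhyankar K k ss ws \<nu> (map pick gs)"
      using fin valued_pair_axioms gs pick
      by (auto simp: abhyankar_def abhyankar_axioms_def map simp del: map_map)
    then show ?thesis using map by blast
  qed
  have "length gs \<le> length ss" if "int_independent gs" for gs :: "'g list"
    using ex[OF that] abhyankar.rational_rank_le by (metis length_map)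
  then obtain gs :: "'g list" where gs: "int_independent gs" "finite B" "length gs = card B" "length gs \<le> length ss"
    using ex_int_independent[OF B, of "length ss"] by blast
  have "finite S" "card S = card B" using BS gs(2) eqpoll_finite_iff eqpoll_iff_card by metis+
  then have "length ss \<le> length gs" using ss distinct_card[OF ss(2)] card_mono gs(3) by metis
  then obtain xs where abh: "abhyankar K k ss ws \<nu> xs" "length xs = length ss"
    using ex[OF gs(1)] gs(4) by (metis le_antisym length_map)
  interpret abhyankar K k ss ws \<nu> xs by (rule abh(1))
  show "\<exists>E :: 'g set. finite E \<and> zmod.span E = UNIV" using value_group_finitely_generated[OF abh(2)] .
  fix r s assume r: "r \<in> carrier K - {\<zero>}" and s: "s \<in> carrier K - {\<zero>}" and rs: "\<nu> r = \<nu> s"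
  have si: "inv s \<in> carrier K" "inv s \<otimes> s = \<one>" "inv s \<noteq> \<zero>"
    using s field_Units by auto
  \<comment> \<open>The quotient has value 0, hence a residue in \<open>k\<close>. Multiplying
    \<open>y \<oplus> b\<close> back by \<open>s\<close> yields the claim with the scalar
    \<open>\<ominus> b\<close>.\<close>
  define y where "y = r \<otimes> inv s"
  have y: "y \<in> carrier K" "y \<noteq> \<zero>" "\<nu> y = 0"
    unfolding y_def using r s si val_mult[of r "inv s"] val_inv[of s] rs by (auto simp: integral_iff)
  have ys: "y \<otimes> s = r" unfolding y_def using r s si by (simp add: m_assoc)
  obtain p where p: "p \<in> carrier (univ_poly K k)" "p \<noteq> []" "eval p y = \<zero> \<or> 0 < \<nu> (eval p y)"
    using residue_polynomial[OF abh(2) y] by blast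
  obtain b where b: "b \<in> k" "y \<oplus> b = \<zero> \<or> 0 < \<nu> (y \<oplus> b)"
    using residue_algebraic_imp_base[OF ac y(1) p] by blast
  have b0: "b \<noteq> \<zero>" using b y by auto
  have t: "\<ominus> b \<in> k - {\<zero>}" using subringE(5)[OF subfieldE(1)[OF base] b(1)] b b0 add.inv_eq_1_iff by simp
  have "r \<ominus> (\<ominus> b) \<otimes> s = (y \<oplus> b) \<otimes> s"
    unfolding ys[symmetric] minus_eq using y b s by (simp add: l_distr l_minus)
  moreover have "\<nu> r < \<nu> ((y \<oplus> b) \<otimes> s)" if "y \<oplus> b \<noteq> \<zero>"
    using val_mult[of "y \<oplus> b" s] that b y s rs by auto
  ultimately have "r \<ominus> (\<ominus> b) \<otimes> s = \<zero> \<or> \<nu> r < \<nu> (r \<ominus> (\<ominus> b) \<otimes> s)"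
    using s by (cases "y \<oplus> b = \<zero>") simp_all
  then show "\<exists>t\<in>k - {\<zero>}. r \<ominus> t \<otimes> s = \<zero> \<or> \<nu> r < \<nu> (r \<ominus> t \<otimes> s)"
    using t by blast
qed

section \<open>The associated graded ring\<close>

locale valued_domain = domain A for A (structure) +
  fixes \<nu> :: "'a \<Rightarrow> 'g::linordered_ab_group_add"
  assumes val_mult: "\<lbrakk>x \<in> carrier A; x \<noteq> \<zero>; y \<in> carrier A; y \<noteq> \<zero>\<rbrakk> \<Longrightarrow> \<nu> (x \<otimes> y) = \<nu> x + \<nu> y"
    and val_add: "\<lbrakk>x \<in> carrier A; x \<noteq> \<zero>; y \<in> carrier A; y \<noteq> \<zero>; x \<oplus> y \<noteq> \<zero>\<rbrakk> \<Longrightarrow>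
      min (\<nu> x) (\<nu> y) \<le> \<nu> (x \<oplus> y)"
begin

abbreviation "\<Phi> \<equiv> value_monoid A \<nu>"
abbreviation "Ige \<equiv> ideal_ge A \<nu>"
abbreviation "Igt \<equiv> ideal_gt A \<nu>"

lemma val_one: "\<nu> \<one> = 0"
  using val_mult[of \<one> \<one>] by simp

lemma val_uminus:
  assumes "x \<in> carrier A" "x \<noteq> \<zero>"
  shows "\<nu> (\<ominus> x) = \<nu> x"
proof -
  have m1: "\<ominus> \<one> \<noteq> \<zero>" using add.inv_eq_1_iff by simp
  have "\<ominus> \<one> \<otimes> \<ominus> \<one> = \<one>" by algebra
  then have "\<nu> (\<ominus> \<one>) + \<nu> (\<ominus> \<one>) = 0" using val_mult[of "\<ominus> \<one>" "\<ominus> \<one>"] m1 val_one by simp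
  then have "\<nu> (\<ominus> \<one>) = 0" by simp
  moreover have "\<ominus> x = (\<ominus> \<one>) \<otimes> x" using assms by (simp add: l_minus)
  ultimately show ?thesis using val_mult[of "\<ominus> \<one>" x] assms m1 by simp
qed

lemma val_pow:
  assumes "x \<in> carrier A" "x \<noteq> \<zero>"
  shows "x [^] (n::nat) \<noteq> \<zero>" "\<nu> (x [^] n) = int n *\<^sub>z \<nu> x"
proof -
  show nz: "x [^] (n::nat) \<noteq> \<zero>" for n using assms by (induction n) (auto simp: integral_iff)
  show "\<nu> (x [^] n) = int n *\<^sub>z \<nu> x"
  proof (induction n)
    case (Suc n)
    then show ?case using val_mult[of "x [^] n" x] nz[of n] assms
      by (simp add: zmod.scale_left_distrib add.commute)
  qed (simp add: val_one)
qed

lemma ideal_ge_iff: "r \<in> Ige m \<longleftrightarrow> r \<in> carrier A \<and> (r = \<zero> \<or> m \<le> \<nu> r)"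
  by (simp add: ideal_ge_def)

lemma ideal_gt_iff: "r \<in> Igt m \<longleftrightarrow> r \<in> carrier A \<and> (r = \<zero> \<or> m < \<nu> r)"
  by (simp add: ideal_gt_def)

lemma ideal_add:
  assumes "x \<in> carrier A" "y \<in> carrier A"
  shows "(x = \<zero> \<or> m \<le> \<nu> x) \<Longrightarrow> (y = \<zero> \<or> m \<le> \<nu> y) \<Longrightarrow> x \<oplus> y = \<zero> \<or> m \<le> \<nu> (x \<oplus> y)"
    and "(x = \<zero> \<or> m < \<nu> x) \<Longrightarrow> (y = \<zero> \<or> m < \<nu> y) \<Longrightarrow> x \<oplus> y = \<zero> \<or> m < \<nu> (x \<oplus> y)"
proof -
  show "x \<oplus> y = \<zero> \<or> m \<le> \<nu> (x \<oplus> y)" if "x = \<zero> \<or> m \<le> \<nu> x" "y = \<zero> \<or> m \<le> \<nu> y"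
  proof (cases "x = \<zero> \<or> y = \<zero>")
    case True
    then show ?thesis using that assms by auto
  next
    case False
    then show ?thesis using that assms val_add[of x y]
      by (cases "x \<oplus> y = \<zero>") (auto simp: min_le_iff_disj intro: order_trans)
  qed
  show "x \<oplus> y = \<zero> \<or> m < \<nu> (x \<oplus> y)" if "x = \<zero> \<or> m < \<nu> x" "y = \<zero> \<or> m < \<nu> y"
  proof (cases "x = \<zero> \<or> y = \<zero>")
    case True
    then show ?thesis using that assms by auto
  next
    case False
    then show ?thesis using that assms val_add[of x y]
      by (cases "x \<oplus> y = \<zero>") (auto simp: min_le_iff_disj intro: less_le_trans)
  qed
qed

lemma subgroup_ideal_ge: "subgroup (Ige m) (add_monoid A)"
proof (rule add.subgroupI)
  show "Ige m \<subseteq> carrier A" "Ige m \<noteq> {}" by (auto simp: ideal_ge_def)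
  show "\<ominus> x \<in> Ige m" if "x \<in> Ige m" for x
    using that val_uminus[of x] by (cases "x = \<zero>") (auto simp: ideal_ge_iff)
  show "x \<oplus> y \<in> Ige m" if "x \<in> Ige m" "y \<in> Ige m" for x y
    using that ideal_add(1)[of x y m] by (auto simp: ideal_ge_iff)
qed

lemma subgroup_ideal_gt: "subgroup (Igt m) (add_monoid A)"
proof (rule add.subgroupI)
  show "Igt m \<subseteq> carrier A" "Igt m \<noteq> {}" by (auto simp: ideal_gt_def)
  show "\<ominus> x \<in> Igt m" if "x \<in> Igt m" for x
    using that val_uminus[of x] by (cases "x = \<zero>") (auto simp: ideal_gt_iff)
  show "x \<oplus> y \<in> Igt m" if "x \<in> Igt m" "y \<in> Igt m" for x y
    using that ideal_add(2)[of x y m] by (auto simp: ideal_gt_iff)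
qed

lemma ideal_gt_subset: "Igt m \<subseteq> Ige m"
  by (auto simp: ideal_ge_iff ideal_gt_iff)

lemma abelian_subgroup_gt: "abelian_subgroup (Igt m) A"
  by (rule abelian_subgroupI3) (auto intro: additive_subgroup.intro subgroup_ideal_gt abelian_group_axioms)

definition coset :: "'g \<Rightarrow> 'a \<Rightarrow> 'a set" where
  "coset m r = Igt m +>\<^bsub>A\<^esub> r"

lemma coset_iff:
  "r \<in> carrier A \<Longrightarrow> x \<in> coset m r \<longleftrightarrow> x \<in> carrier A \<and> x \<ominus> r \<in> Igt m"
  unfolding coset_def
proof
  assume r: "r \<in> carrier A" and "x \<in> Igt m +> r"
  then obtain h where h: "h \<in> Igt m" "x = h \<oplus> r" unfolding a_r_coset_def' by blast
  then have "h \<in> carrier A" by (simp add: ideal_gt_iff)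
  moreover from this have "x \<ominus> r = h" using h r by (simp add: minus_eq a_assoc r_neg)
  ultimately show "x \<in> carrier A \<and> x \<ominus> r \<in> Igt m" using h r by simp
next
  assume r: "r \<in> carrier A" and x: "x \<in> carrier A \<and> x \<ominus> r \<in> Igt m"
  then have "x = (x \<ominus> r) \<oplus> r" by (simp add: minus_eq a_assoc l_neg)
  then show "x \<in> Igt m +> r" unfolding a_r_coset_def' using x by blast
qed

lemma coset_eq_iff:
  assumes "r \<in> carrier A" "s \<in> carrier A"
  shows "coset m r = coset m s \<longleftrightarrow> r \<ominus> s \<in> Igt m"
proof
  assume "coset m r = coset m s"
  moreover have "r \<in> coset m r" using assms by (simp add: coset_iff minus_eq r_neg ideal_gt_iff)
  ultimately show "r \<ominus> s \<in> Igt m" using coset_iff assms by blast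
next
  assume rs: "r \<ominus> s \<in> Igt m"
  have sr: "s \<ominus> r \<in> Igt m"
  proof -
    have "s \<ominus> r = \<ominus> (r \<ominus> s)" using assms by algebra
    then show ?thesis using subgroup.m_inv_closed[OF subgroup_ideal_gt rs] by (simp add: a_inv_def)
  qed
  have eqv: "x \<ominus> s \<in> Igt m \<longleftrightarrow> x \<ominus> r \<in> Igt m" if x: "x \<in> carrier A" for x
  proof -
    have e: "x \<ominus> s = (x \<ominus> r) \<oplus> (r \<ominus> s)" "x \<ominus> r = (x \<ominus> s) \<oplus> (s \<ominus> r)"
      using x assms by algebra+
    have add: "a \<oplus> b \<in> Igt m" if "a \<in> Igt m" "b \<in> Igt m" for a b
      using subgroup.m_closed[OF subgroup_ideal_gt that] by simp
    show ?thesis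
    proof
      assume "x \<ominus> s \<in> Igt m"
      then show "x \<ominus> r \<in> Igt m" by (subst e(2)) (rule add[OF _ sr])
    next
      assume "x \<ominus> r \<in> Igt m"
      then show "x \<ominus> s \<in> Igt m" by (subst e(1)) (rule add[OF _ rs])
    qed
  qed
  show "coset m r = coset m s"
  proof (rule Set.set_eqI)
    show "x \<in> coset m r \<longleftrightarrow> x \<in> coset m s" for x
      using eqv[of x] coset_iff[OF assms(1), of x m] coset_iff[OF assms(2), of x m] by blast
  qed
qed

lemma coset_zero: "coset m \<zero> = Igt m"
  using coset_iff[of \<zero>] by (auto simp: minus_eq ideal_gt_iff)

lemma coset_eq_ideal_iff: "r \<in> carrier A \<Longrightarrow> coset m r = Igt m \<longleftrightarrow> r \<in> Igt m"
  using coset_eq_iff[of r \<zero> m] by (simp add: coset_zero minus_eq)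

lemma add_monoid_restrict: "add_monoid (A\<lparr>carrier := E\<rparr>) = (add_monoid A)\<lparr>carrier := E\<rparr>"
  by simp

lemma comm_group_ge: "comm_group (add_monoid (A\<lparr>carrier := Ige m\<rparr>))"
proof -
  have g: "Group.group (add_monoid (A\<lparr>carrier := Ige m\<rparr>))"
    unfolding add_monoid_restrict
    using add.subgroup_imp_group[OF subgroup_ideal_ge] .
  show ?thesis
    by (rule group.group_comm_groupI[OF g]) (auto simp: ideal_ge_iff a_comm)
qed

lemma gr_piece_comm_group: "comm_group (gr_piece A \<nu> m)"
proof -
  have "subgroup (Igt m) (add_monoid (A\<lparr>carrier := Ige m\<rparr>))"
    unfolding add_monoid_restrict
    using add.subgroup_incl[OF subgroup_ideal_gt subgroup_ideal_ge ideal_gt_subset] .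
  then show ?thesis unfolding gr_piece_def by (rule comm_group.abelian_FactGroup[OF comm_group_ge])
qed

lemma gr_piece_group: "Group.group (gr_piece A \<nu> m)"
  using gr_piece_comm_group comm_group.axioms(2) by blast

lemma gr_piece_carrier: "carrier (gr_piece A \<nu> m) = coset m ` Ige m"
  unfolding gr_piece_def carrier_FactGroup coset_def a_r_coset_def r_coset_def by simp

lemma gr_piece_one: "one (gr_piece A \<nu> m) = Igt m"
  unfolding gr_piece_def by simp

lemma gr_piece_mult:
  assumes "r \<in> carrier A" "s \<in> carrier A"
  shows "monoid.mult (gr_piece A \<nu> m) (coset m r) (coset m s) = coset m (r \<oplus> s)"
proof -
  have "monoid.mult (gr_piece A \<nu> m) (coset m r) (coset m s) = coset m r <+> coset m s"
    unfolding gr_piece_def by (simp add: set_mult_def set_add_def)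
  also have "\<dots> = coset m (r \<oplus> s)"
    unfolding coset_def using abelian_subgroup.a_rcos_sum[OF abelian_subgroup_gt] assms by simp
  finally show ?thesis .
qed

text \<open>\<open>rcoset_mult\<close> is a union over all representatives, and in
  \<open>x y - r s = x (y - s) + (x - r) s\<close> both terms lie in the ideal of values above
  \<open>i + j\<close>; hence all cosets in the union coincide.\<close>

lemma rcoset_mult_coset:
  assumes r: "r \<in> Ige i" and s: "s \<in> Ige j"
  shows "rcoset_mult A (Igt (i + j)) (coset i r) (coset j s) = coset (i + j) (r \<otimes> s)"
proof -
  have rc: "r \<in> carrier A" "s \<in> carrier A" using r s by (auto simp: ideal_ge_iff)
  have prod: "x \<otimes> y \<in> Igt (i + j)" if "x \<in> Ige i" "y \<in> Igt j \<or> x \<in> Igt i \<and> y \<in> Ige j" "y \<in> carrier A" for x y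
  proof (cases "x = \<zero> \<or> y = \<zero>")
    case True
    then show ?thesis using that by (auto simp: ideal_gt_iff ideal_ge_iff)
  next
    case False
    then have "i \<le> \<nu> x \<and> j < \<nu> y \<or> i < \<nu> x \<and> j \<le> \<nu> y" "x \<in> carrier A"
      using that by (auto simp: ideal_gt_iff ideal_ge_iff)
    then show ?thesis using False that(3) val_mult[of x y]
      by (auto simp: ideal_gt_iff intro: add_le_less_mono add_less_le_mono)
  qed
  have "coset (i + j) (x \<otimes> y) = coset (i + j) (r \<otimes> s)" if x: "x \<in> coset i r" and y: "y \<in> coset j s" for x y
  proof -
    have c: "x \<in> carrier A" "y \<in> carrier A" "x \<ominus> r \<in> Igt i" "y \<ominus> s \<in> Igt j"
      using x y coset_iff rc by auto
    have "x = (x \<ominus> r) \<oplus> r" using c rc by algebra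
    then have "x \<in> Ige i" using c(3) r ideal_gt_subset subgroup.m_closed[OF subgroup_ideal_ge, of "x \<ominus> r" i r] by auto
    then have "x \<otimes> (y \<ominus> s) \<in> Igt (i + j)" using prod[of x "y \<ominus> s"] c rc by blast
    moreover have "(x \<ominus> r) \<otimes> s \<in> Igt (i + j)"
      using prod[of "x \<ominus> r" s] c(3) s rc ideal_gt_subset by blast
    ultimately have "x \<otimes> (y \<ominus> s) \<oplus> (x \<ominus> r) \<otimes> s \<in> Igt (i + j)"
      using subgroup.m_closed[OF subgroup_ideal_gt] by fastforce
    moreover have "x \<otimes> (y \<ominus> s) \<oplus> (x \<ominus> r) \<otimes> s = x \<otimes> y \<ominus> r \<otimes> s"
      using c rc by algebra
    ultimately show ?thesis using coset_eq_iff c rc by simp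
  qed
  moreover have "r \<in> coset i r" "s \<in> coset j s"
    using rc by (simp_all add: coset_iff minus_eq r_neg ideal_gt_iff)
  ultimately show ?thesis
    unfolding rcoset_mult_def coset_def[symmetric] by blast
qed

section \<open>Initial forms in the graded ring\<close>

lemma value_mem: "r \<in> carrier A \<Longrightarrow> r \<noteq> \<zero> \<Longrightarrow> \<nu> r \<in> \<Phi>"
  unfolding value_monoid_def by blast

lemma value_cases:
  assumes "m \<in> \<Phi>"
  obtains r where "r \<in> carrier A" "r \<noteq> \<zero>" "\<nu> r = m"
  using assms unfolding value_monoid_def by blast

lemma gr_carrier:
  "f \<in> carrier (gr A \<nu>) \<longleftrightarrow>
    f \<in> (\<Pi>\<^sub>E m\<in>\<Phi>. coset m ` Ige m) \<and> finite {m \<in> \<Phi>. f m \<noteq> Igt m}"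
  unfolding gr_def using carrier_sum_group[of \<Phi> "gr_piece A \<nu>"] gr_piece_group
  by (simp add: gr_piece_carrier gr_piece_one)

lemma gr_zero: "\<zero>\<^bsub>gr A \<nu>\<^esub> = (\<lambda>m\<in>\<Phi>. Igt m)"
  unfolding gr_def by (simp add: gr_piece_one)

lemma gr_add: "f \<oplus>\<^bsub>gr A \<nu>\<^esub> g = (\<lambda>m\<in>\<Phi>. monoid.mult (gr_piece A \<nu> m) (f m) (g m))"
  unfolding gr_def by simp

lemma gr_mult: "f \<otimes>\<^bsub>gr A \<nu>\<^esub> g = (\<lambda>m\<in>\<Phi>.
    finprod (gr_piece A \<nu> m) (\<lambda>(i, j). rcoset_mult A (Igt m) (f i) (g j))
      {(i, j). i \<in> \<Phi> \<and> j \<in> \<Phi> \<and> i + j = m \<and> f i \<noteq> Igt i \<and> g j \<noteq> Igt j})"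
  unfolding gr_def by simp

lemma gr_mult_component:
  "m \<in> \<Phi> \<Longrightarrow> (f \<otimes>\<^bsub>gr A \<nu>\<^esub> g) m =
    finprod (gr_piece A \<nu> m) (\<lambda>(i, j). rcoset_mult A (Igt m) (f i) (g j))
      {(i, j). i \<in> \<Phi> \<and> j \<in> \<Phi> \<and> i + j = m \<and> f i \<noteq> Igt i \<and> g j \<noteq> Igt j}"
  unfolding gr_mult by (rule restrict_apply')

text \<open>The zero of the piece of degree \<open>m\<close> is \<open>Igt m\<close> itself. Hence
  \<open>initial \<zero>\<close> is the zero element, whatever value is assigned to
  \<open>\<zero>\<close>.\<close>

definition initial :: "'a \<Rightarrow> 'g \<Rightarrow> 'a set" where
  "initial r = (\<lambda>m\<in>\<Phi>. if m = \<nu> r then coset m r else Igt m)"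

lemma gr_const_eq_initial: "\<nu> c = 0 \<Longrightarrow> gr_const A \<nu> c = initial c"
  unfolding gr_const_def initial_def coset_def by (rule restrict_ext) simp

lemma gr_one: "\<one>\<^bsub>gr A \<nu>\<^esub> = initial \<one>"
  using gr_const_eq_initial[OF val_one] unfolding gr_def by simp

lemma initial_closed: "r \<in> carrier A \<Longrightarrow> initial r \<in> carrier (gr A \<nu>)"
proof -
  assume r: "r \<in> carrier A"
  have "r \<in> Ige (\<nu> r)" using r by (simp add: ideal_ge_iff)
  moreover have "Igt m \<in> coset m ` Ige m" for m
    using coset_zero[of m] by (metis ideal_ge_iff image_eqI zero_closed)
  moreover have "{m \<in> \<Phi>. initial r m \<noteq> Igt m} \<subseteq> {\<nu> r}" unfolding initial_def by auto
  then have "finite {m \<in> \<Phi>. initial r m \<noteq> Igt m}" by (rule finite_subset) simp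
  ultimately show ?thesis unfolding gr_carrier initial_def by auto
qed

lemma initial_support:
  assumes "r \<in> carrier A" "r \<noteq> \<zero>" "m \<in> \<Phi>"
  shows "initial r m = Igt m \<longleftrightarrow> m \<noteq> \<nu> r"
  using assms coset_eq_ideal_iff[of r "\<nu> r"] unfolding initial_def by (auto simp: ideal_gt_iff)

lemma initial_eqI:
  assumes "r \<in> carrier A" "s \<in> carrier A" "\<nu> r = \<nu> s" "r \<ominus> s = \<zero> \<or> \<nu> r < \<nu> (r \<ominus> s)"
  shows "initial r = initial s"
proof -
  have "coset (\<nu> s) r = coset (\<nu> s) s"
    using assms coset_eq_iff[of r s "\<nu> s"] by (auto simp: ideal_gt_iff)
  then show ?thesis unfolding initial_def assms(3) by (intro restrict_ext) auto
qed

text \<open>If \<open>m - \<nu> r\<close> is not a value, the component of degree \<open>m\<close>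
  is an empty product, the zero of the piece. In this way the absence of a degree from \<Phi>
  becomes visible in the ring.\<close>

lemma initial_mult_support:
  assumes r: "r \<in> carrier A" "r \<noteq> \<zero>" and m: "m \<in> \<Phi>" and ne: "(initial r \<otimes>\<^bsub>gr A \<nu>\<^esub> f) m \<noteq> Igt m"
  shows "m - \<nu> r \<in> \<Phi>"
proof (rule ccontr)
  assume no: "m - \<nu> r \<notin> \<Phi>"
  interpret P: comm_group "gr_piece A \<nu> m" by (rule gr_piece_comm_group)
  have empty: "{(i, j). i \<in> \<Phi> \<and> j \<in> \<Phi> \<and> i + j = m \<and> initial r i \<noteq> Igt i \<and> f j \<noteq> Igt j} = {}"
  proof (rule equals0I, clarify)
    fix i j assume "i \<in> \<Phi>" "j \<in> \<Phi>" "m = i + j" "initial r i \<noteq> Igt i"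
    then show False using initial_support[OF r, of i] no by simp
  qed
  have "(initial r \<otimes>\<^bsub>gr A \<nu>\<^esub> f) m = one (gr_piece A \<nu> m)"
    unfolding gr_mult_component[OF m] empty by (rule P.finprod_empty)
  then show False using ne gr_piece_one by simp
qed

lemma initial_mult:
  assumes r: "r \<in> carrier A" "r \<noteq> \<zero>" and s: "s \<in> carrier A" "s \<noteq> \<zero>"
  shows "initial r \<otimes>\<^bsub>gr A \<nu>\<^esub> initial s = initial (r \<otimes> s)"
proof
  fix m
  have rs: "r \<otimes> s \<noteq> \<zero>" "\<nu> (r \<otimes> s) = \<nu> r + \<nu> s" using r s val_mult by (auto simp: integral_iff)
  show "(initial r \<otimes>\<^bsub>gr A \<nu>\<^esub> initial s) m = initial (r \<otimes> s) m"
  proof (cases "m \<in> \<Phi>")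
    case False
    then show ?thesis unfolding gr_mult initial_def by simp
  next
    case True
    interpret P: comm_group "gr_piece A \<nu> m" by (rule gr_piece_comm_group)
    have set: "{(i, j). i \<in> \<Phi> \<and> j \<in> \<Phi> \<and> i + j = m \<and> initial r i \<noteq> Igt i \<and> initial s j \<noteq> Igt j}
        = (if m = \<nu> r + \<nu> s then {(\<nu> r, \<nu> s)} else {})"
      using initial_support[OF r] initial_support[OF s] value_mem[OF r] value_mem[OF s] by auto
    show ?thesis
    proof (cases "m = \<nu> r + \<nu> s")
      case m: True
      have e: "rcoset_mult A (Igt m) (initial r (\<nu> r)) (initial s (\<nu> s)) = coset m (r \<otimes> s)"
        using rcoset_mult_coset[of r "\<nu> r" s "\<nu> s"] value_mem[OF r] value_mem[OF s] r s
        unfolding initial_def m by (simp add: ideal_ge_iff)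
      have "r \<otimes> s \<in> Ige m" using r s rs m by (simp add: ideal_ge_iff)
      then have "coset m (r \<otimes> s) \<in> carrier (gr_piece A \<nu> m)" unfolding gr_piece_carrier by blast
      then have "finprod (gr_piece A \<nu> m) (\<lambda>(i, j). rcoset_mult A (Igt m) (initial r i) (initial s j))
          {(\<nu> r, \<nu> s)} = coset m (r \<otimes> s)"
        using P.finprod_insert[of "{}" "(\<nu> r, \<nu> s)"
            "\<lambda>(i, j). rcoset_mult A (Igt m) (initial r i) (initial s j)"] e P.r_one by simp
      then have "(initial r \<otimes>\<^bsub>gr A \<nu>\<^esub> initial s) m = coset m (r \<otimes> s)"
        unfolding gr_mult_component[OF True] set using m by simp
      then show ?thesis unfolding initial_def using True rs(2) m by simp
    next
      case m: False
      then have "(initial r \<otimes>\<^bsub>gr A \<nu>\<^esub> initial s) m = Igt m"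
        unfolding gr_mult_component[OF True] set by (simp add: gr_piece_one)
      then show ?thesis unfolding initial_def using True rs(2) m by simp
    qed
  qed
qed

lemma initial_pow:
  assumes "r \<in> carrier A" "r \<noteq> \<zero>"
  shows "initial r [^]\<^bsub>gr A \<nu>\<^esub> (n::nat) = initial (r [^] n)"
proof (induction n)
  case 0
  have "initial r [^]\<^bsub>gr A \<nu>\<^esub> (0::nat) = \<one>\<^bsub>gr A \<nu>\<^esub>" by (simp add: nat_pow_def)
  then show ?case using gr_one by simp
next
  case (Suc n)
  have "initial r [^]\<^bsub>gr A \<nu>\<^esub> Suc n = initial r [^]\<^bsub>gr A \<nu>\<^esub> n \<otimes>\<^bsub>gr A \<nu>\<^esub> initial r"
    by (simp add: nat_pow_def)
  then show ?case using Suc initial_mult[of "r [^] n" r] val_pow(1)[OF assms] assms by simp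
qed

text \<open>If \<open>d + q u\<close> with \<open>u = \<nu> a - \<nu> b\<close> is the value of \<open>s\<close>, then \<open>initial b ^ q \<otimes> initial s\<close> equals
  \<open>initial (w \<otimes> a) ^ q \<otimes> initial c\<close> for some \<open>w\<close> in \<open>k\<close>. The splitting \<open>h\<close> therefore satisfies
  \<open>initial b \<otimes> h (initial s) = initial (w \<otimes> a)\<close>, and in degree \<open>\<nu> a\<close> the left-hand side can only
  be nonzero if \<open>\<nu> a - \<nu> b\<close> is a value.\<close>

lemma split_F_regular_value_monoid:
  assumes F: "split_F_regular p (gr A \<nu>)"
    and diff: "\<And>u. \<exists>a\<in>\<Phi>. \<exists>b\<in>\<Phi>. u = a - b"
    and residue: "\<And>r s. r \<in> carrier A - {\<zero>} \<Longrightarrow> s \<in> carrier A - {\<zero>} \<Longrightarrow> \<nu> r = \<nu> s \<Longrightarrow>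
      \<exists>t\<in>k - {\<zero>}. r \<ominus> t \<otimes> s = \<zero> \<or> \<nu> r < \<nu> (r \<ominus> t \<otimes> s)"
    and k: "k \<subseteq> carrier A" "\<And>t. t \<in> k - {\<zero>} \<Longrightarrow> \<nu> t = 0"
    and root: "\<And>t n. t \<in> k \<Longrightarrow> 0 < (n::nat) \<Longrightarrow> \<exists>s\<in>k. s [^] n = t"
    and d: "d \<in> \<Phi>"
  shows "\<exists>q\<ge>2. \<forall>u. d + q *\<^sub>z u \<in> \<Phi> \<longrightarrow> u \<in> \<Phi>"
proof -
  obtain c where c: "c \<in> carrier A" "c \<noteq> \<zero>" "\<nu> c = d" using value_cases[OF d] .
  interpret G: domain "gr A \<nu>" using F unfolding split_F_regular_def by blast
  have p: "2 \<le> p" using F prime_ge_2_nat unfolding split_F_regular_def by blast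
  have "initial c \<noteq> \<zero>\<^bsub>gr A \<nu>\<^esub>"
  proof
    assume "initial c = \<zero>\<^bsub>gr A \<nu>\<^esub>"
    then have "initial c d = Igt d" unfolding gr_zero using d by simp
    then show False using initial_support[OF c(1,2) d] c(3) by simp
  qed
  then obtain e where e: "0 < e" and "module_splits (gr A \<nu>) (self_module (gr A \<nu>))
      (frobenius_module p e (gr A \<nu>)) (\<lambda>a. a \<odot>\<^bsub>frobenius_module p e (gr A \<nu>)\<^esub> initial c)"
    using F initial_closed[OF c(1)] unfolding split_F_regular_def by blast
  then obtain h where h: "h \<in> module_hom (gr A \<nu>) (frobenius_module p e (gr A \<nu>)) (self_module (gr A \<nu>))"
    and split: "\<And>x. x \<in> carrier (gr A \<nu>) \<Longrightarrow> h (x [^]\<^bsub>gr A \<nu>\<^esub> (p ^ e) \<otimes>\<^bsub>gr A \<nu>\<^esub> initial c) = x"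
    unfolding module_splits_def self_module_def frobenius_module_def by auto
  have linear: "h (x [^]\<^bsub>gr A \<nu>\<^esub> (p ^ e) \<otimes>\<^bsub>gr A \<nu>\<^esub> y) = x \<otimes>\<^bsub>gr A \<nu>\<^esub> h y"
    if "x \<in> carrier (gr A \<nu>)" "y \<in> carrier (gr A \<nu>)" for x y
    using h that unfolding module_hom_def self_module_def frobenius_module_def by auto
  define q where "q = p ^ e"
  have q2: "2 \<le> q" unfolding q_def using p e by (metis self_le_power order_trans one_le_numeral)
  have "u \<in> \<Phi>" if u: "d + int q *\<^sub>z u \<in> \<Phi>" for u
  proof -
    obtain i j where ij: "i \<in> \<Phi>" "j \<in> \<Phi>" "u = i - j" using diff by blast
    obtain a where a: "a \<in> carrier A" "a \<noteq> \<zero>" "\<nu> a = i" using value_cases[OF ij(1)] .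
    obtain b where b: "b \<in> carrier A" "b \<noteq> \<zero>" "\<nu> b = j" using value_cases[OF ij(2)] .
    obtain s where s: "s \<in> carrier A" "s \<noteq> \<zero>" "\<nu> s = d + int q *\<^sub>z u" using value_cases[OF u] .
    \<comment> \<open>With \<open>u = i - j\<close>, both \<open>x\<close> and \<open>y\<close> have
      value \<open>q i + d\<close>, so their initial forms can be compared.\<close>
    define x where "x = b [^] q \<otimes> s"
    define y where "y = a [^] q \<otimes> c"
    have xy: "x \<in> carrier A - {\<zero>}" "y \<in> carrier A - {\<zero>}"
      unfolding x_def y_def using a b c s val_pow(1) by (auto simp: integral_iff)
    have "\<nu> x = int q *\<^sub>z j + (d + int q *\<^sub>z u)"
      unfolding x_def using val_mult[of "b [^] q" s] val_pow[OF b(1,2), of q] b s by simp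
    also have "\<dots> = int q *\<^sub>z i + d" unfolding ij(3) by (simp add: zmod.scale_right_diff_distrib)
    also have "\<dots> = \<nu> y"
      unfolding y_def using val_mult[of "a [^] q" c] val_pow[OF a(1,2), of q] a c by simp
    finally have vxy: "\<nu> x = \<nu> y" .
    obtain t where t: "t \<in> k - {\<zero>}" "x \<ominus> t \<otimes> y = \<zero> \<or> \<nu> x < \<nu> (x \<ominus> t \<otimes> y)"
      using residue[OF xy vxy] by blast
    \<comment> \<open>The scalar relating the leading terms is a \<open>q\<close>-th power, so it
      can be absorbed into \<open>a\<close> before the splitting is applied.\<close>
    obtain w where w: "w \<in> k" "w [^] q = t" using root[of t q] t q2 by auto
    have "w \<noteq> \<zero>" using w(2) t(1) q2 nat_pow_zero[of q] by auto
    then have w': "w \<in> carrier A" "w \<noteq> \<zero>" "\<nu> w = 0" using w(1) k by auto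
    define z where "z = w \<otimes> a"
    have z: "z \<in> carrier A" "z \<noteq> \<zero>" "\<nu> z = i"
      unfolding z_def using w' a val_mult[of w a] by (auto simp: integral_iff)
    have tA: "t \<in> carrier A" "t \<noteq> \<zero>" "\<nu> t = 0" using t(1) k by auto
    have "initial x = initial (t \<otimes> y)"
      using initial_eqI[of x "t \<otimes> y"] xy t(2) tA vxy val_mult[of t y] by simp
    also have "t \<otimes> y = z [^] q \<otimes> c"
      unfolding y_def z_def w(2)[symmetric] using w' a c by (simp add: nat_pow_distrib m_assoc)
    finally have eq: "initial x = initial (z [^] q \<otimes> c)" .
    have ix: "initial x = initial b [^]\<^bsub>gr A \<nu>\<^esub> q \<otimes>\<^bsub>gr A \<nu>\<^esub> initial s"
      unfolding x_def using initial_mult[of "b [^] q" s] initial_pow[OF b(1,2)] val_pow[OF b(1,2)] b s by simp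
    have iz: "initial (z [^] q \<otimes> c) = initial z [^]\<^bsub>gr A \<nu>\<^esub> q \<otimes>\<^bsub>gr A \<nu>\<^esub> initial c"
      using initial_mult[of "z [^] q" c] initial_pow[OF z(1,2)] val_pow[OF z(1,2)] z c by simp
    have "initial b \<otimes>\<^bsub>gr A \<nu>\<^esub> h (initial s) = h (initial x)"
      unfolding ix unfolding q_def using linear[OF initial_closed initial_closed] b s by simp
    also have "\<dots> = initial z" unfolding eq iz unfolding q_def using split[OF initial_closed] z by simp
    finally have "(initial b \<otimes>\<^bsub>gr A \<nu>\<^esub> h (initial s)) i \<noteq> Igt i"
      using initial_support[OF z(1,2) ij(1)] z(3) by simp
    then have "i - j \<in> \<Phi>" using initial_mult_support[OF b(1,2) ij(1)] b(3) by simp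
    then show ?thesis using ij(3) by simp
  qed
  then show ?thesis using q2 by (intro exI[of _ "int q"]) auto
qed

lemma initial_in_generated:
  assumes E: "\<And>g. g \<in> E \<Longrightarrow> \<rho> g \<in> carrier A \<and> \<rho> g \<noteq> \<zero> \<and> \<nu> (\<rho> g) = g"
    and m: "m \<in> monoid_gen E" and H: "initial ` \<rho> ` E \<subseteq> H"
  shows "\<exists>z\<in>carrier A. z \<noteq> \<zero> \<and> \<nu> z = m \<and> initial z \<in> generate_ring (gr A \<nu>) H"
  using m
proof (induction rule: monoid_gen.induct)
  case zero
  then show ?case using val_one gr_one generate_ring.one[of "gr A \<nu>" H] by (intro bexI[of _ \<one>]) auto
next
  case (add g m)
  then obtain z where z: "z \<in> carrier A" "z \<noteq> \<zero>" "\<nu> z = m" "initial z \<in> generate_ring (gr A \<nu>) H" by blast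
  have g: "\<rho> g \<in> carrier A" "\<rho> g \<noteq> \<zero>" "\<nu> (\<rho> g) = g" using E[OF add(1)] by auto
  have "initial (\<rho> g \<otimes> z) \<in> generate_ring (gr A \<nu>) H"
    using generate_ring.eng_mult[OF generate_ring.incl z(4), of "initial (\<rho> g)"] add(1) H
      initial_mult[OF g(1,2) z(1,2)] by auto
  then show ?case using g z val_mult[of "\<rho> g" z] by (intro bexI[of _ "\<rho> g \<otimes> z"]) (auto simp: integral_iff)
qed

text \<open>By the residue condition an initial form is a scalar multiple of a product of chosen
  initial forms of the same degree. A general element has finite support and is stripped of one
  homogeneous component at a time.\<close>

lemma gr_finitely_generated:
  assumes G: "domain (gr A \<nu>)"
    and residue: "\<And>r s. r \<in> carrier A - {\<zero>} \<Longrightarrow> s \<in> carrier A - {\<zero>} \<Longrightarrow> \<nu> r = \<nu> s \<Longrightarrow>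
      \<exists>t\<in>k - {\<zero>}. r \<ominus> t \<otimes> s = \<zero> \<or> \<nu> r < \<nu> (r \<ominus> t \<otimes> s)"
    and k: "k \<subseteq> carrier A" "\<And>t. t \<in> k - {\<zero>} \<Longrightarrow> \<nu> t = 0"
    and E: "finite E" "E \<subseteq> \<Phi>" "\<Phi> \<subseteq> monoid_gen E"
  shows "fin_gen_algebra (gr A \<nu>) (gr_const A \<nu> ` k)"
proof -
  interpret G: domain "gr A \<nu>" by (rule G)
  have "\<forall>g\<in>E. \<exists>r. r \<in> carrier A \<and> r \<noteq> \<zero> \<and> \<nu> r = g"
    using E(2) value_cases by (metis subsetD)
  from bchoice[OF this] obtain \<rho>
    where \<rho>: "\<And>g. g \<in> E \<Longrightarrow> \<rho> g \<in> carrier A \<and> \<rho> g \<noteq> \<zero> \<and> \<nu> (\<rho> g) = g" by blast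
  define H where "H = gr_const A \<nu> ` k \<union> initial ` \<rho> ` E"
  have const: "gr_const A \<nu> c \<in> carrier (gr A \<nu>)" if "c \<in> k" for c
  proof (cases "c = \<zero>")
    case True
    then have "gr_const A \<nu> c = \<zero>\<^bsub>gr A \<nu>\<^esub>"
      using coset_zero[of 0] unfolding gr_const_def gr_zero coset_def by (intro restrict_ext) simp
    then show ?thesis by simp
  next
    case False
    then show ?thesis using that k gr_const_eq_initial[of c] initial_closed[of c] by auto
  qed
  have Hc: "H \<subseteq> carrier (gr A \<nu>)" unfolding H_def using const initial_closed \<rho> by auto
  have init: "initial r \<in> generate_ring (gr A \<nu>) H" if r: "r \<in> carrier A" "r \<noteq> \<zero>" for r
  proof -
    have "\<nu> r \<in> monoid_gen E" using E(3) value_mem[OF r] by blast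
    then obtain z where z: "z \<in> carrier A" "z \<noteq> \<zero>" "\<nu> z = \<nu> r" "initial z \<in> generate_ring (gr A \<nu>) H"
      using initial_in_generated[OF \<rho>, of E "\<nu> r" H] H_def by blast
    obtain t where t: "t \<in> k" "t \<noteq> \<zero>" "r \<ominus> t \<otimes> z = \<zero> \<or> \<nu> r < \<nu> (r \<ominus> t \<otimes> z)"
      using residue[of r z] r z by auto
    have t': "t \<in> carrier A" "\<nu> t = 0" using t k by auto
    have "initial r = initial (t \<otimes> z)"
      using initial_eqI[of r "t \<otimes> z"] r z t t' val_mult[of t z] by simp
    also have "\<dots> = gr_const A \<nu> t \<otimes>\<^bsub>gr A \<nu>\<^esub> initial z"
      using initial_mult[OF t'(1) t(2) z(1,2)] gr_const_eq_initial[OF t'(2)] by simp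
    also have "\<dots> \<in> generate_ring (gr A \<nu>) H"
      by (rule generate_ring.eng_mult[OF generate_ring.incl z(4)]) (use t(1) in \<open>simp add: H_def\<close>)
    finally show ?thesis .
  qed
  have zero: "\<zero>\<^bsub>gr A \<nu>\<^esub> \<in> generate_ring (gr A \<nu>) H"
    using generate_ring.eng_add[OF generate_ring.one generate_ring.a_inv[OF generate_ring.one]] G.r_neg[OF G.one_closed] by metis
  have gen: "f \<in> generate_ring (gr A \<nu>) H" if "f \<in> carrier (gr A \<nu>)" for f
    using that
  proof (induction "card {m \<in> \<Phi>. f m \<noteq> Igt m}" arbitrary: f rule: less_induct)
    case less
    have fP: "f \<in> (\<Pi>\<^sub>E m\<in>\<Phi>. coset m ` Ige m)" and fin: "finite {m \<in> \<Phi>. f m \<noteq> Igt m}"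
      using less.prems unfolding gr_carrier by auto
    show ?case
    proof (cases "{m \<in> \<Phi>. f m \<noteq> Igt m} = {}")
      case True
      then have "f = \<zero>\<^bsub>gr A \<nu>\<^esub>"
        unfolding gr_zero using fP by (intro extensionalityI[of _ \<Phi>]) (auto simp: PiE_def)
      then show ?thesis using zero by simp
    next
      case False
      then obtain n where n: "n \<in> \<Phi>" "f n \<noteq> Igt n" by blast
      obtain r where r: "r \<in> Ige n" "f n = coset n r" using fP n(1) by blast
      have rc: "r \<in> carrier A" using r(1) by (simp add: ideal_ge_iff)
      have "r \<notin> Igt n" using n(2) r(2) coset_eq_ideal_iff[OF rc] by simp
      then have r0: "r \<noteq> \<zero>" "\<nu> r = n" using r(1) by (auto simp: ideal_ge_iff ideal_gt_iff)
      define f' where "f' = f(n := Igt n)"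
      have sub: "{m \<in> \<Phi>. f' m \<noteq> Igt m} = {m \<in> \<Phi>. f m \<noteq> Igt m} - {n}" unfolding f'_def by auto
      have "Igt n = coset n \<zero>" "\<zero> \<in> Ige n" by (simp_all add: coset_zero ideal_ge_iff)
      then have "Igt n \<in> coset n ` Ige n" by blast
      then have "f' \<in> (\<Pi>\<^sub>E m\<in>\<Phi>. coset m ` Ige m)"
        unfolding f'_def using fP n(1) by (simp add: PiE_iff extensional_def)
      moreover have "finite {m \<in> \<Phi>. f' m \<noteq> Igt m}" unfolding sub using fin by simp
      ultimately have f': "f' \<in> carrier (gr A \<nu>)" unfolding gr_carrier by blast
      have "card {m \<in> \<Phi>. f' m \<noteq> Igt m} < card {m \<in> \<Phi>. f m \<noteq> Igt m}"
        unfolding sub using fin n by (intro card_Diff1_less) auto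
      then have "f' \<in> generate_ring (gr A \<nu>) H" using less.hyps f' by blast
      moreover have "f = initial r \<oplus>\<^bsub>gr A \<nu>\<^esub> f'"
      proof
        fix m
        show "f m = (initial r \<oplus>\<^bsub>gr A \<nu>\<^esub> f') m"
        proof (cases "m \<in> \<Phi>")
          case False
          then show ?thesis using fP unfolding gr_add by (auto simp: PiE_def extensional_def)
        next
          case True
          have "f m \<in> coset m ` Ige m" using PiE_mem[OF fP True] .
          then obtain s where "s \<in> Ige m" "f m = coset m s" by blast
          then have s: "s \<in> carrier A" "f m = coset m s" by (simp_all add: ideal_ge_iff)
          show ?thesis
          proof (cases "m = n")
            case mn: True
            then have "(initial r \<oplus>\<^bsub>gr A \<nu>\<^esub> f') m
                = monoid.mult (gr_piece A \<nu> n) (coset n r) (coset n \<zero>)"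
              unfolding gr_add initial_def f'_def using True r0 by (simp add: coset_zero)
            then show ?thesis using gr_piece_mult[OF rc zero_closed] rc r(2) mn by simp
          next
            case mn: False
            then have "(initial r \<oplus>\<^bsub>gr A \<nu>\<^esub> f') m
                = monoid.mult (gr_piece A \<nu> m) (coset m \<zero>) (coset m s)"
              unfolding gr_add initial_def f'_def using True r0 s by (simp add: coset_zero)
            then show ?thesis using gr_piece_mult[OF zero_closed s(1)] s by simp
          qed
        qed
      qed
      ultimately show ?thesis using generate_ring.eng_add[OF init[OF rc r0(1)]] by simp
    qed
  qed
  have "generate_ring (gr A \<nu>) H = carrier (gr A \<nu>)"
    using gen G.generate_ring_in_carrier[OF Hc] by blast
  moreover have "initial ` \<rho> ` E \<subseteq> carrier (gr A \<nu>)" using Hc H_def by blast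
  moreover have "finite (initial ` \<rho> ` E)" using E(1) by simp
  ultimately show ?thesis unfolding fin_gen_algebra_def H_def by blast
qed

end

section \<open>Transfer from \<open>K\<close> to the graded ring of \<open>R\<close>\<close>

theorem mainTheorem4:
  fixes K :: "('a, 'b) ring_scheme" and k R \<mm> :: "'a set" and p :: nat
    and \<nu> :: "'a \<Rightarrow> 'g::linordered_ab_group_add"
  assumes "field K" and "subfield k K"
    and "algebraically_closed (K\<lparr>carrier := k\<rparr>)"
    and "Factorial_Ring.prime p" and "ring_char (K\<lparr>carrier := k\<rparr>) p"
    and "fin_gen_field_ext K k"
    and "valuation_over K k \<nu>"
    and "\<exists>(B :: 'g rat_tensor set) S. rat_tensor_basis B \<and> transcendence_basis K k S \<and> B \<approx> S"
    and "subring R K" and "k \<subseteq> R"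
    and "noetherian_ring (K\<lparr>carrier := R\<rparr>)" and "local_ring (K\<lparr>carrier := R\<rparr>) \<mm>"
    and "is_fraction_field K R"
    and "centered_on K \<nu> R \<mm>"
    and "split_F_regular p (gr (K\<lparr>carrier := R\<rparr>) \<nu>)"
  shows "fin_gen_algebra (gr (K\<lparr>carrier := R\<rparr>) \<nu>) (gr_const (K\<lparr>carrier := R\<rparr>) \<nu> ` k)"
proof -
  interpret K: field K by (rule assms(1))
  let ?A = "K\<lparr>carrier := R\<rparr>"
  have RK: "R \<subseteq> carrier K" using subringE(1)[OF assms(9)] .
  have "domain ?A" using K.subring_is_domain[OF assms(9)] .
  then interpret A: valued_domain ?A \<nu>
  proof (rule valued_domain.intro, unfold_locales)
    fix x y assume "x \<in> carrier ?A" "x \<noteq> \<zero>\<^bsub>?A\<^esub>" "y \<in> carrier ?A" "y \<noteq> \<zero>\<^bsub>?A\<^esub>"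
    then have xy: "x \<in> carrier K - {\<zero>\<^bsub>K\<^esub>}" "y \<in> carrier K - {\<zero>\<^bsub>K\<^esub>}" using RK by auto
    then show "\<nu> (x \<otimes>\<^bsub>?A\<^esub> y) = \<nu> x + \<nu> y"
      using assms(7) unfolding valuation_over_def by simp
    show "min (\<nu> x) (\<nu> y) \<le> \<nu> (x \<oplus>\<^bsub>?A\<^esub> y)" if "x \<oplus>\<^bsub>?A\<^esub> y \<noteq> \<zero>\<^bsub>?A\<^esub>"
      using assms(7) xy that unfolding valuation_over_def by simp
  qed
  interpret V: valued_pair K k \<nu>
    using assms(1,2,7)
    by (simp add: valued_pair_def subfield_pair_def subfield_pair_axioms_def valued_pair_axioms_def)
  have Phi: "value_monoid ?A \<nu> = \<nu> ` (R - {\<zero>\<^bsub>K\<^esub>})" unfolding value_monoid_def by simp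
  \<comment> \<open>Negation in the restricted ring refers to its own carrier; uniqueness of
    additive inverses identifies it with negation in \<open>K\<close>.\<close>
  have minus: "r \<ominus>\<^bsub>?A\<^esub> s = r \<ominus>\<^bsub>K\<^esub> s" if "r \<in> R" "s \<in> R" for r s
  proof -
    have "\<ominus>\<^bsub>?A\<^esub> s = \<ominus>\<^bsub>K\<^esub> s"
    proof (rule K.minus_equality[symmetric])
      show "\<ominus>\<^bsub>?A\<^esub> s \<oplus>\<^bsub>K\<^esub> s = \<zero>\<^bsub>K\<^esub>" using A.l_neg[of s] that by simp
      show "\<ominus>\<^bsub>?A\<^esub> s \<in> carrier K" using A.a_inv_closed[of s] that RK by auto
    qed (use that RK in auto)
    then show ?thesis unfolding a_minus_def by simp
  qed
  note rank = maximal_rational_rank[OF assms(1,2,3,6,7,8)]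
  have residue: "\<exists>t\<in>k - {\<zero>\<^bsub>?A\<^esub>}. r \<ominus>\<^bsub>?A\<^esub> t \<otimes>\<^bsub>?A\<^esub> s = \<zero>\<^bsub>?A\<^esub> \<or> \<nu> r < \<nu> (r \<ominus>\<^bsub>?A\<^esub> t \<otimes>\<^bsub>?A\<^esub> s)"
    if r: "r \<in> carrier ?A - {\<zero>\<^bsub>?A\<^esub>}" and s: "s \<in> carrier ?A - {\<zero>\<^bsub>?A\<^esub>}" and eq: "\<nu> r = \<nu> s" for r s
  proof -
    have "r \<in> carrier K - {\<zero>\<^bsub>K\<^esub>}" "s \<in> carrier K - {\<zero>\<^bsub>K\<^esub>}" using r s RK by auto
    then obtain t where t: "t \<in> k - {\<zero>\<^bsub>K\<^esub>}"
      "r \<ominus>\<^bsub>K\<^esub> t \<otimes>\<^bsub>K\<^esub> s = \<zero>\<^bsub>K\<^esub> \<or> \<nu> r < \<nu> (r \<ominus>\<^bsub>K\<^esub> t \<otimes>\<^bsub>K\<^esub> s)"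
      using rank(2) eq by blast
    have "t \<otimes>\<^bsub>K\<^esub> s \<in> R" using t(1) s assms(10) subringE(6)[OF assms(9)] by auto
    then have "r \<ominus>\<^bsub>?A\<^esub> t \<otimes>\<^bsub>?A\<^esub> s = r \<ominus>\<^bsub>K\<^esub> t \<otimes>\<^bsub>K\<^esub> s" using minus r by simp
    then show ?thesis using t by (intro bexI[of _ t]) auto
  qed
  have k: "k \<subseteq> carrier ?A" "\<And>t. t \<in> k - {\<zero>\<^bsub>?A\<^esub>} \<Longrightarrow> \<nu> t = 0"
    using assms(10) V.val_base by auto
  have root: "\<exists>s\<in>k. s [^]\<^bsub>?A\<^esub> n = t" if "t \<in> k" "0 < (n::nat)" for t n
    using V.ex_power_root[OF assms(3) that] by (simp add: nat_pow_def)
  \<comment> \<open>Every element of \<Gamma> is the value of a fraction of elements of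
    \<open>R\<close>, hence a difference of two elements of \<Phi>.\<close>
  have diff: "\<exists>a\<in>value_monoid ?A \<nu>. \<exists>b\<in>value_monoid ?A \<nu>. u = a - b" for u
  proof -
    obtain x where x: "x \<in> carrier K" "x \<noteq> \<zero>\<^bsub>K\<^esub>" "\<nu> x = u" by (rule V.val_surj)
    obtain a b where ab: "a \<in> R" "b \<in> R - {\<zero>\<^bsub>K\<^esub>}" "x = a \<otimes>\<^bsub>K\<^esub> inv\<^bsub>K\<^esub> b"
      using x(1) assms(13) unfolding is_fraction_field_def by blast
    have c: "a \<in> carrier K" "b \<in> carrier K" "b \<noteq> \<zero>\<^bsub>K\<^esub>" using ab RK by auto
    then have i: "inv\<^bsub>K\<^esub> b \<in> carrier K" using K.field_Units by auto
    have a0: "a \<noteq> \<zero>\<^bsub>K\<^esub>" "inv\<^bsub>K\<^esub> b \<noteq> \<zero>\<^bsub>K\<^esub>" using x(2) c i unfolding ab(3) by auto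
    have "u = \<nu> a - \<nu> b"
      using x(3) V.val_mult[OF c(1) a0(1) i a0(2)] V.val_inv[OF c(2,3)] unfolding ab(3) by simp
    moreover have "\<nu> a \<in> value_monoid ?A \<nu>" "\<nu> b \<in> value_monoid ?A \<nu>"
      unfolding Phi using ab a0 by auto
    ultimately show ?thesis by blast
  qed
  have F_reg: "\<exists>q\<ge>2. \<forall>u. d + q *\<^sub>z u \<in> value_monoid ?A \<nu> \<longrightarrow> u \<in> value_monoid ?A \<nu>"
    if "d \<in> value_monoid ?A \<nu>" for d
    by (rule A.split_F_regular_value_monoid[OF assms(15) diff residue k root that])
  obtain E :: "'g set" where E: "finite E" "zmod.span E = UNIV" using rank(1) by blast
  have zero: "0 \<in> value_monoid ?A \<nu>"
    using A.value_mem[OF A.one_closed A.one_not_zero] A.val_one by simp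
  have add: "x + y \<in> value_monoid ?A \<nu>"
    if xy: "x \<in> value_monoid ?A \<nu>" "y \<in> value_monoid ?A \<nu>" for x y
  proof -
    obtain r where r: "r \<in> carrier ?A" "r \<noteq> \<zero>\<^bsub>?A\<^esub>" "\<nu> r = x" using A.value_cases[OF xy(1)] .
    obtain s where s: "s \<in> carrier ?A" "s \<noteq> \<zero>\<^bsub>?A\<^esub>" "\<nu> s = y" using A.value_cases[OF xy(2)] .
    show ?thesis
      using A.value_mem[of "r \<otimes>\<^bsub>?A\<^esub> s"] A.val_mult[OF r(1,2) s(1,2)] A.integral[of r s] A.m_closed[OF r(1) s(1)] r s
      by metis
  qed
  \<comment> \<open>The center enters here: \<open>R\<close> lies in the valuation ring, and
    nonnegative values make \<Phi> pointed.\<close>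
  have nonneg: "0 \<le> x" if "x \<in> value_monoid ?A \<nu>" for x
    using that assms(14) unfolding Phi centered_on_def val_ring_def by auto
  obtain G where G: "finite G" "G \<subseteq> value_monoid ?A \<nu>" "value_monoid ?A \<nu> \<subseteq> monoid_gen G"
    using F_regular_submonoid_finitely_generated[OF zero add nonneg diff F_reg E] by blast
  have "domain (gr ?A \<nu>)" using assms(15) unfolding split_F_regular_def by blast
  then show ?thesis by (rule A.gr_finitely_generated[OF _ residue k G])
qed

end
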